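(* Let $D>0$ be a square-free integer, let $M=\mathbb{Q}(\sqrt{-D})$ with ring of integers $\mathbb{Z}_M$, let $t\in\mathbb{Z}_M$, and let $\xi$ be a root of \[ f(x)=x^4-4tx^3+(6t+2)x^2+4tx+1\in\mathbb{Z}_M[x]. \] Let $K=M(\xi)$ and $\mathcal{O}=\mathbb{Z}_M[\xi]$. If $|t|>1544803$, then, up to equivalence, the generators of relative power integral bases of $\mathcal{O}$ over $\mathbb{Z}_M$ are exactly \[ \alpha=\xi\quad\text{and}\quad \alpha=(6t+2)\xi-4t\xi^2+\xi^3. \]
   Context: An element $\alpha\in\mathcal{O}$ generates a relative power integral basis of $\mathcal{O}$ over $\mathbb{Z}_M$ if $\mathcal{O}=\mathbb{Z}_M[\alpha]$, i.e. $1,\alpha,\alpha^2,\alpha^3$ is a $\mathbb{Z}_M$-module basis of $\mathcal{O}$ (equivalently, the relative index $(\mathcal{O}^+:\mathbb{Z}_M[\alpha]^+)$ equals $1$). Two elements of $\mathcal{O}$ are called equivalent if one is obtained from the other by multiplication by a unit and translation by an element of $\mathbb{Z}_M$. $|t|$ denotes the complex absolute value. *)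

theory Defs
  imports "HOL-Analysis.Analysis" "HOL-Computational_Algebra.Computational_Algebra"
begin

text \<open>All fields and rings are realised as subsets of the complex numbers.\<close>

definition imag_quadratic_field :: "int \<Rightarrow> complex set" where
  "imag_quadratic_field D = {of_rat a + of_rat b * csqrt (- of_int D) | a b. True}"

definition ring_of_integers :: "complex set \<Rightarrow> complex set" where
  "ring_of_integers M = {z \<in> M. algebraic_int z}"

definition ring_adjoin :: "complex set \<Rightarrow> complex \<Rightarrow> complex set" where
  "ring_adjoin R \<alpha> = {poly p \<alpha> | p. \<forall>i. coeff p i \<in> R}"

text \<open>
  Here \<open>R\<close> is a subring of the complex numbers and \<open>A\<close> an \<open>R\<close>-submodule. The coefficient
  families are extensional (undefined outside \<open>{..<n}\<close>), so that uniqueness of \<open>c\<close> is uniqueness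
  of the coefficients \<open>c 0, \<dots>, c (n - 1)\<close>.
\<close>

definition is_module_basis :: "complex set \<Rightarrow> complex set \<Rightarrow> nat \<Rightarrow> (nat \<Rightarrow> complex) \<Rightarrow> bool" where
  "is_module_basis R A n b \<longleftrightarrow>
     (\<forall>i<n. b i \<in> A) \<and>
     (\<forall>x\<in>A. \<exists>!c. c \<in> {..<n} \<rightarrow>\<^sub>E R \<and> x = (\<Sum>i<n. c i * b i))"

text \<open>
  The order \<open>A\<close> is of rank 4 over \<open>R\<close>. The second conjunct already implies \<open>ring_adjoin R \<alpha> = A\<close>
  when \<open>A\<close> is a ring containing \<open>R\<close>; both are kept because the notion is usually introduced by
  either one.
\<close>

definition generates_relative_power_basis :: "complex set \<Rightarrow> complex set \<Rightarrow> complex \<Rightarrow> bool" where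
  "generates_relative_power_basis R A \<alpha> \<longleftrightarrow>
     \<alpha> \<in> A \<and> A = ring_adjoin R \<alpha> \<and> is_module_basis R A 4 (\<lambda>i. \<alpha> ^ i)"

text \<open>The multiplier is a unit of the base ring \<open>R\<close>, not of the larger order.\<close>

definition equivalent_over :: "complex set \<Rightarrow> complex \<Rightarrow> complex \<Rightarrow> bool" where
  "equivalent_over R \<alpha> \<beta> \<longleftrightarrow>
     (\<exists>\<epsilon>\<in>R. \<exists>a\<in>R. (\<exists>\<eta>\<in>R. \<epsilon> * \<eta> = 1) \<and> \<beta> = \<epsilon> * \<alpha> + a)"

end

theory Submission
  imports Defs "HOL-Complex_Analysis.Complex_Analysis"
begin

text \<open>
  With \<open>p\<^sup>2 = 2 t + 1\<close>, \<open>q\<^sup>2 = 2 t - 4\<close>, \<open>r\<^sup>2 = 2 t\<close> every root of the quartic is of the form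
  \<open>\<xi> = (r + p) (r + q) / 2\<close>, and an element of the order is
  \<open>const + (U p q + Z r p + V r q) / 2\<close> with \<open>U, V, Z\<close> in the base ring \<open>R\<close>. Its relative index is
  a product of three quadratic forms in \<open>U, V, Z\<close> with values in \<open>R\<close>, so for a generator all
  three values are units. A linear relation between the forms, with coefficients of size \<open>t\<close>, forces
  them to be the same unit \<open>\<epsilon>\<close>, which gives the relative Pell equations
  \<open>(2 t + 1) U\<^sup>2 - 2 t V\<^sup>2 = \<epsilon>\<close> and \<open>(t - 2) U\<^sup>2 - t Z\<^sup>2 = - 2 \<epsilon>\<close>. The solutions of each one form a
  recurrent sequence, by descent, and congruences modulo \<open>t\<^sup>2\<close> show that a common nontrivial solution
  has \<open>\<bar>U\<bar> \<ge> \<bar>t\<bar>\<^sup>2\<^sup>4\<close>. Then \<open>V / U\<close> and \<open>Z / U\<close> approximate \<open>\<surd>(1 + 1 / (2 t))\<close> and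
  \<open>\<surd>(1 - 4 / (2 t))\<close> too well, contradicting the Hermite-Pade approximations of Rickert and Bennett.
  So \<open>U\<^sup>2 = V\<^sup>2 = Z\<^sup>2 = \<epsilon>\<close>, which leaves only the two stated classes.
\<close>

section \<open>Integers of imaginary quadratic fields\<close>

text \<open>What makes an imaginary quadratic base special is that nonzero elements of
  \<open>R\<close> have absolute value at least 1: an element estimated below 1 is 0, and if a
  product equals 1, all its factors have absolute value 1. Almost every step uses one of these two
  facts.

  The constants fit together as follows. With N = 2 t, the numbers N, N + 1 and N - 4 are
  \<open>r\<^sup>2\<close>, \<open>p\<^sup>2\<close> and \<open>q\<^sup>2\<close>, so the
  approximations are built on the points 0, 1, -4. Put n = |N|. After clearing denominators the k-th
  remainder is about (1440 / n^2)^k and the coefficients are about (360 n)^k. When |U| is close to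
  (n^2 / 1440)^k, the error of V / U and Z / U contributes about (518400 / n)^k, where 518400 = 360
  * 1440. The bound on |t| gives n >= 3000000, so this ratio is below 1/5. The accumulated constants
  are beaten only after eleven such factors, that is, once |U| >= n^22. The gap |t|^24 supplies
  this, two powers of t paying for 2^22.\<close>

locale discrete_subring =
  fixes R :: "complex set"
  assumes one [simp, intro]: "1 \<in> R"
    and diff [intro]: "x \<in> R \<Longrightarrow> y \<in> R \<Longrightarrow> x - y \<in> R"
    and mult [intro]: "x \<in> R \<Longrightarrow> y \<in> R \<Longrightarrow> x * y \<in> R"
    and norm_sq: "x \<in> R \<Longrightarrow> \<exists>n::nat. (cmod x)\<^sup>2 = real n"
begin

lemma zero [simp, intro]: "0 \<in> R"
  using diff[OF one one] by simp

lemma uminus [intro]: "x \<in> R \<Longrightarrow> - x \<in> R"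
  using diff[OF zero, of x] by simp

lemma add [intro]: "x \<in> R \<Longrightarrow> y \<in> R \<Longrightarrow> x + y \<in> R"
  using diff[of x "- y"] uminus[of y] by simp

lemma power [intro]: "x \<in> R \<Longrightarrow> x ^ n \<in> R"
  by (induction n) auto

lemma of_nat [simp, intro]: "of_nat n \<in> R"
  by (induction n) auto

lemma of_int [simp, intro]: "of_int n \<in> R"
  by (cases n rule: int_cases2) auto

lemma numeral [simp, intro]: "numeral n \<in> R"
  using of_nat[of "numeral n"] by simp

lemma sum [intro]: "(\<And>i. i \<in> I \<Longrightarrow> f i \<in> R) \<Longrightarrow> (\<Sum>i\<in>I. f i) \<in> R"
  by (induction I rule: infinite_finite_induct) auto

lemma norm_ge_1: "x \<in> R \<Longrightarrow> x \<noteq> 0 \<Longrightarrow> cmod x \<ge> 1"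
proof -
  assume x: "x \<in> R" "x \<noteq> 0"
  obtain n :: nat where n: "(cmod x)\<^sup>2 = real n" using norm_sq[OF x(1)] by blast
  then have "n > 0" using x(2) by (cases n) auto
  then have "(cmod x)\<^sup>2 \<ge> 1\<^sup>2" using n by simp
  then show ?thesis by (rule power2_le_imp_le) simp
qed

lemma norm_lt_1_iff: "x \<in> R \<Longrightarrow> cmod x < 1 \<longleftrightarrow> x = 0"
  using norm_ge_1[of x] by (auto simp flip: not_le)

end

text \<open>The order Z[sqrt(-D)]. Denominators are measured against it rather than against the full
  ring of integers, so that no case distinction on D modulo 4 arises.\<close>

definition order_sqrt :: "int \<Rightarrow> complex set" where
  "order_sqrt D = {of_int a + of_int b * csqrt (- of_int D) | a b. True}"

lemma order_sqrt_0 [simp]: "0 \<in> order_sqrt D"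
  unfolding order_sqrt_def by (force intro: exI[of _ 0])

lemma order_sqrt_of_int [simp]: "of_int n \<in> order_sqrt D"
  unfolding order_sqrt_def by (force intro: exI[of _ 0])

lemma order_sqrt_add: "x \<in> order_sqrt D \<Longrightarrow> y \<in> order_sqrt D \<Longrightarrow> x + y \<in> order_sqrt D"
proof -
  assume "x \<in> order_sqrt D" "y \<in> order_sqrt D"
  then obtain a b a' b' where "x = of_int a + of_int b * csqrt (- of_int D)"
      "y = of_int a' + of_int b' * csqrt (- of_int D)" unfolding order_sqrt_def by blast
  then have "x + y = of_int (a + a') + of_int (b + b') * csqrt (- of_int D)"
    by (simp add: algebra_simps)
  then show ?thesis unfolding order_sqrt_def by blast
qed

lemma order_sqrt_mult: "x \<in> order_sqrt D \<Longrightarrow> y \<in> order_sqrt D \<Longrightarrow> x * y \<in> order_sqrt D"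
proof -
  assume "x \<in> order_sqrt D" "y \<in> order_sqrt D"
  then obtain a b a' b' where xy: "x = of_int a + of_int b * csqrt (- of_int D)"
      "y = of_int a' + of_int b' * csqrt (- of_int D)" unfolding order_sqrt_def by blast
  have s: "csqrt (- of_int D) * csqrt (- of_int D) = - of_int D"
    by (metis power2_csqrt power2_eq_square)
  have "x * y = of_int a * of_int a' + of_int b * of_int b' * (csqrt (- of_int D) * csqrt (- of_int D))
      + (of_int a * of_int b' + of_int a' * of_int b) * csqrt (- of_int D)"
    unfolding xy by (simp add: algebra_simps)
  also have "\<dots> = of_int (a * a' - b * b' * D) + of_int (a * b' + a' * b) * csqrt (- of_int D)"
    unfolding s by (simp add: algebra_simps)
  finally show ?thesis unfolding order_sqrt_def by blast
qed

lemma order_sqrt_sum: "(\<And>i. i \<in> I \<Longrightarrow> f i \<in> order_sqrt D) \<Longrightarrow> (\<Sum>i\<in>I. f i) \<in> order_sqrt D"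
  by (induction I rule: infinite_finite_induct) (auto intro: order_sqrt_add)

lemma csqrt_minus_of_int:
  assumes "D > 0" shows "csqrt (- of_int D) = \<i> * of_real (sqrt (of_int D))"
  using assms csqrt_of_real_nonpos[of "- of_int D"] by simp

lemma of_real_of_rat: "of_real (of_rat r) = (of_rat r :: complex)"
  by (cases r) (simp add: of_rat_rat)

lemma norm_sq_quadratic:
  assumes "D > 0"
  shows "(cmod (of_real a + of_real b * csqrt (- of_int D)))\<^sup>2 = a\<^sup>2 + of_int D * b\<^sup>2"
  using assms by (simp add: csqrt_minus_of_int cmod_power2 power_mult_distrib)

lemma order_sqrt_norm_sq:
  assumes "D > 0" "x \<in> order_sqrt D" shows "(cmod x)\<^sup>2 \<in> \<int>"
proof -
  obtain a b where "x = of_int a + of_int b * csqrt (- of_int D)"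
    using assms(2) unfolding order_sqrt_def by blast
  then have "x = of_real (of_int a) + of_real (of_int b) * csqrt (- of_int D)" by simp
  then have "(cmod x)\<^sup>2 = of_int (a\<^sup>2 + D * b\<^sup>2)"
    by (simp only: norm_sq_quadratic[OF assms(1)]) simp
  then show ?thesis by (metis Ints_of_int)
qed

lemma imag_quadratic_denominator:
  assumes "x \<in> imag_quadratic_field D"
  shows "\<exists>d::int. d > 0 \<and> of_int d * x \<in> order_sqrt D"
proof -
  obtain a b where x: "x = of_rat a + of_rat b * csqrt (- of_int D)"
    using assms unfolding imag_quadratic_field_def by blast
  obtain a1 a2 where a: "quotient_of a = (a1, a2)" by fastforce
  obtain b1 b2 where b: "quotient_of b = (b1, b2)" by fastforce
  have pos: "a2 > 0" "b2 > 0" using a b quotient_of_denom_pos by blast+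
  have ab: "a = of_int a1 / of_int a2" "b = of_int b1 / of_int b2"
    using a b quotient_of_div by blast+
  have "of_int (a2 * b2) * x = of_int (a1 * b2) + of_int (b1 * a2) * csqrt (- of_int D)"
    unfolding x ab using pos by (simp add: of_rat_divide field_simps)
  then have "of_int (a2 * b2) * x \<in> order_sqrt D" unfolding order_sqrt_def by blast
  then show ?thesis using pos by (intro exI[of _ "a2 * b2"]) auto
qed

text \<open>
  For elements of the field this is equivalent to being an algebraic integer, and unlike the existence
  of an integral equation it is visibly preserved by sums and products.
\<close>

definition power_bounded_denominator :: "int \<Rightarrow> complex \<Rightarrow> bool" where
  "power_bounded_denominator D x \<longleftrightarrow> (\<exists>d::int. d > 0 \<and> (\<forall>n. of_int d * x ^ n \<in> order_sqrt D))"

lemma imag_quadratic_field_mult: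
  assumes "x \<in> imag_quadratic_field D" "y \<in> imag_quadratic_field D"
  shows "x * y \<in> imag_quadratic_field D"
proof -
  obtain a b a' b' where xy: "x = of_rat a + of_rat b * csqrt (- of_int D)"
      "y = of_rat a' + of_rat b' * csqrt (- of_int D)"
    using assms unfolding imag_quadratic_field_def by blast
  have s: "csqrt (- of_int D) * csqrt (- of_int D) = - of_int D"
    by (metis power2_csqrt power2_eq_square)
  have "x * y = of_rat a * of_rat a' + of_rat b * of_rat b' * (csqrt (- of_int D) * csqrt (- of_int D))
      + (of_rat a * of_rat b' + of_rat a' * of_rat b) * csqrt (- of_int D)"
    unfolding xy by (simp add: algebra_simps)
  also have "\<dots> = of_rat (a * a' - b * b' * of_int D) + of_rat (a * b' + a' * b) * csqrt (- of_int D)"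
    unfolding s by (simp add: algebra_simps of_rat_add of_rat_mult of_rat_diff)
  finally show ?thesis unfolding imag_quadratic_field_def by blast
qed

lemma imag_quadratic_field_diff:
  assumes "x \<in> imag_quadratic_field D" "y \<in> imag_quadratic_field D"
  shows "x - y \<in> imag_quadratic_field D"
proof -
  obtain a b a' b' where xy: "x = of_rat a + of_rat b * csqrt (- of_int D)"
      "y = of_rat a' + of_rat b' * csqrt (- of_int D)"
    using assms unfolding imag_quadratic_field_def by blast
  have "x - y = of_rat (a - a') + of_rat (b - b') * csqrt (- of_int D)"
    unfolding xy by (simp add: algebra_simps of_rat_diff)
  then show ?thesis unfolding imag_quadratic_field_def by blast
qed

lemma imag_quadratic_field_1 [simp]: "1 \<in> imag_quadratic_field D"
proof -
  have "(1::complex) = of_rat 1 + of_rat 0 * csqrt (- of_int D)" by simp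
  then show ?thesis unfolding imag_quadratic_field_def by blast
qed

lemma imag_quadratic_field_power:
  "x \<in> imag_quadratic_field D \<Longrightarrow> x ^ n \<in> imag_quadratic_field D"
  by (induction n) (auto intro: imag_quadratic_field_mult)

lemma order_sqrt_common_denominator:
  fixes f :: "nat \<Rightarrow> complex"
  assumes "\<And>i. f i \<in> imag_quadratic_field D"
  shows "\<exists>d::int. d > 0 \<and> (\<forall>i<n. of_int d * f i \<in> order_sqrt D)"
proof (induction n)
  case 0
  show ?case by (intro exI[of _ 1]) auto
next
  case (Suc n)
  then obtain d where d: "d > 0" "\<And>i. i < n \<Longrightarrow> of_int d * f i \<in> order_sqrt D" by blast
  obtain e where e: "e > 0" "of_int e * f n \<in> order_sqrt D"
    using imag_quadratic_denominator[OF assms] by blast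
  have "of_int (d * e) * f i \<in> order_sqrt D" if "i < Suc n" for i
  proof (cases "i = n")
    case True
    then show ?thesis using order_sqrt_mult[OF order_sqrt_of_int[of d] e(2)] by (simp add: mult.assoc)
  next
    case False
    then show ?thesis using order_sqrt_mult[OF order_sqrt_of_int[of e] d(2)[of i]] that
      by (simp add: algebra_simps)
  qed
  then show ?case using d(1) e(1) by (intro exI[of _ "d * e"]) auto
qed

lemma algebraic_int_power_bounded_denominator:
  assumes "x \<in> imag_quadratic_field D" "algebraic_int x"
  shows "power_bounded_denominator D x"
proof -
  obtain p :: "int poly" where p: "poly (map_poly of_int p) x = 0" "lead_coeff p = 1"
    using assms(2) unfolding algebraic_int_altdef_ipoly by blast
  define m where "m = degree p"
  obtain d where d: "d > 0" "\<And>i. i < m \<Longrightarrow> of_int d * x ^ i \<in> order_sqrt D"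
    using order_sqrt_common_denominator[of "\<lambda>i. x ^ i" D m] imag_quadratic_field_power[OF assms(1)] by blast
  have deg: "degree (map_poly of_int p :: complex poly) = m"
    unfolding m_def by (rule degree_map_poly) (use p(2) in auto)
  have eq: "x ^ m = - (\<Sum>i<m. of_int (coeff p i) * x ^ i)"
  proof -
    have "0 = (\<Sum>i\<le>m. of_int (coeff p i) * x ^ i)"
      using p(1) unfolding poly_altdef deg by (simp add: coeff_map_poly)
    also have "\<dots> = (\<Sum>i<m. of_int (coeff p i) * x ^ i) + x ^ m"
      using p(2) unfolding m_def by (simp add: lessThan_Suc_atMost[symmetric])
    finally show ?thesis by (simp add: algebra_simps eq_neg_iff_add_eq_0)
  qed
  have "of_int d * x ^ n \<in> order_sqrt D" for n
  proof (induction n rule: less_induct)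
    case (less n)
    show ?case
    proof (cases "n < m")
      case True
      then show ?thesis by (rule d(2))
    next
      case False
      \<comment> \<open>The monic equation trades the top power for lower ones with integer
        coefficients, so \<open>d\<close>, chosen for the exponents below \<open>m\<close>, serves
        all of them.\<close>
      then have "x ^ n = x ^ (n - m) * x ^ m" by (simp flip: power_add)
      then have "of_int d * x ^ n = (\<Sum>i<m. of_int (- coeff p i) * (of_int d * x ^ (n - m + i)))"
        unfolding eq by (simp add: sum_distrib_left algebra_simps power_add sum_negf)
      also have "\<dots> \<in> order_sqrt D"
        by (intro order_sqrt_sum order_sqrt_mult order_sqrt_of_int less.IH) (use False in auto)
      finally show ?thesis .
    qed
  qed
  then show ?thesis using d(1) unfolding power_bounded_denominator_def by blast
qed

lemma power_bounded_denominator_mult: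
  assumes "power_bounded_denominator D x" "power_bounded_denominator D y"
  shows "power_bounded_denominator D (x * y)"
proof -
  obtain d e where "d > 0" "\<And>n. of_int d * x ^ n \<in> order_sqrt D"
      "e > 0" "\<And>n. of_int e * y ^ n \<in> order_sqrt D"
    using assms unfolding power_bounded_denominator_def by blast
  then have "d * e > 0" "of_int (d * e) * (x * y) ^ n \<in> order_sqrt D" for n
    using order_sqrt_mult[of "of_int d * x ^ n" D "of_int e * y ^ n"]
    by (auto simp: power_mult_distrib algebra_simps)
  then show ?thesis unfolding power_bounded_denominator_def by blast
qed

lemma power_bounded_denominator_add:
  assumes "power_bounded_denominator D x" "power_bounded_denominator D y"
  shows "power_bounded_denominator D (x + y)"
proof -
  obtain d e where de: "d > 0" "\<And>n. of_int d * x ^ n \<in> order_sqrt D"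
      "e > 0" "\<And>n. of_int e * y ^ n \<in> order_sqrt D"
    using assms unfolding power_bounded_denominator_def by blast
  have "of_int (d * e) * (x + y) ^ n \<in> order_sqrt D" for n
  proof -
    have "of_int (d * e) * (x + y) ^ n =
        (\<Sum>k\<le>n. of_int (int (n choose k)) * ((of_int d * x ^ k) * (of_int e * y ^ (n - k))))"
      unfolding binomial_ring by (simp add: sum_distrib_left algebra_simps)
    also have "\<dots> \<in> order_sqrt D"
      by (intro order_sqrt_sum order_sqrt_mult order_sqrt_of_int de(2) de(4))
    finally show ?thesis .
  qed
  then show ?thesis using de(1,3) unfolding power_bounded_denominator_def
    by (intro exI[of _ "d * e"]) auto
qed

lemma power_bounded_denominator_of_int: "power_bounded_denominator D (of_int m)"
  unfolding power_bounded_denominator_def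
  by (intro exI[of _ 1]) (use order_sqrt_of_int[of "m ^ n" D for n] in auto)

text \<open>In lowest terms a / b, every power b^n divides d, but b^d already exceeds d unless b =
  1.\<close>

lemma rat_bounded_denominator_int:
  fixes r :: real and d :: int
  assumes "r \<in> \<rat>" "d > 0" "\<And>n. of_int d * r ^ n \<in> \<int>"
  shows "r \<in> \<int>"
proof -
  obtain a b :: int where ab: "b > 0" "coprime a b" "r = of_int a / of_int b"
    using Rats_cases'[OF assms(1)] by metis
  have "b ^ n dvd d" for n
  proof -
    obtain k where k: "of_int d * r ^ n = of_int k" using assms(3) by (metis Ints_cases)
    then have "real_of_int (d * a ^ n) = of_int (k * b ^ n)"
      using ab(1) unfolding ab(3) by (simp add: power_divide field_simps)
    then have "d * a ^ n = k * b ^ n" using of_int_eq_iff by blast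
    then have "b ^ n dvd d * a ^ n" by simp
    moreover have "coprime (b ^ n) (a ^ n)" using ab(2) by (simp add: coprime_commute)
    ultimately show ?thesis by (simp add: coprime_dvd_mult_left_iff)
  qed
  then have "b ^ nat d \<le> d" using zdvd_imp_le assms(2) by blast
  moreover have "d < b ^ nat d" if "b \<ge> 2"
  proof -
    have "int (nat d) < int (2 ^ nat d)" using less_exp[of "nat d"] by linarith
    also have "\<dots> \<le> b ^ nat d" using power_mono[of 2 b "nat d"] that by simp
    finally show ?thesis using assms(2) by simp
  qed
  ultimately have "b = 1" using ab(1) by linarith
  then show ?thesis using ab(3) by simp
qed

lemma power_bounded_denominator_norm_sq:
  assumes "D > 0" "x \<in> imag_quadratic_field D" "power_bounded_denominator D x"
  shows "(cmod x)\<^sup>2 \<in> \<int>"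
proof -
  obtain d where d: "d > 0" "\<And>n. of_int d * x ^ n \<in> order_sqrt D"
    using assms(3) unfolding power_bounded_denominator_def by blast
  obtain a b where "x = of_rat a + of_rat b * csqrt (- of_int D)"
    using assms(2) unfolding imag_quadratic_field_def by blast
  then have "x = of_real (of_rat a) + of_real (of_rat b) * csqrt (- of_int D)"
    by (simp only: of_real_of_rat)
  then have "(cmod x)\<^sup>2 = (of_rat a)\<^sup>2 + of_int D * (of_rat b)\<^sup>2"
    by (simp only: norm_sq_quadratic[OF assms(1)])
  then have rat: "(cmod x)\<^sup>2 \<in> \<rat>" by simp
  have "of_int (d\<^sup>2) * ((cmod x)\<^sup>2) ^ n \<in> \<int>" for n
  proof -
    have "of_int (d\<^sup>2) * ((cmod x)\<^sup>2) ^ n = (cmod (of_int d * x ^ n))\<^sup>2"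
      using d(1) by (simp add: norm_mult norm_power power_mult_distrib flip: power_mult)
        (simp add: mult.commute)
    then show ?thesis using order_sqrt_norm_sq[OF assms(1) d(2)[of n]] by simp
  qed
  then show ?thesis using rat_bounded_denominator_int[OF rat, of "d\<^sup>2"] d(1) by simp
qed

text \<open>Norm and trace give a monic quadratic equation. The norms of \<open>x\<close> and
  \<open>x + 1\<close> are integers, and the trace is their difference minus 1.\<close>

lemma power_bounded_denominator_algebraic_int:
  assumes "D > 0" "x \<in> imag_quadratic_field D" "power_bounded_denominator D x"
  shows "algebraic_int x"
proof -
  obtain n where n: "(cmod x)\<^sup>2 = of_int n"
    using power_bounded_denominator_norm_sq[OF assms] by (metis Ints_cases)
  \<comment> \<open>Closure is at hand for differences only: x + 1 is x - (-1), and -1 is 1 - 1 -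
    1.\<close>
  have x1: "x - of_int (-1) \<in> imag_quadratic_field D"
    using imag_quadratic_field_diff[OF assms(2) imag_quadratic_field_diff[OF imag_quadratic_field_diff[OF
      imag_quadratic_field_1 imag_quadratic_field_1] imag_quadratic_field_1]] by simp
  have "(cmod (x + of_int 1))\<^sup>2 \<in> \<int>"
    using power_bounded_denominator_norm_sq[OF assms(1) x1]
      power_bounded_denominator_add[OF assms(3) power_bounded_denominator_of_int[of D 1]] by simp
  then obtain m where m: "(cmod (x + 1))\<^sup>2 = of_int m" by (metis Ints_cases of_int_1)
  have nn: "x * cnj x = of_int n"
    using n by (metis complex_norm_square of_real_of_int_eq)
  have mm: "(x + 1) * (cnj x + 1) = of_int m"
    using m complex_norm_square[of "x + 1"] by simp
  have tr: "x + cnj x = of_int (m - n - 1)"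
    using mm nn by (simp add: algebra_simps)
  have "x\<^sup>2 - (x + cnj x) * x + x * cnj x = 0"
    by (simp add: power2_eq_square algebra_simps)
  then have eq: "x\<^sup>2 - of_int (m - n - 1) * x + of_int n = 0"
    unfolding tr nn .
  show ?thesis
    unfolding algebraic_int_altdef_ipoly
    by (rule exI[of _ "[:n, - (m - n - 1), 1:]"])
       (use eq in \<open>simp add: map_poly_pCons algebra_simps power2_eq_square\<close>)
qed

lemma discrete_subring_ring_of_integers:
  assumes "D > 0"
  shows "discrete_subring (ring_of_integers (imag_quadratic_field D))"
proof -
  have iff: "x \<in> ring_of_integers (imag_quadratic_field D) \<longleftrightarrow>
      x \<in> imag_quadratic_field D \<and> power_bounded_denominator D x" for x
    unfolding ring_of_integers_def
    using algebraic_int_power_bounded_denominator power_bounded_denominator_algebraic_int[OF assms]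
    by blast
  show ?thesis
  proof
    show "1 \<in> ring_of_integers (imag_quadratic_field D)"
      unfolding iff using power_bounded_denominator_of_int[of D 1] by simp
  next
    fix x y assume "x \<in> ring_of_integers (imag_quadratic_field D)"
      "y \<in> ring_of_integers (imag_quadratic_field D)"
    then have xy: "x \<in> imag_quadratic_field D" "power_bounded_denominator D x"
      "y \<in> imag_quadratic_field D" "power_bounded_denominator D y" unfolding iff by auto
    show "x * y \<in> ring_of_integers (imag_quadratic_field D)"
      unfolding iff using xy by (auto intro: imag_quadratic_field_mult power_bounded_denominator_mult)
    have "power_bounded_denominator D (x + of_int (-1) * y)"
      using xy by (intro power_bounded_denominator_add power_bounded_denominator_mult
        power_bounded_denominator_of_int)
    then show "x - y \<in> ring_of_integers (imag_quadratic_field D)"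
      unfolding iff using xy by (auto intro: imag_quadratic_field_diff)
  next
    fix x assume "x \<in> ring_of_integers (imag_quadratic_field D)"
    then have "(cmod x)\<^sup>2 \<in> \<int>"
      unfolding iff using power_bounded_denominator_norm_sq[OF assms] by blast
    then obtain k where k: "(cmod x)\<^sup>2 = of_int k" by (metis Ints_cases)
    then have "k \<ge> 0" by (metis of_int_0_le_iff zero_le_power2)
    then show "\<exists>n::nat. (cmod x)\<^sup>2 = real n" using k by (intro exI[of _ "nat k"]) simp
  qed
qed

section \<open>Relative Pell equations\<close>

text \<open>
  The solutions of \<open>(L + 2) U\<^sup>2 - L V\<^sup>2 = 2\<close> obtained by multiplying
  \<open>\<surd>(L + 2) + \<surd>L\<close> repeatedly by half its square, which is \<open>(L + 1) + \<surd>(L (L + 2))\<close>.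
\<close>

fun pell_pair :: "complex \<Rightarrow> nat \<Rightarrow> complex \<times> complex" where
  "pell_pair L 0 = (1, 1)"
| "pell_pair L (Suc m) =
     (let (x, y) = pell_pair L m in ((L + 1) * x + L * y, (L + 2) * x + (L + 1) * y))"

definition pell_x where "pell_x L m = fst (pell_pair L m)"
definition pell_y where "pell_y L m = snd (pell_pair L m)"

lemma pell_0 [simp]: "pell_x L 0 = 1" "pell_y L 0 = 1"
  and pell_x_Suc: "pell_x L (Suc m) = (L + 1) * pell_x L m + L * pell_y L m"
  and pell_y_Suc: "pell_y L (Suc m) = (L + 2) * pell_x L m + (L + 1) * pell_y L m"
  by (auto simp: pell_x_def pell_y_def Let_def split: prod.splits)

text \<open>The step matrix has determinant (L + 1)^2 - L (L + 2) = 1, so its adjugate inverts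
  it.\<close>

lemma pell_down:
  "(L + 1) * pell_x L (Suc m) - L * pell_y L (Suc m) = pell_x L m"
  "(L + 1) * pell_y L (Suc m) - (L + 2) * pell_x L (Suc m) = pell_y L m"
  by (simp_all add: pell_x_Suc pell_y_Suc algebra_simps)

lemma pell_x_rec: "pell_x L (Suc (Suc m)) = 2 * (L + 1) * pell_x L (Suc m) - pell_x L m"
  by (simp add: pell_x_Suc pell_y_Suc algebra_simps)

text \<open>In the two-term recurrence |2 (L + 1)| >= |L| + 1 for |L| >= 3, and the older term costs
  at most 1. Nonvanishing is carried along to keep the terms increasing.\<close>

lemma norm_pell_x_mono:
  assumes "cmod L \<ge> 3"
  shows "cmod (pell_x L (Suc m)) \<ge> cmod L * cmod (pell_x L m) \<and> pell_x L m \<noteq> 0"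
proof (induction m)
  case 0
  have "2 * cmod L - 1 \<le> cmod (2 * L + 1)"
    using norm_diff_ineq[of "2 * L" 1] by (simp add: norm_mult)
  then show ?case using assms by (simp add: pell_x_Suc algebra_simps)
next
  case (Suc m)
  let ?x = "cmod (pell_x L (Suc m))" and ?y = "cmod (pell_x L m)"
  have "?y > 0" using Suc by simp
  have "3 * ?y \<le> cmod L * ?y" using assms by (intro mult_right_mono) auto
  then have le: "?y \<le> ?x" and pos: "?x > 0" using Suc \<open>?y > 0\<close> by linarith+
  have "cmod (2 * L + 2) \<ge> 2 * cmod L - 2"
    using norm_diff_ineq[of "2 * L" 2] by (simp add: norm_mult)
  then have l: "cmod (2 * (L + 1)) \<ge> cmod L + 1" using assms by (simp add: algebra_simps)
  have "cmod (2 * (L + 1) * pell_x L (Suc m)) - ?y \<le> cmod (pell_x L (Suc (Suc m)))"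
    unfolding pell_x_rec by (rule norm_triangle_ineq2)
  moreover have "cmod (2 * (L + 1) * pell_x L (Suc m)) \<ge> (cmod L + 1) * ?x"
    unfolding norm_mult[of "2 * (L + 1)"] by (rule mult_right_mono[OF l]) simp
  ultimately show ?case using le pos by (auto simp: algebra_simps)
qed

lemma norm_pell_x_ge:
  assumes "cmod L \<ge> 3" shows "cmod (pell_x L m) \<ge> cmod L ^ m"
proof (induction m)
  case (Suc m)
  have "cmod L ^ Suc m \<le> cmod L * cmod (pell_x L m)"
    using Suc by (simp add: mult_left_mono)
  then show ?case using norm_pell_x_mono[OF assms, of m] by linarith
qed simp

context discrete_subring
begin

text \<open>In the recurrence for \<open>pell_x\<close> the other sequence is multiplied by L, so it
  is needed only modulo L, where it is 2 m + 1; the linear coefficient of \<open>pell_x\<close> then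
  grows by 2 (m + 1).\<close>

lemma pell_x_cong:
  assumes "L \<in> R"
  shows "\<exists>c\<in>R. pell_x L m = 1 + of_nat (m * (m + 1)) * L + c * L\<^sup>2"
proof -
  have "(\<exists>c\<in>R. pell_x L m = 1 + of_nat (m * (m + 1)) * L + c * L\<^sup>2) \<and>
        (\<exists>c\<in>R. pell_y L m = of_nat (2 * m + 1) + c * L)"
  proof (induction m)
    case 0
    show ?case by (auto intro!: bexI[of _ 0])
  next
    case (Suc m)
    then obtain c d where c: "c \<in> R" "pell_x L m = 1 + of_nat (m * (m + 1)) * L + c * L\<^sup>2"
      and d: "d \<in> R" "pell_y L m = of_nat (2 * m + 1) + d * L" by blast
    have "pell_x L (Suc m) = 1 + of_nat (Suc m * (Suc m + 1)) * L +
        (of_nat (m * (m + 1)) + c * (L + 1) + d) * L\<^sup>2"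
      unfolding pell_x_Suc c(2) d(2) by (simp add: algebra_simps power2_eq_square)
    moreover have "of_nat (m * (m + 1)) + c * (L + 1) + d \<in> R"
      by (intro add mult of_nat assms c d one)
    moreover have "pell_y L (Suc m) = of_nat (2 * Suc m + 1) +
        (1 + (L + 2) * of_nat (m * (m + 1)) + c * (L + 2) * L + of_nat (2 * m + 1) + d * (L + 1)) * L"
      unfolding pell_y_Suc c(2) d(2) by (simp add: algebra_simps power2_eq_square)
    moreover have "1 + (L + 2) * of_nat (m * (m + 1)) + c * (L + 2) * L + of_nat (2 * m + 1) + d * (L + 1) \<in> R"
      by (intro add mult of_nat assms c d one numeral)
    ultimately show ?case by blast
  qed
  then show ?thesis by blast
qed

text \<open>
  Of the two conjugate descent steps \<open>(L + 1) U \<plusminus> L V\<close>, whose product is \<open>U\<^sup>2 + 2 L \<epsilon>\<close>, one is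
  smaller than \<open>U\<close>.
\<close>

lemma pell_descent:
  assumes L: "L \<in> R" "cmod L \<ge> 20" and e: "cmod e = 1"
  shows "U \<in> R \<Longrightarrow> V \<in> R \<Longrightarrow> (L + 2) * U\<^sup>2 - L * V\<^sup>2 = 2 * e \<Longrightarrow>
    \<exists>m u s. u \<in> R \<and> u\<^sup>2 = e \<and> (s = 1 \<or> s = -1) \<and> U = u * pell_x L m \<and> V = s * u * pell_y L m"
\<comment> \<open>The floor loses nothing: |U|^2 is a natural number, so a smaller |U| strictly
  lowers the measure.\<close>
proof (induction "nat \<lfloor>(cmod U)\<^sup>2\<rfloor>" arbitrary: U V rule: less_induct)
  case less
  note UV = less.prems
  have L0: "L \<noteq> 0" using L(2) by auto
  obtain n :: nat where n: "(cmod U)\<^sup>2 = real n" using norm_sq[OF UV(1)] by blast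
  show ?case
  proof (cases "n \<le> 2")
    case True
    \<comment> \<open>For |U|^2 <= 2 the right-hand side has size at most 6, which is less than |L|,
      so the factor multiplied by L must vanish.\<close>
    have "L * (V\<^sup>2 - U\<^sup>2) = 2 * (U\<^sup>2 - e)" using UV(3) by (simp add: algebra_simps)
    then have "cmod L * cmod (V\<^sup>2 - U\<^sup>2) = 2 * cmod (U\<^sup>2 - e)" by (metis norm_mult norm_numeral)
    also have "cmod (U\<^sup>2 - e) \<le> (cmod U)\<^sup>2 + 1"
      using norm_triangle_ineq4[of "U\<^sup>2" e] e by (simp add: norm_power)
    also have "\<dots> \<le> 3" using n True by simp
    finally have le: "cmod L * cmod (V\<^sup>2 - U\<^sup>2) \<le> 6" by simp
    have "20 * cmod (V\<^sup>2 - U\<^sup>2) \<le> cmod L * cmod (V\<^sup>2 - U\<^sup>2)"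
      using L(2) by (intro mult_right_mono) auto
    then have "cmod (V\<^sup>2 - U\<^sup>2) < 1" using le by linarith
    moreover have "V\<^sup>2 - U\<^sup>2 \<in> R" using UV by auto
    ultimately have VU: "V\<^sup>2 = U\<^sup>2" using norm_lt_1_iff by simp
    then have "2 * U\<^sup>2 = 2 * e" using UV(3) by (simp add: algebra_simps)
    then have "U\<^sup>2 = e" by simp
    moreover have "V = U \<or> V = - U" using VU by (simp add: power2_eq_iff)
    ultimately show ?thesis using UV(1)
      by (intro exI[of _ 0] exI[of _ U] exI[of _ "if V = U then 1 else -1"]) auto
  next
    case False
    have step: "cmod ((L + 1) * U - L * W) < cmod U"
      if W: "(L + 2) * U\<^sup>2 - L * W\<^sup>2 = 2 * e"
        and le: "cmod ((L + 1) * U - L * W) \<le> cmod ((L + 1) * U + L * W)" for W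
    proof -
      let ?a = "(L + 1) * U - L * W" and ?b = "(L + 1) * U + L * W"
      have "?a * ?b = (L + 1)\<^sup>2 * U\<^sup>2 - L * (L * W\<^sup>2)" by (simp add: algebra_simps power2_eq_square)
      also have "L * W\<^sup>2 = (L + 2) * U\<^sup>2 - 2 * e" using W by (simp add: algebra_simps)
      finally have "?a * ?b = U\<^sup>2 + 2 * L * e" by (simp add: algebra_simps power2_eq_square)
      then have "cmod ?a * cmod ?b = cmod (U\<^sup>2 + 2 * L * e)" by (metis norm_mult)
      also have "\<dots> \<le> (cmod U)\<^sup>2 + 2 * cmod L"
        using norm_triangle_ineq[of "U\<^sup>2" "2 * L * e"] e by (simp add: norm_mult norm_power)
      finally have ab: "cmod ?a * cmod ?b \<le> (cmod U)\<^sup>2 + 2 * cmod L" .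
      have "?a + ?b = 2 * ((L + 1) * U)" by (simp add: algebra_simps)
      then have "2 * (cmod (L + 1) * cmod U) = cmod (?a + ?b)" by (simp only: norm_mult norm_numeral)
      also have "\<dots> \<le> 2 * cmod ?b" using norm_triangle_ineq[of ?a ?b] le by linarith
      finally have b: "cmod (L + 1) * cmod U \<le> cmod ?b" by simp
      have l1: "cmod (L + 1) \<ge> cmod L - 1" using norm_diff_ineq[of L 1] by simp
      show ?thesis
      \<comment> \<open>Otherwise (|L| - 2) |U|^2 <= 2 |L|, impossible for |L| >= 20 and |U|^2 >=
        3.\<close>
      proof (rule ccontr)
        assume "\<not> ?thesis"
        then have "cmod U * (cmod (L + 1) * cmod U) \<le> cmod ?a * cmod ?b"
          using b by (intro mult_mono) auto
        then have "cmod (L + 1) * (cmod U)\<^sup>2 \<le> (cmod U)\<^sup>2 + 2 * cmod L"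
          using ab by (simp add: power2_eq_square mult.left_commute)
        moreover have "(cmod L - 1) * (cmod U)\<^sup>2 \<le> cmod (L + 1) * (cmod U)\<^sup>2"
          using l1 by (intro mult_right_mono) auto
        ultimately have "(cmod L - 2) * (cmod U)\<^sup>2 \<le> 2 * cmod L" by (simp add: algebra_simps)
        moreover have "(cmod L - 2) * 3 \<le> (cmod L - 2) * (cmod U)\<^sup>2"
          using L(2) n False by (intro mult_left_mono) auto
        ultimately show False using L(2) by simp
      qed
    qed
    obtain W where W: "W = V \<or> W = - V"
      and le: "cmod ((L + 1) * U - L * W) \<le> cmod ((L + 1) * U + L * W)"
    proof (cases "cmod ((L + 1) * U - L * V) \<le> cmod ((L + 1) * U + L * V)")
      case True then show ?thesis using that[of V] by simp
    next
      case False then show ?thesis using that[of "- V"] by simp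
    qed
    have WR: "W \<in> R" and Weq: "(L + 2) * U\<^sup>2 - L * W\<^sup>2 = 2 * e" using W UV by auto
    \<comment> \<open>The inverse step matrix is applied to (U, W), where the sign of W was chosen
      so that this direction shrinks U.\<close>
    define U' where "U' = (L + 1) * U - L * W"
    define V' where "V' = (L + 1) * W - (L + 2) * U"
    have UW: "U = (L + 1) * U' + L * V'" "W = (L + 2) * U' + (L + 1) * V'"
      unfolding U'_def V'_def by (simp_all add: algebra_simps)
    have R': "U' \<in> R" "V' \<in> R" unfolding U'_def V'_def using UV WR L by auto
    have "(L + 2) * U'\<^sup>2 - L * V'\<^sup>2 = (L + 2) * U\<^sup>2 - L * W\<^sup>2"
      unfolding U'_def V'_def by (simp add: algebra_simps power2_eq_square)
    then have eq': "(L + 2) * U'\<^sup>2 - L * V'\<^sup>2 = 2 * e" using Weq by simp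
    have lt: "cmod U' < cmod U" unfolding U'_def using step[OF Weq le] .
    obtain n' :: nat where n': "(cmod U')\<^sup>2 = real n'" using norm_sq[OF R'(1)] by blast
    have "(cmod U')\<^sup>2 < (cmod U)\<^sup>2" using lt by (simp add: power_strict_mono)
    then have "nat \<lfloor>(cmod U')\<^sup>2\<rfloor> < nat \<lfloor>(cmod U)\<^sup>2\<rfloor>" using n n' by simp
    from less.hyps[OF this R' eq'] obtain m u s where u: "u \<in> R" "u\<^sup>2 = e" "s = 1 \<or> s = -1"
        "U' = u * pell_x L m" "V' = s * u * pell_y L m" by blast
    \<comment> \<open>Undoing the step moves up the sequence if s = 1. If s = -1 it moves down the
      sequence, except at index 0, where it only turns (1, -1) into (1, 1).\<close>
    have "\<exists>m u s. u \<in> R \<and> u\<^sup>2 = e \<and> (s = 1 \<or> s = -1) \<and> U = u * pell_x L m \<and> W = s * u * pell_y L m"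
    proof (cases "s = 1")
      case True
      then show ?thesis using u UW
        by (intro exI[of _ "Suc m"] exI[of _ u] exI[of _ 1]) (simp add: pell_x_Suc pell_y_Suc algebra_simps)
    next
      case False
      then have s: "s = -1" using u by blast
      show ?thesis
      proof (cases m)
        case 0
        then show ?thesis using u UW s
          by (intro exI[of _ 0] exI[of _ u] exI[of _ 1]) (simp add: algebra_simps)
      next
        case (Suc k)
        have "U = u * ((L + 1) * pell_x L (Suc k) - L * pell_y L (Suc k))"
          using UW(1) u(4,5) s unfolding Suc by (simp add: algebra_simps)
        moreover have "W = - u * ((L + 1) * pell_y L (Suc k) - (L + 2) * pell_x L (Suc k))"
          using UW(2) u(4,5) s unfolding Suc by (simp add: algebra_simps)
        ultimately have "U = u * pell_x L k" "W = - u * pell_y L k"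
          unfolding pell_down by simp_all
        then show ?thesis using u by (intro exI[of _ k] exI[of _ u] exI[of _ "-1"]) simp
      qed
    qed
    then obtain m u s where "u \<in> R" "u\<^sup>2 = e" "s = 1 \<or> s = -1" "U = u * pell_x L m"
      "W = s * u * pell_y L m" by blast
    then show ?thesis using W by (intro exI[of _ m] exI[of _ u] exI[of _ "if W = V then s else - s"]) auto
  qed
qed

text \<open>U belongs, up to units u and v, to the sequences for L = 4 t and L = - t. Comparison
  modulo t^2 makes 4 m (m + 1) + n (n + 1) a multiple of t. For indices below 24 it is too small to
  be a nonzero one, so m = 0.\<close>

lemma pell_small_solution:
  assumes t: "t \<in> R" "cmod t > 10000" and e: "cmod e = 1"
    and R: "U \<in> R" "V \<in> R" "Z \<in> R"
    and V: "(2 * t + 1) * U\<^sup>2 - 2 * t * V\<^sup>2 = e"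
    and Z: "(t - 2) * U\<^sup>2 - t * Z\<^sup>2 = - 2 * e"
    and small: "cmod U < cmod t ^ 24"
  shows "U\<^sup>2 = e"
proof -
  \<comment> \<open>Doubling the first equation and negating the second brings both to the shape
    required by \<open>pell_descent\<close>.\<close>
  have eqs: "(4 * t + 2) * U\<^sup>2 - 4 * t * V\<^sup>2 = 2 * e" "(- t + 2) * U\<^sup>2 - (- t) * Z\<^sup>2 = 2 * e"
    using arg_cong[OF V, of "\<lambda>x. 2 * x"] arg_cong[OF Z, of uminus] by (simp_all add: algebra_simps)
  have t0: "t \<noteq> 0" using t(2) by auto
  have large: "cmod (4 * t) \<ge> 20" "cmod (- t) \<ge> 20" using t(2) by (auto simp: norm_mult)
  obtain m u where u: "u \<in> R" "u\<^sup>2 = e" "U = u * pell_x (4 * t) m"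
    using pell_descent[OF _ large(1) e R(1,2) eqs(1)] t(1) by blast
  obtain n v where v: "v \<in> R" "v\<^sup>2 = e" "U = v * pell_x (- t) n"
    using pell_descent[OF _ large(2) e R(1,3) eqs(2)] t(1) by blast
  have nu: "cmod u = 1" "cmod v = 1"
    using u(2) v(2) e norm_power[of u 2] norm_power[of v 2]
    by (auto simp: power2_eq_1_iff) (metis norm_ge_zero not_one_le_zero neg_0_le_iff_le)+
  have m: "m < 24"
  proof -
    have "cmod t ^ m \<le> cmod (4 * t) ^ m" using t(2) by (intro power_mono) (auto simp: norm_mult)
    also have "\<dots> \<le> cmod (pell_x (4 * t) m)" by (rule norm_pell_x_ge) (use large in simp)
    also have "\<dots> = cmod U" using u(3) nu by (simp add: norm_mult)
    finally have "cmod t ^ m < cmod t ^ 24" using small by simp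
    then show ?thesis using t(2) by (simp add: power_less_imp_less_exp[of "cmod t"])
  qed
  have n: "n < 24"
  proof -
    have "cmod t ^ n = cmod (- t) ^ n" by simp
    also have "\<dots> \<le> cmod (pell_x (- t) n)" by (rule norm_pell_x_ge) (use large in simp)
    also have "\<dots> = cmod U" using v(3) nu by (simp add: norm_mult)
    finally have "cmod t ^ n < cmod t ^ 24" using small by simp
    then show ?thesis using t(2) by (simp add: power_less_imp_less_exp[of "cmod t"])
  qed
  obtain c where c: "c \<in> R" "pell_x (4 * t) m = 1 + of_nat (m * (m + 1)) * (4 * t) + c * (4 * t)\<^sup>2"
    using pell_x_cong[of "4 * t" m] t(1) by auto
  obtain d where d: "d \<in> R" "pell_x (- t) n = 1 + of_nat (n * (n + 1)) * (- t) + d * (- t)\<^sup>2"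
    using pell_x_cong[of "- t" n] t(1) by auto
  have "u\<^sup>2 = v\<^sup>2" using u v by simp
  then have uv: "u = v \<or> u = - v" by (simp add: power2_eq_iff)
  have u0: "u \<noteq> 0" "v \<noteq> 0" using nu by auto
  \<comment> \<open>For u = - v the sum of the two sequence terms would be 0, yet it is 2 modulo
    t.\<close>
  have "u = v"
  proof (rule ccontr)
    assume "u \<noteq> v"
    then have "v * (pell_x (4 * t) m + pell_x (- t) n) = 0"
      using uv u(3) v(3) by (simp add: algebra_simps)
    then have "pell_x (4 * t) m = - pell_x (- t) n" using u0 by (simp add: add_eq_0_iff2)
    then have "2 = - t * (of_nat (m * (m + 1)) * 4 + c * 16 * t - of_nat (n * (n + 1)) + d * t)"
      unfolding c(2) d(2) by (simp add: algebra_simps power2_eq_square)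
    moreover define w where "w = of_nat (m * (m + 1)) * 4 + c * 16 * t - of_nat (n * (n + 1)) + d * t"
    ultimately have "2 = cmod t * cmod w" by (metis norm_mult norm_minus_cancel norm_numeral)
    moreover have "w \<in> R" unfolding w_def by (intro add diff mult of_nat numeral c d t)
    moreover have "cmod w \<noteq> 0" using calculation by auto
    ultimately have "cmod w \<ge> 1" "2 = cmod t * cmod w" using norm_ge_1 by auto
    then show False using t(2) mult_left_mono[of 1 "cmod w" "cmod t"] by simp
  qed
  then have "pell_x (4 * t) m = pell_x (- t) n" using u(3) v(3) u0 by simp
  then have "t * (of_nat (4 * (m * (m + 1)) + n * (n + 1)) - t * (d - 16 * c)) = 0"
    unfolding c(2) d(2) by (simp add: algebra_simps power2_eq_square)
  then have "of_nat (4 * (m * (m + 1)) + n * (n + 1)) = t * (d - 16 * c)" using t0 by simp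
  then have k: "real (4 * (m * (m + 1)) + n * (n + 1)) = cmod t * cmod (d - 16 * c)"
    by (metis norm_of_nat norm_mult)
  \<comment> \<open>2760 = 5 * 23 * 24 stays below |t|.\<close>
  have "m * (m + 1) \<le> 23 * 24" "n * (n + 1) \<le> 23 * 24" using m n by (intro mult_mono; simp)+
  then have kle: "4 * (m * (m + 1)) + n * (n + 1) \<le> 2760" by simp
  have "d - 16 * c = 0"
  proof (rule ccontr)
    assume "d - 16 * c \<noteq> 0"
    then have "cmod (d - 16 * c) \<ge> 1" using c d by (intro norm_ge_1) auto
    then have "cmod t * 1 \<le> cmod t * cmod (d - 16 * c)" by (intro mult_left_mono) auto
    then have "real (4 * (m * (m + 1)) + n * (n + 1)) > 10000" using k t(2) by linarith
    then show False using kle by linarith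
  qed
  then have "real (4 * (m * (m + 1)) + n * (n + 1)) = 0" using k by simp
  then have "4 * (m * (m + 1)) + n * (n + 1) = 0" by (simp only: of_nat_eq_0_iff)
  then have "m = 0" by simp
  then show ?thesis using u by simp
qed

end

section \<open>Hermite-Pade approximations\<close>

text \<open>
  \<open>sqrt_series N a k\<close> is the Taylor series of \<open>(N + z) powr (k + 1/2)\<close> at \<open>z = a\<close>, divided
  by \<open>(N + a) powr (1/2)\<close>.
\<close>

definition sqrt_series :: "complex \<Rightarrow> complex \<Rightarrow> nat \<Rightarrow> complex fps" where
  "sqrt_series N a k = Abs_fps (\<lambda>h. ((of_nat k + 1/2) gchoose h) * (N + a) ^ k / (N + a) ^ h)"

definition taylor_poly :: "complex \<Rightarrow> complex poly \<Rightarrow> complex fps" where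
  "taylor_poly a q = fps_of_poly (q \<circ>\<^sub>p [:a, 1:])"

text \<open>
  The residue at \<open>z = a\<close> of \<open>q(z) (N + z) powr (k + 1/2) / A(z)\<^sup>k\<^sup>+\<^sup>1\<close>, divided by
  \<open>(N + a) powr (1/2)\<close>, where \<open>A\<close> has the roots \<open>a\<close>, \<open>a - d\<close> and \<open>a - e\<close>. These are the
  coefficients of the Hermite-Pade approximations of Rickert and Bennett.
\<close>

definition pade :: "complex \<Rightarrow> nat \<Rightarrow> complex \<Rightarrow> complex \<Rightarrow> complex \<Rightarrow> complex poly \<Rightarrow> complex" where
  "pade N k a d e q =
     fps_nth (taylor_poly a q * inverse ((fps_X + fps_const d) * (fps_X + fps_const e)) ^ Suc k
                * sqrt_series N a k) k"

lemma taylor_poly_add: "taylor_poly a (p + q) = taylor_poly a p + taylor_poly a q"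
  and taylor_poly_diff: "taylor_poly a (p - q) = taylor_poly a p - taylor_poly a q"
  and taylor_poly_mult: "taylor_poly a (p * q) = taylor_poly a p * taylor_poly a q"
  and taylor_poly_smult: "taylor_poly a (smult c p) = fps_const c * taylor_poly a p"
  by (simp_all add: taylor_poly_def pcompose_add pcompose_diff pcompose_mult pcompose_smult
      fps_of_poly_add fps_of_poly_diff fps_of_poly_mult fps_of_poly_smult)

lemma taylor_poly_power: "taylor_poly a (p ^ n) = taylor_poly a p ^ n"
proof (induction n)
  case 0
  show ?case by (simp add: taylor_poly_def pcompose_1)
qed (simp add: taylor_poly_mult)

lemma taylor_poly_linear: "taylor_poly a [:c, 1:] = fps_X + fps_const (a + c)"
  by (simp add: taylor_poly_def pcompose_pCons fps_of_poly_linear add.commute)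

lemma taylor_poly_pderiv: "taylor_poly a (pderiv p) = fps_deriv (taylor_poly a p)"
  by (simp add: taylor_poly_def pderiv_pcompose pderiv_pCons flip: fps_of_poly_pderiv)

lemma pade_add: "pade N k a d e (p + q) = pade N k a d e p + pade N k a d e q"
  by (simp add: pade_def taylor_poly_add algebra_simps)

lemma pade_smult: "pade N k a d e (smult c q) = c * pade N k a d e q"
  by (simp add: pade_def taylor_poly_smult mult.assoc)

lemma sqrt_series_eq:
  "sqrt_series N a k = fps_const ((N + a) ^ k) *
     (fps_binomial (of_nat k + 1/2) oo (fps_const (1 / (N + a)) * fps_X))"
  by (simp add: sqrt_series_def fps_compose_linear fps_eq_iff power_divide)

text \<open>Squaring doubles the half-integer exponent to 2 k + 1. This relation later identifies
  the formal series with the expansion of a holomorphic branch.\<close>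

lemma sqrt_series_square:
  assumes "N + a \<noteq> 0"
  shows "fps_const (N + a) * sqrt_series N a k ^ 2 = (fps_X + fps_const (N + a)) ^ (2 * k + 1)"
proof -
  let ?c = "fps_const (1 / (N + a)) * fps_X :: complex fps"
  have b: "fps_binomial (of_nat k + 1/2 :: complex) ^ 2 = (1 + fps_X) ^ (2 * k + 1)"
  proof -
    have "of_nat 2 * (of_nat k + 1/2) = (of_nat (2 * k + 1) :: complex)" by simp
    then show ?thesis unfolding fps_binomial_power by (simp only: fps_binomial_of_nat)
  qed
  have "fps_const (N + a) * sqrt_series N a k ^ 2 =
      fps_const ((N + a) ^ (2 * k + 1)) * (fps_binomial (of_nat k + 1/2) ^ 2 oo ?c)"
    unfolding sqrt_series_eq power_mult_distrib
    by (simp add: fps_compose_power fps_const_power power_mult mult.assoc[symmetric]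
        power_commutes flip: power_mult) (simp add: mult.commute)
  also have "\<dots> = (fps_const (N + a) * ((1 + fps_X) oo ?c)) ^ (2 * k + 1)"
    unfolding b power_mult_distrib fps_const_power
    by (subst fps_compose_power) simp_all
  also have "fps_const (N + a) * ((1 + fps_X) oo ?c) = fps_X + fps_const (N + a)"
    using assms by (simp add: fps_compose_add_distrib algebra_simps flip: mult.assoc)
  finally show ?thesis .
qed

lemma sqrt_series_deriv:
  assumes "N + a \<noteq> 0"
  shows "(fps_X + fps_const (N + a)) * fps_deriv (sqrt_series N a k) =
         fps_const (of_nat k + 1/2) * sqrt_series N a k"
proof (rule fps_ext)
  fix h
  define c where "c = (of_nat k + 1/2 :: complex)"
  define M where "M = N + a"
  have M: "M \<noteq> 0" using assms by (simp add: M_def)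
  have S: "fps_nth (sqrt_series N a k) i = (c gchoose i) * M ^ k / M ^ i" for i
    by (simp add: sqrt_series_def c_def M_def)
  have ab: "of_nat (Suc h) * (c gchoose Suc h) = (c - of_nat h) * (c gchoose h)"
    unfolding gbinomial_absorb_comp gbinomial_absorption ..
  have 1: "fps_nth (fps_X * fps_deriv (sqrt_series N a k)) h = of_nat h * ((c gchoose h) * M ^ k / M ^ h)"
    by (cases h) (simp_all add: S)
  have 2: "M * fps_nth (fps_deriv (sqrt_series N a k)) h =
      (of_nat (Suc h) * (c gchoose Suc h)) * (M ^ k / M ^ h)"
    using M by (simp add: S del: of_nat_Suc)
  have "fps_nth ((fps_X + fps_const M) * fps_deriv (sqrt_series N a k)) h =
      fps_nth (fps_X * fps_deriv (sqrt_series N a k)) h + M * fps_nth (fps_deriv (sqrt_series N a k)) h"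
    by (simp only: distrib_right fps_add_nth fps_mult_left_const_nth)
  also have "\<dots> = c * ((c gchoose h) * (M ^ k / M ^ h))"
    unfolding 1 2 ab by (simp add: algebra_simps)
  finally show "fps_nth ((fps_X + fps_const (N + a)) * fps_deriv (sqrt_series N a k)) h =
      fps_nth (fps_const (of_nat k + 1/2) * sqrt_series N a k) h"
    unfolding fps_mult_left_const_nth S c_def[symmetric] M_def[symmetric] by simp
qed

text \<open>The residue of the derivative of \<open>r(z) (N + z) powr (k + 3/2) / A(z)\<^sup>k\<close> vanishes.\<close>

lemma pade_derivative:
  assumes nz: "N + a \<noteq> 0" "d \<noteq> 0" "e \<noteq> 0"
    and A: "A = [:- a, 1:] * [:d - a, 1:] * [:e - a, 1:]"
  shows "pade N k a d e (smult (of_nat k + 3/2) (r * A)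
           + [:N, 1:] * (pderiv r * A - smult (of_nat k) (r * pderiv A))) = 0"
proof -
  define B where "B = (fps_X + fps_const d) * (fps_X + fps_const e)"
  define g where "g = inverse B"
  define \<rho> where "\<rho> = taylor_poly a r"
  define S where "S = sqrt_series N a k"
  define M where "M = fps_X + fps_const (N + a)"
  have gB: "g * B = 1" unfolding g_def by (rule inverse_mult_eq_1) (use nz in \<open>simp add: B_def\<close>)
  have "fps_deriv (g * B) = 0" unfolding gB by simp
  then have "fps_deriv g * B + g * fps_deriv B = 0" by (simp add: add.commute)
  then have "(fps_deriv g * B + g * fps_deriv B) * g = 0" by simp
  then have "fps_deriv g * (g * B) + g * g * fps_deriv B = 0" by (simp add: algebra_simps)
  then have g': "fps_deriv g = - (g ^ 2 * fps_deriv B)"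
    unfolding gB by (simp add: power2_eq_square eq_neg_iff_add_eq_0)
  have gk: "fps_deriv (g ^ k) = - (fps_const (of_nat k) * g ^ Suc k * fps_deriv B)"
    unfolding fps_deriv_power by (cases k) (simp_all add: g' power2_eq_square mult_ac del: of_nat_Suc)
  have MS: "fps_deriv (M * S) = fps_const (of_nat k + 3/2) * S"
  proof -
    have "fps_deriv (M * S) = S + M * fps_deriv S" by (simp add: M_def)
    also have "M * fps_deriv S = fps_const (of_nat k + 1/2) * S"
      unfolding M_def S_def by (rule sqrt_series_deriv[OF nz(1)])
    also have "S + fps_const (of_nat k + 1/2) * S = (1 + fps_const (of_nat k + 1/2)) * S"
      by (simp add: algebra_simps)
    also have "(1 + fps_const (of_nat k + 1/2 :: complex)) = fps_const (1 + (of_nat k + 1/2))"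
      by (simp only: fps_const_add[symmetric] fps_const_1_eq_1)
    finally show ?thesis by (simp add: algebra_simps)
  qed
  have gS: "g ^ Suc k * B = g ^ k" using gB by (simp add: mult.assoc mult.left_commute)
  \<comment> \<open>The function r(z) (N + z)^(k + 3/2) / A(z)^k, expanded at \<open>a\<close> and
    multiplied by X^k to remove its pole.\<close>
  define H where "H = \<rho> * g ^ k * (M * S)"
  have H': "fps_deriv H = g ^ Suc k * S * (fps_deriv \<rho> * B * M
      - fps_const (of_nat k) * \<rho> * fps_deriv B * M + fps_const (of_nat k + 3/2) * \<rho> * B)"
  proof -
    define G where "G = g ^ Suc k"
    have "fps_deriv H = fps_deriv \<rho> * g ^ k * (M * S) + \<rho> * fps_deriv (g ^ k) * (M * S)
        + \<rho> * g ^ k * fps_deriv (M * S)"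
      unfolding H_def by (simp only: fps_deriv_mult) (simp only: algebra_simps)
    also have "\<dots> = fps_deriv \<rho> * (G * B) * (M * S) - \<rho> * (fps_const (of_nat k) * G * fps_deriv B) * (M * S)
        + \<rho> * (G * B) * (fps_const (of_nat k + 3/2) * S)"
      unfolding gk MS gS G_def by simp
    finally show ?thesis unfolding G_def[symmetric] by (simp add: algebra_simps)
  qed
  have tA: "taylor_poly a A = fps_X * B"
    unfolding A taylor_poly_mult taylor_poly_linear B_def by (simp add: mult.assoc)
  have tA': "taylor_poly a (pderiv A) = B + fps_X * fps_deriv B"
    unfolding taylor_poly_pderiv tA by simp
  have tM: "taylor_poly a [:N, 1:] = M"
    unfolding taylor_poly_linear M_def by (simp add: add.commute)
  have "taylor_poly a (smult (of_nat k + 3/2) (r * A)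
           + [:N, 1:] * (pderiv r * A - smult (of_nat k) (r * pderiv A))) * g ^ Suc k * S
      = fps_X * fps_deriv H - fps_const (of_nat k) * (\<rho> * (g ^ Suc k * B) * (M * S))"
    unfolding taylor_poly_add taylor_poly_mult taylor_poly_smult taylor_poly_diff tA tA' tM H'
    by (simp only: taylor_poly_pderiv \<rho>_def[symmetric]) (simp add: algebra_simps)
  also have "\<dots> = fps_X * fps_deriv H - fps_const (of_nat k) * H"
    unfolding gS H_def by simp
  finally have eq: "taylor_poly a (smult (of_nat k + 3/2) (r * A)
           + [:N, 1:] * (pderiv r * A - smult (of_nat k) (r * pderiv A))) * g ^ Suc k * S
      = fps_X * fps_deriv H - fps_const (of_nat k) * H" .
  \<comment> \<open>This series is X^(k + 1) times the derivative of X^(-k) H; its coefficient of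
    index k is (k - k) times that of H.\<close>
  have "fps_nth (fps_X * fps_deriv H - fps_const (of_nat k) * H) k = 0"
    by (cases k) simp_all
  then show ?thesis
    unfolding pade_def using eq unfolding g_def B_def S_def by simp
qed

text \<open>The test polynomial cancels the other two poles and lowers the pole at \<open>a\<close>
  to order one. Together with \<open>pade_vanish\<close> it singles out one of the three
  points.\<close>

lemma pade_isolate:
  assumes "d \<noteq> 0" "e \<noteq> 0"
  shows "pade N k a d e ([:- a, 1:] ^ k * ([:d - a, 1:] * [:e - a, 1:]) ^ Suc k) = (N + a) ^ k"
proof -
  let ?B = "(fps_X + fps_const d) * (fps_X + fps_const e)"
  have gB: "inverse ?B * ?B = 1" by (rule inverse_mult_eq_1) (use assms in simp)
  have "taylor_poly a ([:- a, 1:] ^ k * ([:d - a, 1:] * [:e - a, 1:]) ^ Suc k) * inverse ?B ^ Suc k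
      = fps_X ^ k * (inverse ?B * ?B) ^ Suc k"
    unfolding taylor_poly_mult taylor_poly_power taylor_poly_linear power_mult_distrib
    by (simp add: algebra_simps)
  then show ?thesis
    unfolding pade_def gB by (simp add: fps_X_power_mult_nth sqrt_series_def)
qed

lemma pade_vanish: "pade N k a d e ([:- a, 1:] ^ Suc k * q) = 0"
proof -
  have "pade N k a d e ([:- a, 1:] ^ Suc k * q) = fps_nth (fps_X ^ Suc k * (taylor_poly a q *
      inverse ((fps_X + fps_const d) * (fps_X + fps_const e)) ^ Suc k * sqrt_series N a k)) k"
    unfolding pade_def taylor_poly_mult taylor_poly_power taylor_poly_linear by (simp add: mult.assoc)
  also have "\<dots> = 0" unfolding fps_X_power_mult_nth by simp
  finally show ?thesis .
qed

text \<open>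
  If the combination vanishes on \<open>1, z, z\<^sup>2\<close>, then by \<open>pade_derivative\<close> it vanishes on all powers
  of \<open>z\<close>, since the leading coefficient \<open>m - 2 k + 3/2\<close> of the derived polynomial is never zero.
\<close>

lemma pade_nonvanishing:
  fixes N :: complex
  assumes N: "N \<noteq> 0" "N + 1 \<noteq> 0" "N - 4 \<noteq> 0"
    and zero: "\<And>i. i \<le> 2 \<Longrightarrow> X0 * pade N k 0 (-1) 4 (monom 1 i)
      + X1 * pade N k 1 1 5 (monom 1 i) + X2 * pade N k (-4) (-4) (-5) (monom 1 i) = 0"
  shows "X0 = 0"
proof -
  define L where "L = (\<lambda>q. X0 * pade N k 0 (-1) 4 q
      + X1 * pade N k 1 1 5 q + X2 * pade N k (-4) (-4) (-5) q)"
  have L_add: "L (p + q) = L p + L q" and L_smult: "L (smult c q) = c * L q" for p q c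
    by (simp_all add: L_def pade_add pade_smult algebra_simps)
  have L_monom: "L (monom c n) = c * L (monom 1 n)" for c n
    using L_smult[of c "monom 1 n"] by (simp add: smult_monom)
  \<comment> \<open>A(z) = z (z - 1) (z + 4). The parameters d and e at each root are its
    differences to the other two roots.\<close>
  define A :: "complex poly" where "A = [:0, -4, 3, 1:]"
  have A0: "A = [:- 0, 1:] * [:-1 - 0, 1:] * [:4 - 0, 1:]"
    and A1: "A = [:- 1, 1:] * [:1 - 1, 1:] * [:5 - 1, 1:]"
    and A2: "A = [:- (-4), 1:] * [:-4 - (-4), 1:] * [:-5 - (-4), 1:]"
    unfolding A_def by simp_all
  have der: "L (smult (of_nat k + 3/2) (r * A)
           + [:N, 1:] * (pderiv r * A - smult (of_nat k) (r * pderiv A))) = 0" for r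
    unfolding L_def
    using pade_derivative[OF _ _ _ A0, of N k r] pade_derivative[OF _ _ _ A1, of N k r]
      pade_derivative[OF _ _ _ A2, of N k r] N by simp
  have rec: "(of_nat m - 2 * of_nat k + 3/2) * L (monom 1 (m + 3)) +
      c2 m * L (monom 1 (m + 2)) + c1 m * L (monom 1 (m + 1)) + c0 m * L (monom 1 m) = 0"
    if c: "c2 = (\<lambda>m. 3 * (of_nat k + 3/2) + 3 * of_nat m - 6 * of_nat k
              + N * (of_nat m - 3 * of_nat k))"
          "c1 = (\<lambda>m. - 4 * (of_nat k + 3/2) - 4 * of_nat m + 4 * of_nat k
              + N * (3 * of_nat m - 6 * of_nat k))"
          "c0 = (\<lambda>m. N * (4 * of_nat k - 4 * of_nat m))" for m and c0 c1 c2 :: "nat \<Rightarrow> complex"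
  proof -
    have Am: "A = monom 1 3 + monom 3 2 + monom (-4) 1"
      and A'm: "pderiv A = monom 3 2 + monom 6 1 + monom (-4) 0"
      and Nm: "[:N, 1:] = monom N 0 + monom 1 1"
      unfolding A_def by (simp_all add: monom_altdef pderiv_pCons numeral_eq_Suc)
    have dm: "pderiv (monom 1 m) * A =
        monom (of_nat m) (m + 2) + monom (3 * of_nat m) (m + 1) + monom (- 4 * of_nat m) m"
      unfolding Am pderiv_monom
      by (cases m) (simp_all add: distrib_left mult_monom numeral_eq_Suc algebra_simps)
    have "smult (of_nat k + 3/2) (monom 1 m * A)
           + [:N, 1:] * (pderiv (monom 1 m) * A - smult (of_nat k) (monom 1 m * pderiv A))
      = monom (of_nat m - 2 * of_nat k + 3/2) (m + 3) + monom (c2 m) (m + 2)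
         + monom (c1 m) (m + 1) + monom (c0 m) m" (is "?l = ?r")
      unfolding dm A'm unfolding Am Nm c
      by (rule poly_eqI) (simp add: algebra_simps mult_monom smult_monom)
    then have "L ?r = 0" using der[of "monom 1 m"] by simp
    then show ?thesis
      by (simp only: L_add L_monom[of "of_nat m - 2 * of_nat k + 3/2"] L_monom[of "c2 m"]
        L_monom[of "c1 m"] L_monom[of "c0 m"])
  qed
  have Lm: "L (monom 1 m) = 0" for m
  proof (induction m rule: less_induct)
    case (less m)
    show ?case
    proof (cases "m \<le> 2")
      case True
      then show ?thesis unfolding L_def by (rule zero)
    next
      case False
      define j where "j = m - 3"
      have j: "m = j + 3" using False unfolding j_def by simp
      have "L (monom 1 (j + 2)) = 0" "L (monom 1 (j + 1)) = 0" "L (monom 1 j) = 0"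
        using less.IH j by simp_all
      then have "(of_nat j - 2 * of_nat k + 3/2) * L (monom 1 m) = 0"
        using rec[OF refl refl refl, of j] j by simp
      \<comment> \<open>Vanishing would mean 2 j + 3 = 4 k, impossible by parity.\<close>
      moreover have "of_nat j - 2 * of_nat k + 3/2 \<noteq> (0::complex)"
      proof
        assume "of_nat j - 2 * of_nat k + 3/2 = (0::complex)"
        then have "of_nat (2 * j + 3) = (of_nat (4 * k) :: complex)" by (simp add: field_simps)
        then have "2 * j + 3 = 4 * k" by (simp only: of_nat_eq_iff)
        then show False by presburger
      qed
      ultimately show ?thesis by simp
    qed
  qed
  have L_sum: "L (\<Sum>i\<le>n. monom (f i) i) = 0" for f n
    by (induction n) (simp_all add: L_add L_monom[of "f i" for i] Lm Lm[of 0, simplified])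
  have L0: "L q = 0" for q
    using L_sum[of "coeff q" "degree q"] by (simp add: poly_as_sum_of_monoms)
  \<comment> \<open>Its residues at 1 and -4 vanish, while the one at 0 is N^k, so only X0
    survives.\<close>
  define q0 :: "complex poly" where "q0 = [:0, 1:] ^ k * ([:-1, 1:] * [:4, 1:]) ^ Suc k"
  have "pade N k 0 (-1) 4 q0 = N ^ k"
    using pade_isolate[of "-1" 4 N k 0] by (simp add: q0_def)
  moreover have "pade N k 1 1 5 q0 = 0"
  proof -
    have "q0 = [:-1, 1:] ^ Suc k * ([:0, 1:] ^ k * [:4, 1:] ^ Suc k)"
      unfolding q0_def power_mult_distrib by (simp only: mult_ac)
    then show ?thesis using pade_vanish[of N k 1 1 5] by simp
  qed
  moreover have "pade N k (-4) (-4) (-5) q0 = 0"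
  proof -
    have "q0 = [:4, 1:] ^ Suc k * ([:0, 1:] ^ k * [:-1, 1:] ^ Suc k)"
      unfolding q0_def power_mult_distrib by (simp only: mult_ac)
    then show ?thesis using pade_vanish[of N k "-4" "-4" "-5"] by simp
  qed
  ultimately have "X0 * N ^ k = 0" using L0[of q0] unfolding L_def by simp
  then show ?thesis using N(1) by simp
qed

section \<open>Denominators of the Pade coefficients\<close>

lemma gbinomial_minus_half:
  "4 ^ h * ((- 1/2) gchoose h) = ((- 1) ^ h * of_nat ((2 * h) choose h) :: complex)"
proof -
  have b: "(of_nat ((2 * h) choose h) :: complex) = fact (2 * h) / (fact h * fact h)"
    using binomial_fact[of h "2 * h", where ?'a = complex] by (simp add: mult_2)
  have "(4::complex) ^ h = 2 ^ (2 * h)" by (simp add: power_mult)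
  then show ?thesis
    unfolding b gbinomial_pochhammer fact_double by simp
qed

text \<open>Pascal's rule raises the upper index from -1/2, where central binomial coefficients
  occur, in unit steps; hence the inner statement uses n - 1/2.\<close>

lemma four_power_gbinomial_half_int:
  "4 ^ h * ((of_nat k + 1/2) gchoose h) \<in> (\<int> :: complex set)"
proof -
  have "4 ^ h * ((of_nat n - 1/2) gchoose h) \<in> (\<int> :: complex set)" for n
  proof (induction n arbitrary: h)
    case 0
    have "4 ^ h * ((of_nat 0 - 1/2) gchoose h) = (- 1) ^ h * (of_nat ((2 * h) choose h) :: complex)"
      using gbinomial_minus_half[of h] by simp
    then show ?case by simp
  next
    case (Suc n)
    show ?case
    proof (cases h)
      case (Suc j)
      have "(of_nat (Suc n) - 1/2 :: complex) = (of_nat n - 1/2) + 1" by simp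
      then have "4 ^ h * ((of_nat (Suc n) - 1/2) gchoose h) =
          4 * (4 ^ j * ((of_nat n - 1/2) gchoose j)) + (4 ^ h * ((of_nat n - 1/2) gchoose h) :: complex)"
        unfolding Suc by (simp only: gbinomial_Suc_Suc) (simp add: algebra_simps)
      then show ?thesis by (simp only:) (intro Ints_add Ints_mult Ints_numeral Suc.IH)
    qed simp
  qed
  from this[of "Suc k"] show ?thesis by (simp add: algebra_simps)
qed

context discrete_subring
begin

lemma Ints_subset: "x \<in> \<int> \<Longrightarrow> x \<in> R"
  by (auto elim: Ints_cases)

text \<open>F(20 X) has coefficients in \<open>R\<close> up to degree k. The factor 20 = 4 * 5
  covers the powers of 4 from half-integer binomials and the differences 1, 4, 5 of the roots. The
  cut at k is needed because (N + a)^(k - h) must remain a polynomial.\<close>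

definition scaled_coeffs :: "nat \<Rightarrow> complex fps \<Rightarrow> bool" where
  "scaled_coeffs k F \<longleftrightarrow> (\<forall>h\<le>k. 20 ^ h * fps_nth F h \<in> R)"

lemma scaled_coeffs_mult:
  assumes "scaled_coeffs k F" "scaled_coeffs k G" shows "scaled_coeffs k (F * G)"
  unfolding scaled_coeffs_def
proof (intro allI impI)
  fix h assume h: "h \<le> k"
  have "20 ^ h * fps_nth (F * G) h = (\<Sum>i=0..h. (20 ^ i * fps_nth F i) * (20 ^ (h - i) * fps_nth G (h - i)))"
    unfolding fps_mult_nth sum_distrib_left
  proof (intro sum.cong refl)
    fix i assume "i \<in> {0..h}"
    then have "(20::complex) ^ h = 20 ^ i * 20 ^ (h - i)" by (simp flip: power_add)
    then show "20 ^ h * (fps_nth F i * fps_nth G (h - i)) =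
        20 ^ i * fps_nth F i * (20 ^ (h - i) * fps_nth G (h - i))" by simp
  qed
  also have "\<dots> \<in> R"
  proof (intro sum)
    fix i assume "i \<in> {0..h}"
    then have "20 ^ i * fps_nth F i \<in> R" "20 ^ (h - i) * fps_nth G (h - i) \<in> R"
      using assms h unfolding scaled_coeffs_def by simp_all
    then show "20 ^ i * fps_nth F i * (20 ^ (h - i) * fps_nth G (h - i)) \<in> R" by (rule mult)
  qed
  finally show "20 ^ h * fps_nth (F * G) h \<in> R" .
qed

lemma scaled_coeffs_power: "scaled_coeffs k F \<Longrightarrow> scaled_coeffs k (F ^ n)"
proof (induction n)
  case 0
  show ?case by (auto simp: scaled_coeffs_def)
qed (simp add: scaled_coeffs_mult)

lemma scaled_coeffs_inverse_linear:
  assumes "d \<noteq> 0" "20 / d \<in> \<int>"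
  shows "scaled_coeffs k (fps_const d * inverse (fps_X + fps_const d))"
proof -
  define F where "F = Abs_fps (\<lambda>h. (- (1 / d)) ^ h)"
  have "(fps_X + fps_const d) * F = fps_const d"
  proof (rule fps_ext)
    fix h show "fps_nth ((fps_X + fps_const d) * F) h = fps_nth (fps_const d) h"
      using assms(1) by (cases h) (simp_all add: F_def distrib_right)
  qed
  then have "inverse (fps_X + fps_const d) * ((fps_X + fps_const d) * F) =
      fps_const d * inverse (fps_X + fps_const d)" by (simp add: mult.commute)
  moreover have "inverse (fps_X + fps_const d) * (fps_X + fps_const d) = 1"
    by (rule inverse_mult_eq_1) (use assms in simp)
  ultimately have eq: "fps_const d * inverse (fps_X + fps_const d) = F"
    by (simp flip: mult.assoc)
  have "20 ^ h * fps_nth F h = (- (20 / d)) ^ h" for h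
    unfolding F_def by (simp flip: power_mult_distrib)
  then show ?thesis
    unfolding eq scaled_coeffs_def using Ints_subset[OF assms(2)] by auto
qed

text \<open>For the three points d e is -4, 5 and 20, so one more factor 20 clears the constant
  term.\<close>

lemma scaled_coeffs_inverse_quadratic:
  assumes "d \<noteq> 0" "20 / d \<in> \<int>" "e \<noteq> 0" "20 / e \<in> \<int>" "20 / (d * e) \<in> \<int>"
  shows "scaled_coeffs k (fps_const 20 * inverse ((fps_X + fps_const d) * (fps_X + fps_const e)))"
proof -
  have "20 / (d * e) * d * e = 20" using assms(1,3) by simp
  then have c: "fps_const 20 = fps_const (20 / (d * e)) * fps_const d * fps_const e"
    unfolding fps_const_mult by simp
  have "fps_const 20 * inverse ((fps_X + fps_const d) * (fps_X + fps_const e)) =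
      fps_const (20 / (d * e)) * ((fps_const d * inverse (fps_X + fps_const d)) *
        (fps_const e * inverse (fps_X + fps_const e)))"
    unfolding fps_inverse_mult c by (simp only: mult_ac)
  moreover have "scaled_coeffs k (fps_const (20 / (d * e)))"
    unfolding scaled_coeffs_def using Ints_subset[OF assms(5)] by auto
  ultimately show ?thesis using assms
    by (simp only:) (intro scaled_coeffs_mult scaled_coeffs_inverse_linear)
qed

lemma scaled_coeffs_sqrt_series:
  assumes "N \<in> R" "a \<in> R" "N + a \<noteq> 0" shows "scaled_coeffs k (sqrt_series N a k)"
  unfolding scaled_coeffs_def
proof (intro allI impI)
  fix h assume h: "h \<le> k"
  have "20 ^ h * fps_nth (sqrt_series N a k) h =
      5 ^ h * (4 ^ h * ((of_nat k + 1/2) gchoose h)) * (N + a) ^ (k - h)"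
    using h assms(3) by (simp add: sqrt_series_def power_diff flip: power_mult_distrib mult.assoc)
  also have "\<dots> \<in> R"
    using assms by (intro mult power add numeral Ints_subset[OF four_power_gbinomial_half_int])
  finally show "20 ^ h * fps_nth (sqrt_series N a k) h \<in> R" .
qed

lemma scaled_coeffs_taylor_poly_monom:
  assumes "a \<in> R" shows "scaled_coeffs k (taylor_poly a (monom 1 i))"
proof -
  have "taylor_poly a (monom 1 i) = (fps_X + fps_const a) ^ i"
    unfolding monom_altdef taylor_poly_smult taylor_poly_power taylor_poly_linear by simp
  moreover have "scaled_coeffs k (fps_X + fps_const a)"
    unfolding scaled_coeffs_def using assms by (auto simp: fps_X_def)
  ultimately show ?thesis by (simp add: scaled_coeffs_power)
qed

text \<open>The exponent is k for the coefficient index plus k + 1 for the copies of the inverse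
  quadratic.\<close>

lemma pade_integral:
  assumes "N \<in> R" "a \<in> R" "N + a \<noteq> 0" 
    and "d \<noteq> 0" "20 / d \<in> \<int>" "e \<noteq> 0" "20 / e \<in> \<int>" "20 / (d * e) \<in> \<int>"
  shows "20 ^ (2 * k + 1) * pade N k a d e (monom 1 i) \<in> R"
proof -
  let ?g = "inverse ((fps_X + fps_const d) * (fps_X + fps_const e))"
  have "scaled_coeffs k (taylor_poly a (monom 1 i) * (fps_const 20 * ?g) ^ Suc k * sqrt_series N a k)"
    using assms by (intro scaled_coeffs_mult scaled_coeffs_power scaled_coeffs_taylor_poly_monom
        scaled_coeffs_inverse_quadratic scaled_coeffs_sqrt_series)
  then have "20 ^ k * fps_nth (taylor_poly a (monom 1 i) * (fps_const 20 * ?g) ^ Suc k * sqrt_series N a k) k \<in> R"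
    unfolding scaled_coeffs_def by blast
  also have "taylor_poly a (monom 1 i) * (fps_const 20 * ?g) ^ Suc k * sqrt_series N a k =
      fps_const (20 ^ Suc k) * (taylor_poly a (monom 1 i) * ?g ^ Suc k * sqrt_series N a k)"
    unfolding power_mult_distrib fps_const_power by (simp only: mult_ac)
  also have "20 ^ k * fps_nth \<dots> k = 20 ^ (2 * k + 1) * pade N k a d e (monom 1 i)"
    unfolding pade_def fps_mult_left_const_nth by (simp only: mult_2 mult_2_right power_add power_Suc power_one_right mult_ac)
  finally show ?thesis .
qed

end

section \<open>Residues and size estimates for the approximations\<close>

lemma one_plus_divide_not_nonpos:
  assumes "cmod z < cmod N" shows "1 + z / N \<notin> \<real>\<^sub>\<le>\<^sub>0"
proof -
  have "cmod (z / N) < 1" using assms by (auto simp: norm_divide divide_simps)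
  moreover have "- Re (z / N) \<le> cmod (z / N)" using abs_Re_le_cmod[of "z / N"] by linarith
  ultimately have "Re (1 + z / N) > 0" by simp
  then show ?thesis by (auto simp: complex_nonpos_Reals_iff)
qed

text \<open>Up to the polynomial factor this is (N + z)^(k + 1/2) / N^(1/2), in a branch holomorphic
  on |z| < |N|. Dividing by N^(1/2) makes the coefficients at 0, 1, -4 appear with weights 1, sqrt(1
  + 1/N), sqrt(1 - 4/N).\<close>

definition pade_numerator :: "complex \<Rightarrow> nat \<Rightarrow> complex poly \<Rightarrow> complex \<Rightarrow> complex" where
  "pade_numerator N k q z = poly q z * ((N + z) ^ k * csqrt (1 + z / N))"

lemma pade_numerator_holomorphic: "pade_numerator N k q holomorphic_on ball 0 (cmod N)"
  unfolding pade_numerator_def[abs_def]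
  by (intro holomorphic_intros one_plus_divide_not_nonpos) auto

lemma has_fps_expansion_taylor_poly:
  "(\<lambda>w. poly q (a + w)) has_fps_expansion taylor_poly a q"
proof -
  have "eval_fps (taylor_poly a q) has_fps_expansion taylor_poly a q"
    by (rule eval_fps_has_fps_expansion) (simp add: taylor_poly_def)
  then show ?thesis by (simp add: taylor_poly_def poly_pcompose eval_fps_of_poly[abs_def])
qed

text \<open>Both sides have the same square and the same nonzero value at 0.\<close>

lemma has_fps_expansion_sqrt_series:
  assumes a: "cmod a < cmod N"
  shows "(\<lambda>w. (N + (a + w)) ^ k * csqrt (1 + (a + w) / N)) has_fps_expansion
    fps_const (csqrt (1 + a / N)) * sqrt_series N a k"
proof -
  define f where "f = (\<lambda>z. (N + z) ^ k * csqrt (1 + z / N))"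
  define T where "T = fps_expansion f a"
  define S where "S = fps_const (csqrt (1 + a / N)) * sqrt_series N a k"
  have N: "N \<noteq> 0" using a by auto
  have Na: "N + a \<noteq> 0" using a by (metis add_eq_0_iff norm_minus_cancel order_less_irrefl)
  then have \<theta>: "csqrt (1 + a / N) \<noteq> 0" using N by (auto simp: field_simps)
  have "f holomorphic_on ball 0 (cmod N)"
    unfolding f_def by (intro holomorphic_intros one_plus_divide_not_nonpos) auto
  then have "f analytic_on {a}" using a by (auto simp: analytic_at intro!: exI[of _ "ball 0 (cmod N)"])
  then have T: "(\<lambda>w. f (a + w)) has_fps_expansion T"
    unfolding T_def by (rule analytic_at_imp_has_fps_expansion)
  have sq: "f (a + w) ^ 2 = 1 / N * (w + (N + a)) ^ (2 * k + 1)" for w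
  proof -
    have "f (a + w) ^ 2 = ((N + (a + w)) ^ k) ^ 2 * (1 + (a + w) / N)"
      unfolding f_def power_mult_distrib by simp
    also have "1 + (a + w) / N = (w + (N + a)) / N" using N by (simp add: field_simps)
    also have "((N + (a + w)) ^ k) ^ 2 = (w + (N + a)) ^ (2 * k)"
      by (simp add: power_mult[symmetric] mult.commute add_ac)
    finally show ?thesis by simp
  qed
  have "(\<lambda>w. f (a + w) ^ 2) has_fps_expansion T ^ 2"
    by (rule has_fps_expansion_power[OF T])
  moreover have "(\<lambda>w. 1 / N * (w + (N + a)) ^ (2 * k + 1)) has_fps_expansion
      fps_const (1 / N) * (fps_X + fps_const (N + a)) ^ (2 * k + 1)"
    by (intro fps_expansion_intros)
  ultimately have "T ^ 2 = fps_const (1 / N) * (fps_X + fps_const (N + a)) ^ (2 * k + 1)"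
    unfolding sq by (rule fps_expansion_unique_complex)
  also have "\<dots> = fps_const (1 / N) * (fps_const (N + a) * sqrt_series N a k ^ 2)"
    unfolding sqrt_series_square[OF Na] ..
  also have "\<dots> = fps_const (1 / N * (N + a)) * sqrt_series N a k ^ 2"
    by (simp only: fps_const_mult[symmetric] mult.assoc)
  also have "1 / N * (N + a) = csqrt (1 + a / N) ^ 2" using N by (simp add: field_simps)
  also have "fps_const (csqrt (1 + a / N) ^ 2) * sqrt_series N a k ^ 2 = S ^ 2"
    unfolding S_def power_mult_distrib fps_const_power ..
  finally have "(T - S) * (T + S) = 0" by (simp add: algebra_simps power2_eq_square)
  moreover have "T + S \<noteq> 0"
  proof
    assume "T + S = 0"
    then have "fps_nth T 0 + fps_nth S 0 = 0" by (metis fps_add_nth fps_zero_nth)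
    moreover have "fps_nth T 0 = f a"
      using has_fps_expansion_imp_0_eq_fps_nth_0[OF T] by simp
    moreover have "fps_nth S 0 = f a"
      by (simp add: S_def sqrt_series_def f_def)
    moreover have "f a \<noteq> 0" unfolding f_def using Na \<theta> by simp
    ultimately show False by simp
  qed
  ultimately have "T = S" by simp
  then show ?thesis using T unfolding S_def f_def by simp
qed

text \<open>The factor \<open>csqrt (1 + a / N)\<close> is the quotient of the two normalisations:
  \<open>pade\<close> divides by (N + a)^(1/2), \<open>pade_numerator\<close> by N^(1/2).\<close>

lemma higher_deriv_pade:
  assumes a: "cmod a < cmod N" and de: "d \<noteq> 0" "e \<noteq> 0"
  shows "(deriv ^^ k) (\<lambda>z. pade_numerator N k q z * inverse ((z - a + d) * (z - a + e)) ^ Suc k) a / fact k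
    = csqrt (1 + a / N) * pade N k a d e q"
proof -
  let ?f = "\<lambda>z. pade_numerator N k q z * inverse ((z - a + d) * (z - a + e)) ^ Suc k"
  have "(\<lambda>w. poly q (a + w) * ((N + (a + w)) ^ k * csqrt (1 + (a + w) / N)) *
        inverse ((w + d) * (w + e)) ^ Suc k)
     has_fps_expansion taylor_poly a q * (fps_const (csqrt (1 + a / N)) * sqrt_series N a k) *
        inverse ((fps_X + fps_const d) * (fps_X + fps_const e)) ^ Suc k"
    by (intro has_fps_expansion_mult has_fps_expansion_taylor_poly has_fps_expansion_sqrt_series[OF a]
        has_fps_expansion_power has_fps_expansion_inverse fps_expansion_intros)
       (use de in simp)
  also have "(\<lambda>w. poly q (a + w) * ((N + (a + w)) ^ k * csqrt (1 + (a + w) / N)) *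
        inverse ((w + d) * (w + e)) ^ Suc k) = ?f \<circ> (\<lambda>w. a + w)"
    by (simp add: fun_eq_iff pade_numerator_def)
  finally have "(deriv ^^ k) (?f \<circ> (\<lambda>w. a + w)) 0 / fact k =
      fps_nth (taylor_poly a q * (fps_const (csqrt (1 + a / N)) * sqrt_series N a k) *
        inverse ((fps_X + fps_const d) * (fps_X + fps_const e)) ^ Suc k) k"
    by (rule fps_nth_fps_expansion[symmetric])
  also have "taylor_poly a q * (fps_const (csqrt (1 + a / N)) * sqrt_series N a k) *
        inverse ((fps_X + fps_const d) * (fps_X + fps_const e)) ^ Suc k =
      fps_const (csqrt (1 + a / N)) * (taylor_poly a q *
        inverse ((fps_X + fps_const d) * (fps_X + fps_const e)) ^ Suc k * sqrt_series N a k)"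
    by (simp only: mult_ac)
  finally show ?thesis
    unfolding pade_def fps_mult_left_const_nth by (subst higher_deriv_shift_0)
qed

lemma pade_factor_holomorphic:
  assumes "ball a r \<subseteq> ball 0 (cmod N)" "cmod d \<ge> r" "cmod e \<ge> r"
  shows "(\<lambda>z. pade_numerator N k q z * inverse ((z - a + d) * (z - a + e)) ^ Suc k) holomorphic_on ball a r"
proof -
  have nz: "z - a + c \<noteq> 0" if "z \<in> ball a r" "cmod c \<ge> r" for z c
  proof
    assume "z - a + c = 0"
    then have "c = a - z" by (simp add: algebra_simps eq_neg_iff_add_eq_0)
    then show False using that by (simp add: dist_norm)
  qed
  show ?thesis
    by (intro holomorphic_intros holomorphic_on_subset[OF pade_numerator_holomorphic] assms(1))
       (use nz assms in auto)
qed

lemma residue_pade: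
  assumes a: "cmod a < cmod N" and de: "d \<noteq> 0" "e \<noteq> 0"
  shows "residue (\<lambda>z. pade_numerator N k q z / ((z - a) * ((z - a + d) * (z - a + e))) ^ Suc k) a
    = csqrt (1 + a / N) * pade N k a d e q"
proof -
  define r where "r = min (cmod N - cmod a) (min (cmod d) (cmod e))"
  have r: "r > 0" using a de by (simp add: r_def)
  have sub: "ball a r \<subseteq> ball 0 (cmod N)"
  proof
    fix z assume "z \<in> ball a r"
    then have "cmod (a - z) < cmod N - cmod a" by (simp add: r_def dist_norm)
    then show "z \<in> ball 0 (cmod N)" using norm_triangle_ineq4[of a "a - z"] by simp
  qed
  let ?f = "\<lambda>z. pade_numerator N k q z * inverse ((z - a + d) * (z - a + e)) ^ Suc k"
  have "residue (\<lambda>z. ?f z / (z - a) ^ Suc k) a = (deriv ^^ k) ?f a / fact k"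
    by (rule residue_holomorphic_over_power[of "ball a r"])
       (use r pade_factor_holomorphic[OF sub] in \<open>auto simp: r_def\<close>)
  also have "(\<lambda>z. ?f z / (z - a) ^ Suc k) =
      (\<lambda>z. pade_numerator N k q z / ((z - a) * ((z - a + d) * (z - a + e))) ^ Suc k)"
    by (simp add: fun_eq_iff divide_inverse power_mult_distrib mult_ac power_inverse)
  finally show ?thesis unfolding higher_deriv_pade[OF a de] .
qed

lemma pade_cauchy_bound:
  assumes r: "r > 0" "cmod a + r < cmod N" "cmod d > r" "cmod e > r"
    and B: "\<And>z. cmod (z - a) = r \<Longrightarrow>
      cmod (pade_numerator N k q z * inverse ((z - a + d) * (z - a + e)) ^ Suc k) \<le> B"
  shows "cmod (csqrt (1 + a / N) * pade N k a d e q) \<le> B / r ^ k"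
proof -
  let ?f = "\<lambda>z. pade_numerator N k q z * inverse ((z - a + d) * (z - a + e)) ^ Suc k"
  define s where "s = min (cmod N - cmod a) (min (cmod d) (cmod e))"
  have s: "s > r" using r by (simp add: s_def)
  have sub: "ball a s \<subseteq> ball 0 (cmod N)"
  proof
    fix z assume "z \<in> ball a s"
    then have "cmod (a - z) < cmod N - cmod a" by (simp add: s_def dist_norm)
    then show "z \<in> ball 0 (cmod N)" using norm_triangle_ineq4[of a "a - z"] by simp
  qed
  have hol: "?f holomorphic_on ball a s"
    by (rule pade_factor_holomorphic[OF sub]) (auto simp: s_def)
  have "cmod ((deriv ^^ k) ?f a) \<le> fact k * B / r ^ k"
  proof (rule Cauchy_inequality)
    show "?f holomorphic_on ball a r" by (rule holomorphic_on_subset[OF hol]) (use s in auto)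
    show "continuous_on (cball a r) ?f"
      by (rule holomorphic_on_imp_continuous_on, rule holomorphic_on_subset[OF hol]) (use s in auto)
    show "cmod (?f z) \<le> B" if "cmod (a - z) = r" for z
      using B[of z] that by (simp add: norm_minus_commute)
  qed (use r in simp)
  then have "cmod ((deriv ^^ k) ?f a / fact k) \<le> B / r ^ k"
    by (simp add: norm_divide field_simps)
  then show ?thesis
    using higher_deriv_pade[of a N d e k q] r by (simp del: power_Suc) force
qed

lemma norm_csqrt_one_plus_le:
  assumes "cmod z \<le> c * cmod N" "N \<noteq> 0" "1 + c \<le> b\<^sup>2" "b \<ge> 0"
  shows "cmod (csqrt (1 + z / N)) \<le> b"
proof -
  have "(cmod (csqrt (1 + z / N)))\<^sup>2 = cmod (1 + z / N)" by (simp flip: norm_power)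
  also have "\<dots> \<le> 1 + cmod (z / N)" using norm_triangle_ineq[of 1 "z / N"] by simp
  also have "\<dots> \<le> 1 + c" using assms(1,2) by (simp add: norm_divide field_simps)
  also have "\<dots> \<le> b\<^sup>2" by (rule assms(3))
  finally show ?thesis by (rule power2_le_imp_le[OF _ assms(4)])
qed

lemma norm_csqrt_one_plus_ge:
  assumes "cmod z \<le> c * cmod N" "N \<noteq> 0" "b\<^sup>2 \<le> 1 - c" "b \<ge> 0"
  shows "b \<le> cmod (csqrt (1 + z / N))"
proof -
  have "cmod (z / N) \<le> c" using assms(1,2) by (simp add: norm_divide field_simps)
  then have "b\<^sup>2 \<le> 1 - cmod (z / N)" using assms(3) by linarith
  also have "\<dots> \<le> cmod (1 + z / N)" using norm_diff_ineq[of 1 "z / N"] by simp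
  also have "\<dots> = (cmod (csqrt (1 + z / N)))\<^sup>2" by (simp flip: norm_power)
  finally show ?thesis by (rule power2_le_imp_le) simp
qed

lemma pade_numerator_monom_bound:
  assumes z: "cmod z \<le> c * cmod N" "N \<noteq> 0" "1 + c \<le> b\<^sup>2" "b \<ge> 0"
    and C: "cmod z \<le> C" "1 \<le> C" and i: "i \<le> 2"
  shows "cmod (pade_numerator N k (monom 1 i) z) \<le> C\<^sup>2 * ((cmod N + cmod z) ^ k * b)"
proof -
  have "cmod z ^ i \<le> C ^ i" using C by (intro power_mono) auto
  also have "\<dots> \<le> C ^ 2" using C i by (intro power_increasing) auto
  finally have "cmod (z ^ i) \<le> C\<^sup>2" by (simp add: norm_power)
  moreover have "cmod ((N + z) ^ k) \<le> (cmod N + cmod z) ^ k"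
    unfolding norm_power by (intro power_mono norm_triangle_ineq) auto
  ultimately show ?thesis
    unfolding pade_numerator_def norm_mult poly_monom using norm_csqrt_one_plus_le[OF z] C
    by (intro mult_mono) (auto simp: mult_nonneg_nonneg)
qed

text \<open>On the circle of radius 1/2 about 1, |z (z + 4)| >= 9/4. With the factor 2^k from
  Cauchy's inequality the growth rate is 8/9 (|N| + 3/2). The point 0 needs no such bound, because
  its coefficient is absorbed into the remainder.\<close>

lemma pade_bound_1:
  assumes N: "cmod N \<ge> 1000" and i: "i \<le> 2"
  shows "cmod (csqrt (1 + 1 / N) * pade N k 1 1 5 (monom 1 i)) \<le> 3 * (9/10 * cmod N) ^ k"
proof -
  have "cmod (csqrt (1 + 1 / N) * pade N k 1 1 5 (monom 1 i)) \<le>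
      (9/4 * ((cmod N + 3/2) ^ k * 2) * (4/9) ^ Suc k) / (1/2) ^ k"
  proof (rule pade_cauchy_bound)
    fix z assume z: "cmod (z - 1) = 1/2"
    have z1: "cmod z \<le> 3/2" using norm_triangle_ineq[of "z - 1" 1] z by simp
    have z2: "1/2 \<le> cmod z" using norm_triangle_ineq[of "1 - z" z] z by (simp add: norm_minus_commute)
    have "5 \<le> cmod (z + 4) + 1/2" using norm_triangle_ineq[of "1 - z" "z + 4"] z
      by (simp add: norm_minus_commute)
    then have "9/4 \<le> cmod z * cmod (z + 4)" using z2 mult_mono[of "1/2" "cmod z" "9/2" "cmod (z + 4)"] by simp
    then have "inverse (cmod (z * (z + 4))) \<le> 4/9"
      unfolding norm_mult by (metis inverse_divide le_imp_inverse_le divide_pos_pos zero_less_numeral)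
    then have inv: "cmod (inverse ((z - 1 + 1) * (z - 1 + 5)) ^ Suc k) \<le> (4/9) ^ Suc k"
      unfolding norm_power norm_inverse by (intro power_mono) (auto simp: algebra_simps)
    have "cmod (pade_numerator N k (monom 1 i) z) \<le> (3/2)\<^sup>2 * ((cmod N + cmod z) ^ k * 2)"
      by (rule pade_numerator_monom_bound[of z 1]) (use z1 N i in auto)
    also have "\<dots> \<le> 9/4 * ((cmod N + 3/2) ^ k * 2)"
      using z1 by (intro mult_mono power_mono) (auto simp: power2_eq_square)
    finally show "cmod (pade_numerator N k (monom 1 i) z * inverse ((z - 1 + 1) * (z - 1 + 5)) ^ Suc k)
        \<le> 9/4 * ((cmod N + 3/2) ^ k * 2) * (4/9) ^ Suc k"
      unfolding norm_mult using inv by (intro mult_mono) auto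
  qed (use N in auto)
  also have "\<dots> = 2 * (8/9 * (cmod N + 3/2)) ^ k"
    by (simp add: power_mult_distrib power_divide) (simp add: field_simps flip: power_mult_distrib)
  also have "\<dots> \<le> 3 * (9/10 * cmod N) ^ k"
    by (rule mult_mono[OF _ power_mono]) (use N in auto)
  finally show ?thesis .
qed

text \<open>On the circle of radius 1 about -4, |z (z - 1)| >= 12. The true rate is far smaller;
  9/10 only matches the bound at the point 1.\<close>

lemma pade_bound_2:
  assumes N: "cmod N \<ge> 1000" and i: "i \<le> 2"
  shows "cmod (csqrt (1 + (-4) / N) * pade N k (-4) (-4) (-5) (monom 1 i)) \<le> 5 * (9/10 * cmod N) ^ k"
proof -
  have "cmod (csqrt (1 + (-4) / N) * pade N k (-4) (-4) (-5) (monom 1 i)) \<le>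
      (25 * ((cmod N + 5) ^ k * 2) * (1/12) ^ Suc k) / 1 ^ k"
  proof (rule pade_cauchy_bound)
    fix z assume z: "cmod (z - (-4)) = 1"
    have z1: "cmod z \<le> 5" using norm_triangle_ineq4[of "z + 4" 4] z by simp
    have z2: "3 \<le> cmod z" using norm_triangle_ineq4[of "z + 4" z] z by simp
    have "4 \<le> cmod (z - 1)" using norm_triangle_ineq4[of "z + 4" "z - 1"] z by simp
    then have "12 \<le> cmod z * cmod (z - 1)" using z2 mult_mono[of 3 "cmod z" 4 "cmod (z - 1)"] by simp
    then have "inverse (cmod (z * (z - 1))) \<le> 1/12"
      unfolding norm_mult by (metis inverse_eq_divide le_imp_inverse_le zero_less_numeral)
    then have inv: "cmod (inverse ((z - (-4) + (-4)) * (z - (-4) + (-5))) ^ Suc k) \<le> (1/12) ^ Suc k"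
      unfolding norm_power norm_inverse by (intro power_mono) auto
    have "cmod (pade_numerator N k (monom 1 i) z) \<le> 5\<^sup>2 * ((cmod N + cmod z) ^ k * 2)"
      by (rule pade_numerator_monom_bound[of z 1]) (use z1 N i in auto)
    also have "\<dots> \<le> 25 * ((cmod N + 5) ^ k * 2)"
      using z1 by (intro mult_mono power_mono) auto
    finally show "cmod (pade_numerator N k (monom 1 i) z *
        inverse ((z - (-4) + (-4)) * (z - (-4) + (-5))) ^ Suc k)
        \<le> 25 * ((cmod N + 5) ^ k * 2) * (1/12) ^ Suc k"
      unfolding norm_mult using inv by (intro mult_mono) auto
  qed (use N in auto)
  also have "\<dots> = 50/12 * ((cmod N + 5) / 12) ^ k"
    by (simp add: power_divide)
  also have "\<dots> \<le> 5 * (9/10 * cmod N) ^ k"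
    by (rule mult_mono[OF _ power_mono]) (use N in auto)
  finally show ?thesis .
qed

text \<open>The weighted sum is the sum of all residues, hence a contour integral over a large
  circle. There the numerator grows like n^k and the denominator like n^(3 k).\<close>

lemma pade_remainder_bound:
  assumes N: "cmod N \<ge> 1000" and i: "i \<le> 2"
  shows "cmod (pade N k 0 (-1) 4 (monom 1 i) + csqrt (1 + 1 / N) * pade N k 1 1 5 (monom 1 i)
      + csqrt (1 + (-4) / N) * pade N k (-4) (-4) (-5) (monom 1 i)) \<le> 2 * (18 / (5 * (cmod N)\<^sup>2)) ^ k"
proof -
  define n where "n = cmod N"
  \<comment> \<open>Inside the disc |z| < n of holomorphy, but with (4/5)^3 = 64/125 still above
    1/2.\<close>
  define R where "R = 4/5 * n"
  have n: "n \<ge> 1000" "N \<noteq> 0" using N by (auto simp: n_def)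
  have R: "R > 5" "R < n" using n by (auto simp: R_def)
  let ?g = "\<lambda>z. pade_numerator N k (monom 1 i) z / (z * ((z - 1) * (z + 4))) ^ Suc k"
  let ?res = "pade N k 0 (-1) 4 (monom 1 i) + csqrt (1 + 1 / N) * pade N k 1 1 5 (monom 1 i)
      + csqrt (1 + (-4) / N) * pade N k (-4) (-4) (-5) (monom 1 i)"
  have r0: "residue ?g 0 = pade N k 0 (-1) 4 (monom 1 i)"
    using residue_pade[of 0 N "-1" 4 k "monom 1 i"] n(2) by simp
  have r1: "residue ?g 1 = csqrt (1 + 1 / N) * pade N k 1 1 5 (monom 1 i)"
    using residue_pade[of 1 N 1 5 k "monom 1 i"] n by (simp add: n_def mult.left_commute algebra_simps)
  have r2: "residue ?g (-4) = csqrt (1 + (-4) / N) * pade N k (-4) (-4) (-5) (monom 1 i)"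
    using residue_pade[of "-4" N "-4" "-5" k "monom 1 i"] n by (simp add: n_def mult_ac)
  have hol: "?g holomorphic_on ball 0 n - {0, 1, -4}"
    by (intro holomorphic_intros holomorphic_on_subset[OF pade_numerator_holomorphic])
       (auto simp: n_def eq_neg_iff_add_eq_0)
  have path: "path_image (circlepath 0 R) = sphere 0 R" using R by simp
  have cont: "contour_integral (circlepath 0 R) ?g = 2 * pi * \<i> *
      (\<Sum>p\<in>{0, 1, -4}. winding_number (circlepath 0 R) p * residue ?g p)"
  proof (rule Residue_theorem[of "ball 0 n"])
    show "path_image (circlepath 0 R) \<subseteq> ball 0 n - {0, 1, -4}"
      unfolding path using R by auto
    show "\<forall>z. z \<notin> ball 0 n \<longrightarrow> winding_number (circlepath 0 R) z = 0"
    proof (intro allI impI)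
      fix z :: complex assume "z \<notin> ball 0 n"
      moreover have "path_image (circlepath 0 R) \<subseteq> ball 0 n" unfolding path using R by auto
      ultimately show "winding_number (circlepath 0 R) z = 0"
        by (intro winding_number_zero_outside[of _ "ball 0 n"]) (auto intro: valid_path_imp_path)
    qed
  qed (use hol in auto)
  also have "(\<Sum>p\<in>{0, 1, -4}. winding_number (circlepath 0 R) p * residue ?g p) = ?res"
    unfolding r0[symmetric] r1[symmetric] r2[symmetric]
    using R by (simp add: winding_number_circlepath add.assoc del: power_Suc)
  finally have I: "contour_integral (circlepath 0 R) ?g = 2 * pi * \<i> * ?res" .
  have "?g contour_integrable_on circlepath 0 R"
    by (rule contour_integrable_continuous_circlepath, rule holomorphic_on_imp_continuous_on,
        rule holomorphic_on_subset[OF hol]) (use R path in auto)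
  then have has: "(?g has_contour_integral (2 * pi * \<i> * ?res)) (circlepath 0 R)"
    using has_contour_integral_integral[of ?g "circlepath 0 R"] unfolding I by blast
  define B where "B = R\<^sup>2 * ((9/5 * n) ^ k * (3/2)) / (n ^ 3 / 2) ^ Suc k"
  have norm_2pi: "cmod (2 * pi * \<i> * w) = 2 * pi * cmod w" for w
    by (simp add: norm_mult)
  have "cmod (2 * pi * \<i> * ?res) \<le> B * (2 * pi * R)"
  proof (rule has_contour_integral_bound_circlepath[OF has])
    show "B \<ge> 0" using n R by (simp add: B_def)
    show "R > 0" using R by simp
    fix z assume "cmod (z - 0) = R"
    then have z: "cmod z = R" by simp
    have "cmod (pade_numerator N k (monom 1 i) z) \<le> R\<^sup>2 * ((cmod N + cmod z) ^ k * (3/2))"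
      by (rule pade_numerator_monom_bound[of z "4/5"])
         (use z n i R in \<open>auto simp: R_def n_def power2_eq_square\<close>)
    also have "cmod N + cmod z = 9/5 * n" unfolding z R_def n_def by simp
    finally have num: "cmod (pade_numerator N k (monom 1 i) z) \<le> R\<^sup>2 * ((9/5 * n) ^ k * (3/2))" .
    have "R - 1 \<le> cmod (z - 1)" "R - 4 \<le> cmod (z + 4)"
      using norm_triangle_ineq2[of z 1] norm_diff_ineq[of z 4] z by auto
    then have "R * ((R - 1) * (R - 4)) \<le> cmod z * (cmod (z - 1) * cmod (z + 4))"
      using R z by (intro mult_mono) auto
    \<comment> \<open>The surplus 64/125 - 1/2 = 12/1000 in the cubic term pays for the quadratic
      term once n >= 1000.\<close>
    moreover have "n ^ 3 / 2 \<le> R * ((R - 1) * (R - 4))"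
    proof -
      have "0 \<le> n * (n * (n - 1000) * (12/1000) + 44/5 * n + 16/5)"
        using n by (intro mult_nonneg_nonneg add_nonneg_nonneg) auto
      also have "\<dots> = R * ((R - 1) * (R - 4)) - n ^ 3 / 2"
        unfolding R_def by (simp add: field_simps power3_eq_cube)
      finally show ?thesis by simp
    qed
    ultimately have "n ^ 3 / 2 \<le> cmod (z * ((z - 1) * (z + 4)))" by (simp add: norm_mult)
    then have den: "(n ^ 3 / 2) ^ Suc k \<le> cmod ((z * ((z - 1) * (z + 4))) ^ Suc k)"
      unfolding norm_power using n by (intro power_mono) auto
    show "cmod (?g z) \<le> B"
      unfolding norm_divide B_def
    proof (rule frac_le[OF _ num _ den])
      show "0 \<le> R\<^sup>2 * ((9/5 * n) ^ k * (3/2))" using n by simp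
      show "0 < (n ^ 3 / 2) ^ Suc k" using n by (intro zero_less_power) simp
    qed
  qed
  then have "2 * pi * cmod ?res \<le> 2 * pi * (B * R)"
    unfolding norm_2pi by (simp only: mult_ac)
  then have "cmod ?res \<le> B * R" by simp
  also have "B * R = (192/125) * (18 / (5 * n\<^sup>2)) ^ k"
  proof -
    have "9/5 * n / (n ^ 3 / 2) = 18 / (5 * n\<^sup>2)"
      using n by (simp add: field_simps power2_eq_square power3_eq_cube)
    then have p: "(9/5 * n) ^ k / (n ^ 3 / 2) ^ k = (18 / (5 * n\<^sup>2)) ^ k"
      by (simp only: power_divide[symmetric])
    have "B * R = (R\<^sup>2 * R * (3/2) / (n ^ 3 / 2)) * ((9/5 * n) ^ k / (n ^ 3 / 2) ^ k)"
      unfolding B_def by simp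
    also have "R\<^sup>2 * R * (3/2) / (n ^ 3 / 2) = 192/125"
      using n unfolding R_def by (simp add: field_simps power2_eq_square power3_eq_cube)
    finally show ?thesis unfolding p .
  qed
  also have "\<dots> \<le> 2 * (18 / (5 * n\<^sup>2)) ^ k" by (intro mult_right_mono) auto
  finally show ?thesis unfolding n_def .
qed

section \<open>Simultaneous approximation\<close>

text \<open>The factors Y - \<theta> U and Y + \<theta> U have product \<delta>, and the larger has
  size at least |\<theta> U|. The sign of Y makes the difference the smaller one.\<close>

lemma sqrt_approximation:
  fixes X U \<theta> \<delta> :: complex
  assumes eq: "X\<^sup>2 = \<theta>\<^sup>2 * U\<^sup>2 + \<delta>" and \<theta>: "cmod \<theta> \<ge> 9/10" and U: "U \<noteq> 0"
  obtains Y where "Y = X \<or> Y = - X" "cmod (Y - \<theta> * U) \<le> 10/9 * cmod \<delta> / cmod U"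
proof -
  have *: "cmod (Y - \<theta> * U) \<le> 10/9 * cmod \<delta> / cmod U"
    if Y: "Y\<^sup>2 = X\<^sup>2" and le: "cmod (Y - \<theta> * U) \<le> cmod (Y + \<theta> * U)" for Y
  proof -
    have "2 * (\<theta> * U) = (Y + \<theta> * U) - (Y - \<theta> * U)" by simp
    then have "2 * (cmod \<theta> * cmod U) \<le> cmod (Y + \<theta> * U) + cmod (Y - \<theta> * U)"
      using norm_triangle_ineq4[of "Y + \<theta> * U" "Y - \<theta> * U"] by (metis norm_mult norm_numeral)
    then have "cmod \<theta> * cmod U \<le> cmod (Y + \<theta> * U)" using le by simp
    moreover have "9/10 * cmod U \<le> cmod \<theta> * cmod U" using \<theta> by (intro mult_right_mono) auto
    ultimately have ge: "9/10 * cmod U \<le> cmod (Y + \<theta> * U)" by linarith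
    have "(Y - \<theta> * U) * (Y + \<theta> * U) = \<delta>"
      using Y eq by (simp add: algebra_simps power2_eq_square)
    then have "cmod (Y - \<theta> * U) * cmod (Y + \<theta> * U) = cmod \<delta>" by (metis norm_mult)
    moreover have "cmod (Y - \<theta> * U) * (9/10 * cmod U) \<le> cmod (Y - \<theta> * U) * cmod (Y + \<theta> * U)"
      using ge by (intro mult_left_mono) auto
    ultimately show ?thesis using U by (simp add: field_simps)
  qed
  show thesis
  proof (cases "cmod (X - \<theta> * U) \<le> cmod (X + \<theta> * U)")
    case True
    then show ?thesis using *[of X] that[of X] by simp
  next
    case False
    then have "cmod (- X - \<theta> * U) \<le> cmod (- X + \<theta> * U)"
      by (metis (no_types, lifting) add.commute add_uminus_conv_diff minus_add_distrib
          minus_diff_eq nle_le norm_minus_cancel)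
    then show ?thesis using *[of "- X"] that[of "- X"] by simp
  qed
qed

lemma approximation_contradiction:
  fixes n x :: real
  assumes n: "n \<ge> 3000000" and x: "x \<ge> n ^ 22"
    and ineq: "\<And>k. 1 \<le> 40 * x * (1440 / n\<^sup>2) ^ k + 580 / (n * x) * (360 * n) ^ k"
  shows False
proof -
  define q where "q = n\<^sup>2 / 1440"
  have n0: "n > 0" using n by simp
  have x1: "x \<ge> 1" using x n one_le_power[of n 22] by linarith
  have "1440 * 1 < n * n" using n by (intro mult_strict_mono) auto
  then have q: "q > 1" "q \<le> n\<^sup>2" unfolding q_def by (auto simp: power2_eq_square)
  \<comment> \<open>This makes the first term less than 1/2. Minimality gives 1 / x <= 80 / q^(k -
    1), whence the index \<open>j\<close>.\<close>
  define k where "k = (LEAST k. q ^ k > 80 * x)"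
  have k: "q ^ k > 80 * x" unfolding k_def
    by (rule LeastI_ex) (use real_arch_pow[OF q(1)] in blast)
  have "k \<noteq> 0" using k x1 by (intro notI) simp
  then obtain j where j: "k = Suc j" by (cases k) auto
  have qj: "q ^ j \<le> 80 * x"
    using not_less_Least[of j "\<lambda>k. q ^ k > 80 * x"] j unfolding k_def by linarith
  have "q ^ 11 \<le> (n\<^sup>2) ^ 11" using q by (intro power_mono) auto
  also have "\<dots> \<le> x" using x by (simp flip: power_mult)
  also have "\<dots> < q ^ k" using k x1 by linarith
  finally have "11 < k" by (rule power_less_imp_less_exp[OF q(1)])
  then have j11: "11 \<le> j" using j by simp
  have first: "40 * x * (1440 / n\<^sup>2) ^ k < 1/2"
  proof -
    have "1440 / n\<^sup>2 = 1 / q" unfolding q_def by simp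
    then have "40 * x * (1440 / n\<^sup>2) ^ k = 40 * x / q ^ k" by (simp add: power_one_over)
    also have "\<dots> < 1/2" using k q by (simp add: field_simps)
    finally show ?thesis .
  qed
  have second: "580 / (n * x) * (360 * n) ^ k < 1/2"
  proof -
    have "1 / x \<le> 80 / q ^ j" using qj x1 q by (simp add: field_simps)
    then have "580 / (n * x) * (360 * n) ^ k \<le> (580 / n * (360 * n) ^ k) * (80 / q ^ j)"
      using n0 mult_left_mono[of "1 / x" "80 / q ^ j" "580 / n * (360 * n) ^ k"] by simp
    also have "\<dots> = 580 * 360 * 80 * ((360 * n) ^ j / q ^ j)"
      using n0 unfolding j by (simp add: field_simps)
    also have "(360 * n) ^ j / q ^ j = (518400 / n) ^ j"
    proof -
      have "360 * n / q = 518400 / n" using n0 unfolding q_def by (simp add: field_simps power2_eq_square)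
      then show ?thesis by (simp only: power_divide[symmetric])
    qed
    \<comment> \<open>Eleven factors 1/5 are needed: 580 * 360 * 80 = 16704000 lies below 5^11 / 2
      but above 5^10 / 2.\<close>
    also have "(518400 / n) ^ j \<le> (1/5) ^ j" using n by (intro power_mono) (auto simp: field_simps)
    also have "(1/5) ^ j \<le> (1/5 :: real) ^ 11" using j11 by (intro power_decreasing) auto
    finally have "580 / (n * x) * (360 * n) ^ k \<le> 580 * 360 * 80 * (1/5) ^ 11" by simp
    then show ?thesis by (simp add: power_one_over)
  qed
  show False using ineq[of k] first second by linarith
qed

context discrete_subring
begin

text \<open>A nonzero combination W of the coefficients with weights U, V, Z has size at least 1
  after scaling into \<open>R\<close>; replacing V and Z by their approximations bounds it from
  above.\<close>

lemma pade_inequality: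
  assumes N: "N \<in> R" "cmod N \<ge> 1000"
    and R: "U \<in> R" "V \<in> R" "Z \<in> R" and U: "U \<noteq> 0"
    and V: "cmod (V - csqrt (1 + 1 / N) * U) \<le> 10/9 * (1 / cmod N) / cmod U"
    and Z: "cmod (Z - csqrt (1 + (-4) / N) * U) \<le> 10/9 * (4 / cmod N) / cmod U"
  shows "1 \<le> 40 * cmod U * (1440 / (cmod N)\<^sup>2) ^ k + 580 / (cmod N * cmod U) * (360 * cmod N) ^ k"
proof -
  define \<theta>\<^sub>1 \<theta>\<^sub>2 where "\<theta>\<^sub>1 = csqrt (1 + 1 / N)" and "\<theta>\<^sub>2 = csqrt (1 + (-4) / N)"
  have N0: "N \<noteq> 0" using N by auto
  have N': "N + 1 \<noteq> 0" "N - 4 \<noteq> 0"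
    using N norm_diff_ineq[of N 1] norm_triangle_ineq2[of N 4] by auto
  have \<theta>: "cmod \<theta>\<^sub>1 \<ge> 9/10" "cmod \<theta>\<^sub>2 \<ge> 9/10" unfolding \<theta>\<^sub>1_def \<theta>\<^sub>2_def
    by (rule norm_csqrt_one_plus_ge[of _ "1/100"]; use N N0 in \<open>simp add: power2_eq_square\<close>)+
  let ?p0 = "\<lambda>i. pade N k 0 (-1) 4 (monom 1 i)" and ?p1 = "\<lambda>i. pade N k 1 1 5 (monom 1 i)"
    and ?p2 = "\<lambda>i. pade N k (-4) (-4) (-5) (monom 1 i)"
  obtain i where i: "i \<le> 2" "U * ?p0 i + V * ?p1 i + Z * ?p2 i \<noteq> 0"
    using pade_nonvanishing[OF N0 N', of U k V Z] U by blast
  define W where "W = U * ?p0 i + V * ?p1 i + Z * ?p2 i"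
  have int: "20 ^ (2 * k + 1) * ?p0 i \<in> R" "20 ^ (2 * k + 1) * ?p1 i \<in> R"
      "20 ^ (2 * k + 1) * ?p2 i \<in> R"
    by (rule pade_integral; use N N0 N' in \<open>auto simp: add_eq_0_iff\<close>)+
  have "20 ^ (2 * k + 1) * W = U * (20 ^ (2 * k + 1) * ?p0 i) + V * (20 ^ (2 * k + 1) * ?p1 i)
      + Z * (20 ^ (2 * k + 1) * ?p2 i)" unfolding W_def by (simp only: algebra_simps)
  also have "\<dots> \<in> R" by (intro add mult R int)
  finally have "1 \<le> cmod (20 ^ (2 * k + 1) * W)"
    using i by (intro norm_ge_1) (auto simp: W_def)
  then have one: "1 \<le> 20 * 400 ^ k * cmod W"
    by (simp add: norm_mult norm_power power_add power_mult)
  define I where "I = ?p0 i + \<theta>\<^sub>1 * ?p1 i + \<theta>\<^sub>2 * ?p2 i"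
  \<comment> \<open>All that is large cancels in I; the rest carries the approximation errors of V
    and Z.\<close>
  have "W = U * I + (V - \<theta>\<^sub>1 * U) * ?p1 i + (Z - \<theta>\<^sub>2 * U) * ?p2 i"
    unfolding W_def I_def by (simp add: algebra_simps)
  then have "cmod W \<le> cmod (U * I) + cmod ((V - \<theta>\<^sub>1 * U) * ?p1 i) + cmod ((Z - \<theta>\<^sub>2 * U) * ?p2 i)"
    by (metis add_right_mono norm_triangle_ineq norm_triangle_le)
  also have "cmod (U * I) \<le> cmod U * (2 * (18 / (5 * (cmod N)\<^sup>2)) ^ k)"
    unfolding norm_mult I_def \<theta>\<^sub>1_def \<theta>\<^sub>2_def using pade_remainder_bound[OF N(2) i(1), of k]
    by (intro mult_left_mono) auto
  also have "cmod ((V - \<theta>\<^sub>1 * U) * ?p1 i) \<le> (10/9 * (1 / cmod N) / cmod U) * (10/9 * (3 * (9/10 * cmod N) ^ k))"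
  proof -
    have "9/10 * cmod (?p1 i) \<le> cmod \<theta>\<^sub>1 * cmod (?p1 i)" using \<theta> by (intro mult_right_mono) auto
    then have "cmod (?p1 i) \<le> 10/9 * (3 * (9/10 * cmod N) ^ k)"
      using pade_bound_1[OF N(2) i(1), of k] unfolding \<theta>\<^sub>1_def[symmetric] norm_mult by linarith
    then show ?thesis unfolding norm_mult using V unfolding \<theta>\<^sub>1_def by (intro mult_mono) auto
  qed
  also have "cmod ((Z - \<theta>\<^sub>2 * U) * ?p2 i) \<le> (10/9 * (4 / cmod N) / cmod U) * (10/9 * (5 * (9/10 * cmod N) ^ k))"
  proof -
    have "9/10 * cmod (?p2 i) \<le> cmod \<theta>\<^sub>2 * cmod (?p2 i)" using \<theta> by (intro mult_right_mono) auto
    then have "cmod (?p2 i) \<le> 10/9 * (5 * (9/10 * cmod N) ^ k)"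
      using pade_bound_2[OF N(2) i(1), of k] unfolding \<theta>\<^sub>2_def[symmetric] norm_mult by linarith
    then show ?thesis unfolding norm_mult using Z unfolding \<theta>\<^sub>2_def by (intro mult_mono) auto
  qed
  \<comment> \<open>2300/81 is (10/9)^2 (1 * 3 + 4 * 5). Multiplication by 20 * 400^k then yields
    1440 = 400 * 18/5, 360 = 400 * 9/10 and 46000/81 <= 580.\<close>
  finally have W: "cmod W \<le> 2 * cmod U * (18 / (5 * (cmod N)\<^sup>2)) ^ k
      + 2300/81 * (1 / (cmod N * cmod U)) * (9/10 * cmod N) ^ k"
    by (simp add: field_simps)
  have "1 \<le> 20 * 400 ^ k * (2 * cmod U * (18 / (5 * (cmod N)\<^sup>2)) ^ k
      + 2300/81 * (1 / (cmod N * cmod U)) * (9/10 * cmod N) ^ k)"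
    by (rule order_trans[OF one mult_left_mono[OF W]]) simp
  also have "\<dots> = 40 * cmod U * (400 ^ k * (18 / (5 * (cmod N)\<^sup>2)) ^ k)
      + (46000/81) * (1 / (cmod N * cmod U)) * (400 ^ k * (9/10 * cmod N) ^ k)"
    by (simp add: algebra_simps)
  also have "400 ^ k * (18 / (5 * (cmod N)\<^sup>2)) ^ k = (1440 / (cmod N)\<^sup>2) ^ k"
    unfolding power_mult_distrib[symmetric] by simp
  also have "400 ^ k * (9/10 * cmod N) ^ k = (360 * cmod N) ^ k"
    unfolding power_mult_distrib[symmetric] by simp
  also have "(46000/81) * (1 / (cmod N * cmod U)) * (360 * cmod N) ^ k \<le>
      580 * (1 / (cmod N * cmod U)) * (360 * cmod N) ^ k"
    by (intro mult_right_mono) auto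
  finally show ?thesis by simp
qed

lemma pell_large_solution:
  assumes t: "t \<in> R" "cmod t > 1544803" and e: "cmod e = 1"
    and R: "U \<in> R" "V \<in> R" "Z \<in> R"
    and V: "(2 * t + 1) * U\<^sup>2 - 2 * t * V\<^sup>2 = e"
    and Z: "(t - 2) * U\<^sup>2 - t * Z\<^sup>2 = - 2 * e"
  shows "cmod U < cmod t ^ 24"
proof (rule ccontr)
  assume "\<not> ?thesis"
  then have large: "cmod t ^ 24 \<le> cmod U" by simp
  define N where "N = 2 * t"
  define n where "n = cmod N"
  have N: "N \<in> R" "cmod N \<ge> 3000000" using t unfolding N_def by (auto simp: norm_mult)
  have t0: "t \<noteq> 0" using t by auto
  have N0: "N \<noteq> 0" using t0 by (simp add: N_def)
  have "cmod t ^ 24 > 0" using t0 by simp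
  then have U0: "U \<noteq> 0" using large by auto
  have \<theta>: "cmod (csqrt (1 + 1 / N)) \<ge> 9/10" "cmod (csqrt (1 + (-4) / N)) \<ge> 9/10"
    by (rule norm_csqrt_one_plus_ge[of _ "1/100"]; use N N0 in \<open>simp add: power2_eq_square\<close>)+
  \<comment> \<open>Both equations divided by their coefficient of V^2 or Z^2: the errors of V / U
    and Z / U are of order 1 / (|N| |U|^2).\<close>
  have V': "V\<^sup>2 = (csqrt (1 + 1 / N))\<^sup>2 * U\<^sup>2 + (- e / N)"
    using V t0 unfolding N_def by (simp add: field_simps)
  have Z': "Z\<^sup>2 = (csqrt (1 + (-4) / N))\<^sup>2 * U\<^sup>2 + 4 * e / N"
    using Z t0 unfolding N_def by (simp add: field_simps)
  obtain V1 where V1: "V1 = V \<or> V1 = - V"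
      "cmod (V1 - csqrt (1 + 1 / N) * U) \<le> 10/9 * cmod (- e / N) / cmod U"
    using sqrt_approximation[OF V' \<theta>(1) U0] .
  obtain Z1 where Z1: "Z1 = Z \<or> Z1 = - Z"
      "cmod (Z1 - csqrt (1 + (-4) / N) * U) \<le> 10/9 * cmod (4 * e / N) / cmod U"
    using sqrt_approximation[OF Z' \<theta>(2) U0] .
  have R1: "V1 \<in> R" "Z1 \<in> R" using V1 Z1 R by auto
  have "1 \<le> 40 * cmod U * (1440 / (cmod N)\<^sup>2) ^ k + 580 / (cmod N * cmod U) * (360 * cmod N) ^ k" for k
    by (rule pade_inequality[OF N(1) _ R(1) R1 U0])
       (use N V1(2) Z1(2) e in \<open>simp_all add: norm_divide norm_mult\<close>)
  moreover have "(cmod N) ^ 22 \<le> cmod U"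
  proof -
    \<comment> \<open>Two of the 24 powers of |t| absorb the factor 2^22 in passing from |t| to |N|
      = 2 |t|.\<close>
    have "(2::real) ^ 22 \<le> cmod t * cmod t" using t mult_mono[of 1544803 "cmod t" 1544803 "cmod t"] by simp
    then have "2 ^ 22 * cmod t ^ 22 \<le> cmod t ^ 2 * cmod t ^ 22"
      unfolding power2_eq_square by (intro mult_right_mono) auto
    then have "(cmod N) ^ 22 \<le> cmod t ^ 24"
      unfolding N_def norm_mult power_mult_distrib power_add[symmetric] by simp
    then show ?thesis using large by linarith
  qed
  ultimately show False using approximation_contradiction[OF N(2)] by blast
qed

theorem pell_system:
  assumes "t \<in> R" "cmod t > 1544803" "cmod e = 1" "U \<in> R" "V \<in> R" "Z \<in> R"
    and "(2 * t + 1) * U\<^sup>2 - 2 * t * V\<^sup>2 = e" "(t - 2) * U\<^sup>2 - t * Z\<^sup>2 = - 2 * e"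
  shows "U\<^sup>2 = e"
  using pell_small_solution[OF assms(1) _ assms(3-8)] pell_large_solution[OF assms] assms(2) by simp

end

section \<open>The quartic order\<close>

context discrete_subring
begin

text \<open>Adjoining to \<open>R\<close> a square root that lies in its fraction field keeps it discrete.\<close>

lemma norm_ge_1_quadratic_fraction:
  assumes s: "s\<^sup>2 \<in> R" and c: "c \<in> R" "c \<noteq> 0" "c * s \<in> R"
    and x: "a \<in> R" "b \<in> R" "x = a + b * s" "x \<noteq> 0"
  shows "cmod x \<ge> 1"
proof (rule ccontr)
  assume "\<not> ?thesis"
  then have lt: "cmod x < 1" by simp
  have "\<exists>a\<in>R. \<exists>b\<in>R. x ^ n = a + b * s" for n
  proof (induction n)
    case 0
    then show ?case by (intro bexI[of _ 1] bexI[of _ 0]) auto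
  next
    case (Suc n)
    then obtain a' b' where ab: "a' \<in> R" "b' \<in> R" "x ^ n = a' + b' * s" by blast
    have "x ^ Suc n = (a + b * s) * (a' + b' * s)" using ab(3) x(3) by simp
    then have "x ^ Suc n = (a * a' + b * b' * s\<^sup>2) + (a * b' + b * a') * s"
      by (simp add: algebra_simps power2_eq_square)
    then show ?case using ab s x by blast
  qed
  \<comment> \<open>The single denominator c serves all powers of x, whereas |x| < 1 would make c
    x^n tend to 0.\<close>
  then have "c * x ^ n \<in> R" for n
  proof -
    obtain a' b' where ab: "a' \<in> R" "b' \<in> R" "x ^ n = a' + b' * s"
      using \<open>\<And>n. \<exists>a\<in>R. \<exists>b\<in>R. x ^ n = a + b * s\<close> by blast
    have "c * x ^ n = c * a' + b' * (c * s)" unfolding ab(3) by (simp add: algebra_simps)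
    then show ?thesis using ab c by auto
  qed
  then have ge: "cmod c * cmod x ^ n \<ge> 1" for n
    using norm_ge_1[of "c * x ^ n"] c x(4) by (simp add: norm_mult norm_power)
  have "(\<lambda>n. cmod c * cmod x ^ n) \<longlonglongrightarrow> cmod c * 0"
    by (intro tendsto_intros LIMSEQ_power_zero) (use lt in simp)
  then have "1 \<le> cmod c * 0"
    by (rule LIMSEQ_le_const) (use ge in auto)
  then show False by simp
qed

text \<open>Lying outside the fraction field of \<open>R\<close>, expressed without forming that
  field.\<close>

definition irrational :: "complex \<Rightarrow> bool" where
  "irrational s \<longleftrightarrow> (\<forall>c\<in>R. c \<noteq> 0 \<longrightarrow> c * s \<notin> R)"

text \<open>For s in the fraction field both factors of K have size at least 1, hence at most 25,
  and their sum 2 A is too small. The bound 25 is the largest K that occurs.\<close>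

lemma irrationalI:
  assumes s: "s\<^sup>2 \<in> R" and A: "A \<in> R" "m \<in> R" and K: "(A - m * s) * (A + m * s) = K"
    "K \<noteq> 0" "cmod K \<le> 25" and large: "cmod A > 25"
  shows "irrational s"
  unfolding irrational_def
proof (intro ballI impI notI)
  fix c assume c: "c \<in> R" "c \<noteq> 0" "c * s \<in> R"
  have nz: "A - m * s \<noteq> 0" "A + m * s \<noteq> 0" using K by auto
  have ge: "cmod (A - m * s) \<ge> 1" "cmod (A + m * s) \<ge> 1"
    using norm_ge_1_quadratic_fraction[OF s c A(1), of "- m" "A - m * s"]
      norm_ge_1_quadratic_fraction[OF s c A(1) A(2), of "A + m * s"] nz A uminus by auto
  have prod: "cmod (A - m * s) * cmod (A + m * s) \<le> 25" using K by (simp flip: norm_mult)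
  have "cmod (A - m * s) \<le> 25" "cmod (A + m * s) \<le> 25"
    using prod ge mult_left_mono[OF ge(2), of "cmod (A - m * s)"]
      mult_right_mono[OF ge(1), of "cmod (A + m * s)"] by auto
  moreover have "2 * A = (A - m * s) + (A + m * s)" by simp
  then have "2 * cmod A \<le> cmod (A - m * s) + cmod (A + m * s)"
    by (metis norm_mult norm_numeral norm_triangle_ineq)
  ultimately show False using large by linarith
qed

lemma irrational_square_eq:
  assumes "irrational s" "a \<in> R" "b \<in> R" "a\<^sup>2 = (b * s)\<^sup>2"
  shows "a = 0 \<and> b = 0"
proof -
  have "a = b * s \<or> a = - (b * s)" using assms(4) by (simp add: power2_eq_iff)
  then have bs: "b * s \<in> R" using assms(2) uminus[of a] by auto
  then have "b = 0" using assms(1,3) unfolding irrational_def by blast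
  then show ?thesis using assms(4) by simp
qed

lemma irrational_cross_term:
  assumes "irrational s" "a \<in> R" "b \<in> R" "a + b * s = 0"
  shows "b = 0"
proof -
  have "b * s = - a" using assms(4) by (simp add: eq_neg_iff_add_eq_0 add.commute)
  then have "b * s \<in> R" using uminus[OF assms(2)] by simp
  then show ?thesis using assms(1,3) unfolding irrational_def by blast
qed

text \<open>
  Moving two of the four terms to the other side and squaring, in each of the three possible
  ways, gives three relations between the coefficients.
\<close>

lemma biquadratic_independent:
  assumes R: "a \<in> R" "b \<in> R" "c \<in> R" "d \<in> R" "p\<^sup>2 \<in> R" "q\<^sup>2 \<in> R" "r\<^sup>2 \<in> R"
    and nz: "p \<noteq> 0" "q \<noteq> 0" "r \<noteq> 0"
    and irr: "irrational (p * q)" "irrational (r * p)" "irrational (r * q)"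
    and eq: "a + b * (p * q) + c * (r * p) + d * (r * q) = 0"
  shows "a = 0 \<and> b = 0 \<and> c = 0 \<and> d = 0"
proof -
  have sq: "a\<^sup>2 \<in> R" "b\<^sup>2 \<in> R" "c\<^sup>2 \<in> R" "d\<^sup>2 \<in> R" using R by auto
  have 1: "a * b = c * d * r\<^sup>2"
  proof -
    have "a + b * (p * q) = - (c * (r * p) + d * (r * q))" using eq by (simp add: algebra_simps eq_neg_iff_add_eq_0)
    then have "(a + b * (p * q))\<^sup>2 = (c * (r * p) + d * (r * q))\<^sup>2" by (simp only: power2_minus)
    then have "(a\<^sup>2 + b\<^sup>2 * p\<^sup>2 * q\<^sup>2 - c\<^sup>2 * r\<^sup>2 * p\<^sup>2 - d\<^sup>2 * r\<^sup>2 * q\<^sup>2)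
        + (2 * (a * b - c * d * r\<^sup>2)) * (p * q) = 0"
      by (simp add: algebra_simps power2_eq_square)
    then have "2 * (a * b - c * d * r\<^sup>2) = 0"
      by (rule irrational_cross_term[OF irr(1), rotated 2]) (intro add diff mult numeral R sq)+
    then show ?thesis by simp
  qed
  have 2: "a * c = b * d * q\<^sup>2"
  proof -
    have "a + c * (r * p) = - (b * (p * q) + d * (r * q))" using eq by (simp add: algebra_simps eq_neg_iff_add_eq_0)
    then have "(a + c * (r * p))\<^sup>2 = (b * (p * q) + d * (r * q))\<^sup>2" by (simp only: power2_minus)
    then have "(a\<^sup>2 + c\<^sup>2 * p\<^sup>2 * r\<^sup>2 - b\<^sup>2 * p\<^sup>2 * q\<^sup>2 - d\<^sup>2 * r\<^sup>2 * q\<^sup>2)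
        + (2 * (a * c - b * d * q\<^sup>2)) * (r * p) = 0"
      by (simp add: algebra_simps power2_eq_square)
    then have "2 * (a * c - b * d * q\<^sup>2) = 0"
      by (rule irrational_cross_term[OF irr(2), rotated 2]) (intro add diff mult numeral R sq)+
    then show ?thesis by simp
  qed
  have 3: "a * d = b * c * p\<^sup>2"
  proof -
    have "a + d * (r * q) = - (b * (p * q) + c * (r * p))" using eq by (simp add: algebra_simps eq_neg_iff_add_eq_0)
    then have "(a + d * (r * q))\<^sup>2 = (b * (p * q) + c * (r * p))\<^sup>2" by (simp only: power2_minus)
    then have "(a\<^sup>2 + d\<^sup>2 * q\<^sup>2 * r\<^sup>2 - b\<^sup>2 * p\<^sup>2 * q\<^sup>2 - c\<^sup>2 * r\<^sup>2 * p\<^sup>2)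
        + (2 * (a * d - b * c * p\<^sup>2)) * (r * q) = 0"
      by (simp add: algebra_simps power2_eq_square)
    then have "2 * (a * d - b * c * p\<^sup>2) = 0"
      by (rule irrational_cross_term[OF irr(3), rotated 2]) (intro add diff mult numeral R sq)+
    then show ?thesis by simp
  qed
  \<comment> \<open>Multiplying two of the relations and cancelling b c leaves a^2 = (d r q)^2. As r
    q is irrational, a = d = 0, and the third relation contradicts b c being nonzero.\<close>
  have bc: "b * c = 0"
  proof (rule ccontr)
    assume nz': "b * c \<noteq> 0"
    have "(b * c) * a\<^sup>2 = (a * b) * (a * c)" by (simp add: power2_eq_square)
    also have "\<dots> = (b * c) * (d * (r * q))\<^sup>2" unfolding 1 2 by (simp add: power2_eq_square)
    finally have "a\<^sup>2 = (d * (r * q))\<^sup>2" using nz' by simp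
    then have "a = 0 \<and> d = 0" using irrational_square_eq[OF irr(3)] R by blast
    then show False using 3 nz' nz by simp
  qed
  have bd: "b * d = 0"
  proof (rule ccontr)
    assume nz': "b * d \<noteq> 0"
    have "(b * d) * a\<^sup>2 = (a * b) * (a * d)" by (simp add: power2_eq_square)
    also have "\<dots> = (b * d) * (c * (r * p))\<^sup>2" unfolding 1 3 by (simp add: power2_eq_square)
    finally have "a\<^sup>2 = (c * (r * p))\<^sup>2" using nz' by simp
    then have "a = 0 \<and> c = 0" using irrational_square_eq[OF irr(2)] R by blast
    then show False using 2 nz' nz by simp
  qed
  have cd: "c * d = 0"
  proof (rule ccontr)
    assume nz': "c * d \<noteq> 0"
    have "(c * d) * a\<^sup>2 = (a * c) * (a * d)" by (simp add: power2_eq_square)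
    also have "\<dots> = (c * d) * (b * (p * q))\<^sup>2" unfolding 2 3 by (simp add: power2_eq_square)
    finally have "a\<^sup>2 = (b * (p * q))\<^sup>2" using nz' by simp
    then have "a = 0 \<and> b = 0" using irrational_square_eq[OF irr(1)] R by blast
    then show False using 1 nz' nz by simp
  qed
  \<comment> \<open>All pairwise products vanish, so at most one coefficient is nonzero, and
    \<open>eq\<close> removes that one.\<close>
  have "a * b = 0" "a * c = 0" "a * d = 0" using 1 2 3 bc bd cd by simp_all
  then show ?thesis using bc bd cd eq nz by (auto simp: mult_eq_0_iff)
qed

end

text \<open>The quartic is the difference of squares (x^2 - 2 t x - 1)^2 - (p q x)^2. Each quadratic
  factor has roots with product -1.\<close>

lemma quartic_root_factorization:
  fixes t x :: complex
  assumes p: "p\<^sup>2 = 2 * t + 1" and q: "q\<^sup>2 = 2 * t - 4" and r: "r\<^sup>2 = 2 * t"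
  shows "poly [:1, 4 * t, 6 * t + 2, - 4 * t, 1:] x =
    (x - (r + p) * (r + q) / 2) * (x - (r - p) * (r - q) / 2) *
    ((x - (r - p) * (r + q) / 2) * (x - (r + p) * (r - q) / 2))"
proof -
  have a: "(x - (r + p) * (r + q) / 2) * (x - (r - p) * (r - q) / 2) =
      x\<^sup>2 - x * (r\<^sup>2 + p * q) + (r\<^sup>2 - p\<^sup>2) * (r\<^sup>2 - q\<^sup>2) / 4"
    by (simp add: field_simps power2_eq_square)
  have b: "(x - (r - p) * (r + q) / 2) * (x - (r + p) * (r - q) / 2) =
      x\<^sup>2 - x * (r\<^sup>2 - p * q) + (r\<^sup>2 - p\<^sup>2) * (r\<^sup>2 - q\<^sup>2) / 4"
    by (simp add: field_simps power2_eq_square)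
  have K: "(r\<^sup>2 - p\<^sup>2) * (r\<^sup>2 - q\<^sup>2) / 4 = -1" unfolding p q r by simp
  have "(x\<^sup>2 - x * (2 * t + p * q) + -1) * (x\<^sup>2 - x * (2 * t - p * q) + -1) =
      (x\<^sup>2 - 2 * t * x - 1)\<^sup>2 - x\<^sup>2 * (p\<^sup>2 * q\<^sup>2)"
    by (simp add: algebra_simps power2_eq_square)
  also have "\<dots> = poly [:1, 4 * t, 6 * t + 2, - 4 * t, 1:] x"
    unfolding p q by (simp add: algebra_simps power2_eq_square)
  finally show ?thesis unfolding a b K unfolding r by simp
qed

text \<open>Sign changes of p and q permute the four roots, so signs can be chosen to turn the given
  root into the one with plus signs.\<close>

lemma quartic_root_radicals:
  fixes t \<xi> :: complex
  assumes "poly [:1, 4 * t, 6 * t + 2, - 4 * t, 1:] \<xi> = 0"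
  obtains p q r where "p\<^sup>2 = 2 * t + 1" "q\<^sup>2 = 2 * t - 4" "r\<^sup>2 = 2 * t" "\<xi> = (r + p) * (r + q) / 2"
proof -
  define p q r where "p = csqrt (2 * t + 1)" and "q = csqrt (2 * t - 4)" and "r = csqrt (2 * t)"
  have pqr: "p\<^sup>2 = 2 * t + 1" "q\<^sup>2 = 2 * t - 4" "r\<^sup>2 = 2 * t"
    unfolding p_def q_def r_def by simp_all
  have "\<xi> = (r + p) * (r + q) / 2 \<or> \<xi> = (r - p) * (r - q) / 2 \<or>
      \<xi> = (r - p) * (r + q) / 2 \<or> \<xi> = (r + p) * (r - q) / 2"
    using assms unfolding quartic_root_factorization[OF pqr] by simp
  then show thesis
    using that[of p q r] that[of "- p" "- q" r] that[of "- p" q r] that[of p "- q" r] pqr by auto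
qed

text \<open>The radicals are parameters so that everything can be reused with - p and - q, that is,
  for a conjugate root.\<close>

locale quartic_order = discrete_subring +
  fixes t p q r :: complex
  assumes t: "t \<in> R" "cmod t > 1544803"
    and pqr: "p\<^sup>2 = 2 * t + 1" "q\<^sup>2 = 2 * t - 4" "r\<^sup>2 = 2 * t"
begin

definition \<xi> :: complex where "\<xi> = (r + p) * (r + q) / 2"

lemma \<xi>_root: "poly [:1, 4 * t, 6 * t + 2, - 4 * t, 1:] \<xi> = 0"
  unfolding quartic_root_factorization[OF pqr] \<xi>_def by simp

lemma sq_in_R: "p\<^sup>2 \<in> R" "q\<^sup>2 \<in> R" "r\<^sup>2 \<in> R"
  unfolding pqr using t(1) by auto

lemma pqr_nonzero: "p \<noteq> 0" "q \<noteq> 0" "r \<noteq> 0"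
proof -
  have "2 * t + 1 \<noteq> 0"
  proof
    assume "2 * t + 1 = 0"
    then have "2 * t = - 1" by (simp only: eq_neg_iff_add_eq_0)
    then have "cmod (2 * t) = cmod (- 1)" by (rule arg_cong)
    then show False using t(2) by (simp add: norm_mult)
  qed
  moreover have "2 * t - 4 \<noteq> 0" "2 * t \<noteq> 0" using t(2) by auto
  ultimately show "p \<noteq> 0" "q \<noteq> 0" "r \<noteq> 0" using pqr by auto
qed

lemma irrationals: "irrational (p * q)" "irrational (r * p)" "irrational (r * q)"
proof -
  have n4: "cmod (4 * t) > 1000" "cmod (2 * t) > 1000" using t(2) by (simp_all add: norm_mult)
  show "irrational (p * q)"
  \<comment> \<open>Completing the square: 4 p^2 q^2 = (4 t - 3)^2 - 25. The other two radicals are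
    treated in the same way.\<close>
  proof (rule irrationalI[of _ "4 * t - 3" 2 25])
    show "(4 * t - 3 - 2 * (p * q)) * (4 * t - 3 + 2 * (p * q)) = 25"
    proof -
      have "(4 * t - 3 - 2 * (p * q)) * (4 * t - 3 + 2 * (p * q)) = (4 * t - 3)\<^sup>2 - 4 * (p\<^sup>2 * q\<^sup>2)"
        by (simp add: algebra_simps power2_eq_square)
      then show ?thesis unfolding pqr by (simp add: algebra_simps power2_eq_square)
    qed
    show "cmod (4 * t - 3) > 25" using n4 norm_triangle_ineq2[of "4 * t" 3] by simp
  qed (use t sq_in_R in \<open>auto simp: power_mult_distrib\<close>)
  show "irrational (r * p)"
  proof (rule irrationalI[of _ "4 * t + 1" 2 1])
    show "(4 * t + 1 - 2 * (r * p)) * (4 * t + 1 + 2 * (r * p)) = 1"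
    proof -
      have "(4 * t + 1 - 2 * (r * p)) * (4 * t + 1 + 2 * (r * p)) = (4 * t + 1)\<^sup>2 - 4 * (r\<^sup>2 * p\<^sup>2)"
        by (simp add: algebra_simps power2_eq_square)
      then show ?thesis unfolding pqr by (simp add: algebra_simps power2_eq_square)
    qed
    show "cmod (4 * t + 1) > 25" using n4 norm_diff_ineq[of "4 * t" 1] by simp
  qed (use t sq_in_R in \<open>auto simp: power_mult_distrib\<close>)
  show "irrational (r * q)"
  proof (rule irrationalI[of _ "2 * t - 2" 1 4])
    show "(2 * t - 2 - 1 * (r * q)) * (2 * t - 2 + 1 * (r * q)) = 4"
    proof -
      have "(2 * t - 2 - 1 * (r * q)) * (2 * t - 2 + 1 * (r * q)) = (2 * t - 2)\<^sup>2 - (r\<^sup>2 * q\<^sup>2)"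
        by (simp add: algebra_simps power2_eq_square)
      then show ?thesis unfolding pqr by (simp add: algebra_simps power2_eq_square)
    qed
    show "cmod (2 * t - 2) > 25" using n4 norm_triangle_ineq2[of "2 * t" 2] by simp
  qed (use t sq_in_R in \<open>auto simp: power_mult_distrib\<close>)
qed

lemma independent:
  assumes "a \<in> R" "b \<in> R" "c \<in> R" "d \<in> R" "a + b * (p * q) + c * (r * p) + d * (r * q) = 0"
  shows "a = 0" "b = 0" "c = 0" "d = 0"
  using biquadratic_independent[OF assms(1-4) sq_in_R pqr_nonzero irrationals assms(5)] by auto

definition \<alpha>\<^sub>2 :: complex where "\<alpha>\<^sub>2 = (6 * t + 2) * \<xi> - 4 * t * \<xi>\<^sup>2 + \<xi> ^ 3"

lemma \<xi>_coords: "2 * \<xi> = 2 * t + p * q + r * p + r * q"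
  unfolding \<xi>_def using pqr(3) by (simp add: algebra_simps power2_eq_square)

lemma \<xi>_sq_coords:
  "2 * \<xi>\<^sup>2 = 2 * (4 * t + 1) * (t - 1) + 4 * t * (p * q) + (4 * t - 4) * (r * p) + (4 * t + 1) * (r * q)"
proof -
  have "2 * (2 * \<xi>\<^sup>2) = (r\<^sup>2 + p\<^sup>2 + 2 * (r * p)) * (r\<^sup>2 + q\<^sup>2 + 2 * (r * q))"
    unfolding \<xi>_def by (simp add: field_simps power2_eq_square)
  also have "\<dots> = (r\<^sup>2 + p\<^sup>2) * (r\<^sup>2 + q\<^sup>2) + 2 * (r\<^sup>2 + p\<^sup>2) * (r * q) + 2 * (r\<^sup>2 + q\<^sup>2) * (r * p)
      + 4 * r\<^sup>2 * (p * q)"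
    by (simp add: algebra_simps power2_eq_square)
  also have "\<dots> = 2 * (2 * (4 * t + 1) * (t - 1) + 4 * t * (p * q) + (4 * t - 4) * (r * p) + (4 * t + 1) * (r * q))"
    unfolding pqr by (simp add: algebra_simps)
  finally show ?thesis by (simp only: mult_cancel_left) simp
qed

lemma \<xi>_inverse: "\<xi> * (r - p) * (r - q) = - 2"
proof -
  have "\<xi> * (r - p) * (r - q) = (r\<^sup>2 - p\<^sup>2) * (r\<^sup>2 - q\<^sup>2) / 2"
    unfolding \<xi>_def by (simp add: algebra_simps power2_eq_square)
  then show ?thesis unfolding pqr by simp
qed

text \<open>Dividing the quartic equation by \<xi> gives
  \<open>\<alpha>\<^sub>2 + 4 * t = - 1 / \<xi>\<close>, again a root.\<close>

lemma \<alpha>\<^sub>2_eq: "\<alpha>\<^sub>2 = (r - p) * (r - q) / 2 - 4 * t"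
proof -
  have nz: "\<xi> \<noteq> 0" using \<xi>_inverse by auto
  have "\<xi> * (\<alpha>\<^sub>2 + 4 * t) = -1"
    using \<xi>_root unfolding \<alpha>\<^sub>2_def
    by (simp add: algebra_simps power2_eq_square power3_eq_cube eq_neg_iff_add_eq_0)
  also have "\<dots> = \<xi> * ((r - p) * (r - q) / 2)" using \<xi>_inverse by (simp add: mult.assoc)
  finally have "\<alpha>\<^sub>2 + 4 * t = (r - p) * (r - q) / 2" using nz by simp
  then show ?thesis by (simp add: algebra_simps)
qed

lemma \<alpha>\<^sub>2_coords: "2 * \<alpha>\<^sub>2 = - 6 * t + p * q - r * p - r * q"
  unfolding \<alpha>\<^sub>2_eq using pqr(3) by (simp add: field_simps power2_eq_square)

end

section \<open>Rings generated by one element and power bases\<close>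

context discrete_subring
begin

lemma ring_adjoin_iff: "y \<in> ring_adjoin R x \<longleftrightarrow> (\<exists>p. (\<forall>i. coeff p i \<in> R) \<and> y = poly p x)"
  unfolding ring_adjoin_def by blast

lemma ring_adjoin_const: "c \<in> R \<Longrightarrow> c \<in> ring_adjoin R x"
  unfolding ring_adjoin_iff by (rule exI[of _ "[:c:]"]) (auto simp: coeff_pCons split: nat.splits)

lemma ring_adjoin_gen: "x \<in> ring_adjoin R x"
  unfolding ring_adjoin_iff by (rule exI[of _ "[:0, 1:]"]) (auto simp: coeff_pCons split: nat.splits)

lemma ring_adjoin_add:
  assumes "y \<in> ring_adjoin R x" "z \<in> ring_adjoin R x" shows "y + z \<in> ring_adjoin R x"
proof -
  obtain P Q where "\<forall>i. coeff P i \<in> R" "y = poly P x" "\<forall>i. coeff Q i \<in> R" "z = poly Q x"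
    using assms unfolding ring_adjoin_iff by blast
  then show ?thesis unfolding ring_adjoin_iff by (intro exI[of _ "P + Q"]) auto
qed

lemma ring_adjoin_mult:
  assumes "y \<in> ring_adjoin R x" "z \<in> ring_adjoin R x" shows "y * z \<in> ring_adjoin R x"
proof -
  obtain P Q where "\<forall>i. coeff P i \<in> R" "y = poly P x" "\<forall>i. coeff Q i \<in> R" "z = poly Q x"
    using assms unfolding ring_adjoin_iff by blast
  then show ?thesis unfolding ring_adjoin_iff by (intro exI[of _ "P * Q"]) (auto simp: coeff_mult)
qed

lemma ring_adjoin_power: "y \<in> ring_adjoin R x \<Longrightarrow> y ^ n \<in> ring_adjoin R x"
  by (induction n) (auto intro: ring_adjoin_mult ring_adjoin_const)

lemma ring_adjoin_subset:
  assumes y: "y \<in> ring_adjoin R x" shows "ring_adjoin R y \<subseteq> ring_adjoin R x"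
proof
  fix z assume "z \<in> ring_adjoin R y"
  then obtain P where P: "\<forall>i. coeff P i \<in> R" "z = poly P y" unfolding ring_adjoin_iff by blast
  have "(\<forall>i. coeff P i \<in> R) \<longrightarrow> poly P y \<in> ring_adjoin R x"
  proof (induction P)
    case 0
    show ?case by (auto intro: ring_adjoin_const)
  next
    case (pCons a P)
    show ?case
    proof
      assume "\<forall>i. coeff (pCons a P) i \<in> R"
      then have "a \<in> R" "\<forall>i. coeff P i \<in> R"
        by (metis coeff_pCons_0, metis coeff_pCons_Suc)
      then show "poly (pCons a P) y \<in> ring_adjoin R x"
        using pCons.IH y by (simp add: ring_adjoin_add ring_adjoin_mult ring_adjoin_const)
    qed
  qed
  then show "z \<in> ring_adjoin R x" using P by blast
qed

lemma ring_adjoin_affine: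
  assumes "e \<in> R" "h \<in> R" "e * h = 1" "a \<in> R"
  shows "ring_adjoin R (e * x + a) = ring_adjoin R x"
proof
  show "ring_adjoin R (e * x + a) \<subseteq> ring_adjoin R x"
    using assms by (intro ring_adjoin_subset ring_adjoin_add ring_adjoin_mult ring_adjoin_const ring_adjoin_gen)
  have "x = h * (e * x + a) + (- (h * a))"
    using assms(3) by (simp add: algebra_simps)
  moreover have "h * (e * x + a) + (- (h * a)) \<in> ring_adjoin R (e * x + a)"
    using assms by (intro ring_adjoin_add ring_adjoin_mult ring_adjoin_const ring_adjoin_gen uminus mult)
  ultimately show "ring_adjoin R x \<subseteq> ring_adjoin R (e * x + a)"
    by (intro ring_adjoin_subset) simp
qed

lemma ring_adjoin_quartic:
  assumes m: "m0 \<in> R" "m1 \<in> R" "m2 \<in> R" "m3 \<in> R" "x ^ 4 = m0 + m1 * x + m2 * x\<^sup>2 + m3 * x ^ 3"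
    and y: "y \<in> ring_adjoin R x"
  obtains c0 c1 c2 c3 where "c0 \<in> R" "c1 \<in> R" "c2 \<in> R" "c3 \<in> R"
    "y = c0 + c1 * x + c2 * x\<^sup>2 + c3 * x ^ 3"
proof -
  obtain P where P: "\<forall>i. coeff P i \<in> R" "y = poly P x" using y unfolding ring_adjoin_iff by blast
  have "(\<forall>i. coeff P i \<in> R) \<longrightarrow> (\<exists>c0\<in>R. \<exists>c1\<in>R. \<exists>c2\<in>R. \<exists>c3\<in>R.
      poly P x = c0 + c1 * x + c2 * x\<^sup>2 + c3 * x ^ 3)"
  proof (induction P)
    case 0
    show ?case by (auto intro!: bexI[of _ 0])
  next
    case (pCons a P)
    show ?case
    proof
      assume "\<forall>i. coeff (pCons a P) i \<in> R"
      then have aP: "a \<in> R" "\<forall>i. coeff P i \<in> R"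
        by (metis coeff_pCons_0, metis coeff_pCons_Suc)
      then obtain c0 c1 c2 c3 where c: "c0 \<in> R" "c1 \<in> R" "c2 \<in> R" "c3 \<in> R"
          "poly P x = c0 + c1 * x + c2 * x\<^sup>2 + c3 * x ^ 3" using pCons.IH by blast
      have "poly (pCons a P) x = a + c0 * x + c1 * x\<^sup>2 + c2 * x ^ 3 + c3 * x ^ 4"
        using c(5) by (simp add: algebra_simps power2_eq_square power3_eq_cube power4_eq_xxxx)
      also have "\<dots> = (a + c3 * m0) + (c0 + c3 * m1) * x + (c1 + c3 * m2) * x\<^sup>2 + (c2 + c3 * m3) * x ^ 3"
        unfolding m(5) by (simp add: algebra_simps)
      finally show "\<exists>c0\<in>R. \<exists>c1\<in>R. \<exists>c2\<in>R. \<exists>c3\<in>R.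
          poly (pCons a P) x = c0 + c1 * x + c2 * x\<^sup>2 + c3 * x ^ 3"
        using aP(1) c(1-4) m(1-4) by blast
    qed
  qed
  then show thesis using that P by blast
qed

lemma is_module_basis_4I:
  assumes mem: "\<And>i. i < 4 \<Longrightarrow> x ^ i \<in> A"
    and span: "\<And>y. y \<in> A \<Longrightarrow> \<exists>c0\<in>R. \<exists>c1\<in>R. \<exists>c2\<in>R. \<exists>c3\<in>R. y = c0 + c1 * x + c2 * x\<^sup>2 + c3 * x ^ 3"
    and indep: "\<And>c0 c1 c2 c3. c0 \<in> R \<Longrightarrow> c1 \<in> R \<Longrightarrow> c2 \<in> R \<Longrightarrow> c3 \<in> R \<Longrightarrow>
      c0 + c1 * x + c2 * x\<^sup>2 + c3 * x ^ 3 = 0 \<Longrightarrow> c0 = 0 \<and> c1 = 0 \<and> c2 = 0 \<and> c3 = 0"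
  shows "is_module_basis R A 4 (\<lambda>i. x ^ i)"
  unfolding is_module_basis_def
proof (intro conjI allI impI ballI)
  have sum4: "(\<Sum>i<4. c i * x ^ i) = c 0 + c 1 * x + c 2 * x\<^sup>2 + c 3 * x ^ 3" for c :: "nat \<Rightarrow> complex"
    by (simp add: eval_nat_numeral)
  have four: "i < 4 \<longleftrightarrow> i = 0 \<or> i = 1 \<or> i = 2 \<or> i = 3" for i :: nat by auto
  show "x ^ i \<in> A" if "i < 4" for i by (rule mem[OF that])
  fix y assume y: "y \<in> A"
  obtain c0 c1 c2 c3 where c: "c0 \<in> R" "c1 \<in> R" "c2 \<in> R" "c3 \<in> R"
    "y = c0 + c1 * x + c2 * x\<^sup>2 + c3 * x ^ 3" using span[OF y] by blast
  define c where "c = (\<lambda>i\<in>{..<4::nat}. if i = 0 then c0 else if i = 1 then c1 else if i = 2 then c2 else c3)"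
  have c': "c \<in> {..<4} \<rightarrow>\<^sub>E R" unfolding c_def using c by auto
  have yc: "y = (\<Sum>i<4. c i * x ^ i)" unfolding sum4 c(5) by (simp add: c_def)
  show "\<exists>!c. c \<in> {..<4} \<rightarrow>\<^sub>E R \<and> y = (\<Sum>i<4. c i * x ^ i)"
  proof (rule ex1I[of _ c])
    show "c \<in> {..<4} \<rightarrow>\<^sub>E R \<and> y = (\<Sum>i<4. c i * x ^ i)" using c' yc by blast
    fix d assume d: "d \<in> {..<4} \<rightarrow>\<^sub>E R \<and> y = (\<Sum>i<4. d i * x ^ i)"
    have dR: "d i - c i \<in> R" if "i < 4" for i
      using d c' that by (intro diff) (auto simp: PiE_iff)
    have "(d 0 - c 0) + (d 1 - c 1) * x + (d 2 - c 2) * x\<^sup>2 + (d 3 - c 3) * x ^ 3 = 0"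
      using d yc unfolding sum4 by (simp add: algebra_simps)
    then have "d 0 - c 0 = 0 \<and> d 1 - c 1 = 0 \<and> d 2 - c 2 = 0 \<and> d 3 - c 3 = 0"
      by (intro indep dR) auto
    then have "d i = c i" if "i \<in> {..<4}" for i using that unfolding lessThan_iff four by auto
    then show "d = c" by (rule PiE_ext[OF conjunct1[OF d] c'])
  qed
qed

end

context quartic_order
begin

text \<open>The basis with \<open>\<alpha>\<^sub>2\<close> in place of the cube of \<xi> is
  preferred because the coordinates of \<open>2 * \<alpha>\<^sub>2\<close> on p q, r p, r q are just
  1, -1, -1.\<close>

lemma \<alpha>\<^sub>2_independent:
  assumes R: "a \<in> R" "x \<in> R" "y \<in> R" "z \<in> R" and eq: "a + x * \<xi> + y * \<xi>\<^sup>2 + z * \<alpha>\<^sub>2 = 0"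
  shows "a = 0 \<and> x = 0 \<and> y = 0 \<and> z = 0"
proof -
  have "0 = 2 * (a + x * \<xi> + y * \<xi>\<^sup>2 + z * \<alpha>\<^sub>2)" using eq by simp
  also have "\<dots> = 2 * a + x * (2 * \<xi>) + y * (2 * \<xi>\<^sup>2) + z * (2 * \<alpha>\<^sub>2)" by (simp add: algebra_simps)
  also have "\<dots> = (2 * a + 2 * t * x + 2 * (4 * t + 1) * (t - 1) * y - 6 * t * z)
      + (x + 4 * t * y + z) * (p * q) + (x + (4 * t - 4) * y - z) * (r * p)
      + (x + (4 * t + 1) * y - z) * (r * q)"
    unfolding \<xi>_coords \<xi>_sq_coords \<alpha>\<^sub>2_coords by (simp add: algebra_simps)
  finally have eq': "(2 * a + 2 * t * x + 2 * (4 * t + 1) * (t - 1) * y - 6 * t * z)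
      + (x + 4 * t * y + z) * (p * q) + (x + (4 * t - 4) * y - z) * (r * p)
      + (x + (4 * t + 1) * y - z) * (r * q) = 0" by simp
  have "2 * a + 2 * t * x + 2 * (4 * t + 1) * (t - 1) * y - 6 * t * z = 0" "x + 4 * t * y + z = 0"
    "x + (4 * t - 4) * y - z = 0" "x + (4 * t + 1) * y - z = 0"
    by (rule independent[OF _ _ _ _ eq']; intro add diff mult numeral one t R)+
  note e = this
  have "5 * y = (x + (4 * t + 1) * y - z) - (x + (4 * t - 4) * y - z)" by (simp add: algebra_simps)
  then have y: "y = 0" using e by simp
  then have "2 * x = (x + 4 * t * y + z) + (x + (4 * t + 1) * y - z)" by simp
  then have x: "x = 0" using e by simp
  then show ?thesis using e y by simp
qed

lemma powers_independent:
  assumes R: "c0 \<in> R" "c1 \<in> R" "c2 \<in> R" "c3 \<in> R" and eq: "c0 + c1 * \<xi> + c2 * \<xi>\<^sup>2 + c3 * \<xi> ^ 3 = 0"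
  shows "c0 = 0 \<and> c1 = 0 \<and> c2 = 0 \<and> c3 = 0"
proof -
  have "c0 + (c1 - (6 * t + 2) * c3) * \<xi> + (c2 + 4 * t * c3) * \<xi>\<^sup>2 + c3 * \<alpha>\<^sub>2 = 0"
    using eq unfolding \<alpha>\<^sub>2_def by (simp add: algebra_simps)
  then have "c0 = 0 \<and> c1 - (6 * t + 2) * c3 = 0 \<and> c2 + 4 * t * c3 = 0 \<and> c3 = 0"
    by (rule \<alpha>\<^sub>2_independent[rotated 4]) (intro R add diff mult numeral t)+
  then show ?thesis by auto
qed

lemma \<xi>_power4: "\<xi> ^ 4 = -1 + (- 4 * t) * \<xi> + (- (6 * t + 2)) * \<xi>\<^sup>2 + (4 * t) * \<xi> ^ 3"
proof -
  have "\<xi> ^ 4 + 1 + 4 * t * \<xi> + (6 * t + 2) * \<xi>\<^sup>2 - 4 * t * \<xi> ^ 3 = 0"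
    using \<xi>_root by (simp add: algebra_simps power2_eq_square power3_eq_cube power4_eq_xxxx)
  then show ?thesis by (simp add: algebra_simps eq_neg_iff_add_eq_0)
qed

lemma order_span:
  assumes "y \<in> ring_adjoin R \<xi>"
  obtains c0 c1 c2 c3 where "c0 \<in> R" "c1 \<in> R" "c2 \<in> R" "c3 \<in> R"
    "y = c0 + c1 * \<xi> + c2 * \<xi>\<^sup>2 + c3 * \<xi> ^ 3"
proof (rule ring_adjoin_quartic[OF _ _ _ _ \<xi>_power4 assms])
  show "-1 \<in> R" by (intro uminus one)
  show "- 4 * t \<in> R" using t(1) by auto
  show "- (6 * t + 2) \<in> R" using t(1) by auto
  show "4 * t \<in> R" using t(1) by auto
qed (use that in blast)

lemma generates_affine:
  assumes e: "e \<in> R" "h \<in> R" "e * h = 1" and a: "a \<in> R"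
  shows "generates_relative_power_basis R (ring_adjoin R \<xi>) (e * \<xi> + a)"
  unfolding generates_relative_power_basis_def
proof (intro conjI)
  let ?x = "e * \<xi> + a"
  have adj: "ring_adjoin R ?x = ring_adjoin R \<xi>" using ring_adjoin_affine[OF e a] .
  show mem: "?x \<in> ring_adjoin R \<xi>" using ring_adjoin_gen[of ?x] adj by simp
  show "ring_adjoin R \<xi> = ring_adjoin R ?x" using adj by simp
  show "is_module_basis R (ring_adjoin R \<xi>) 4 (\<lambda>i. ?x ^ i)"
  proof (rule is_module_basis_4I)
    show "?x ^ i \<in> ring_adjoin R \<xi>" for i by (rule ring_adjoin_power[OF mem])
  next
    fix y assume "y \<in> ring_adjoin R \<xi>"
    then obtain c0 c1 c2 c3 where c: "c0 \<in> R" "c1 \<in> R" "c2 \<in> R" "c3 \<in> R"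
      "y = c0 + c1 * \<xi> + c2 * \<xi>\<^sup>2 + c3 * \<xi> ^ 3" by (rule order_span)
    define b where "b = - (h * a)"
    have b: "b \<in> R" unfolding b_def by (intro uminus mult e a)
    have x: "\<xi> = h * ?x + b" unfolding b_def using e(3)
      by (simp add: algebra_simps)
    have "c0 + c1 * (h * w + b) + c2 * (h * w + b)\<^sup>2 + c3 * (h * w + b) ^ 3 =
        (c0 + c1 * b + c2 * b\<^sup>2 + c3 * b ^ 3) + (c1 + 2 * c2 * b + 3 * c3 * b\<^sup>2) * h * w
        + (c2 + 3 * c3 * b) * h\<^sup>2 * w\<^sup>2 + c3 * h ^ 3 * w ^ 3" for w
      by (simp add: algebra_simps power2_eq_square power3_eq_cube)
    from this[of ?x] have "y = (c0 + c1 * b + c2 * b\<^sup>2 + c3 * b ^ 3)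
        + (c1 + 2 * c2 * b + 3 * c3 * b\<^sup>2) * h * ?x
        + (c2 + 3 * c3 * b) * h\<^sup>2 * ?x\<^sup>2 + c3 * h ^ 3 * ?x ^ 3"
      unfolding c(5) x[symmetric] .
    moreover have "c0 + c1 * b + c2 * b\<^sup>2 + c3 * b ^ 3 \<in> R" "(c1 + 2 * c2 * b + 3 * c3 * b\<^sup>2) * h \<in> R"
      "(c2 + 3 * c3 * b) * h\<^sup>2 \<in> R" "c3 * h ^ 3 \<in> R"
      by (intro add mult power numeral b e c)+
    ultimately show "\<exists>c0\<in>R. \<exists>c1\<in>R. \<exists>c2\<in>R. \<exists>c3\<in>R. y = c0 + c1 * ?x + c2 * ?x\<^sup>2 + c3 * ?x ^ 3"
      by blast
  next
    fix c0 c1 c2 c3 assume c: "c0 \<in> R" "c1 \<in> R" "c2 \<in> R" "c3 \<in> R"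
      and eq: "c0 + c1 * ?x + c2 * ?x\<^sup>2 + c3 * ?x ^ 3 = 0"
    have e0: "e \<noteq> 0" using e(3) by auto
    \<comment> \<open>Expansion in \<xi> is triangular with diagonal 1, e, e^2, e^3, which are
      units.\<close>
    have "(c0 + c1 * a + c2 * a\<^sup>2 + c3 * a ^ 3) + (c1 + 2 * c2 * a + 3 * c3 * a\<^sup>2) * e * \<xi>
        + (c2 + 3 * c3 * a) * e\<^sup>2 * \<xi>\<^sup>2 + c3 * e ^ 3 * \<xi> ^ 3 = 0"
      using eq by (simp add: algebra_simps power2_eq_square power3_eq_cube)
    then have "c0 + c1 * a + c2 * a\<^sup>2 + c3 * a ^ 3 = 0 \<and> (c1 + 2 * c2 * a + 3 * c3 * a\<^sup>2) * e = 0
        \<and> (c2 + 3 * c3 * a) * e\<^sup>2 = 0 \<and> c3 * e ^ 3 = 0"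
      by (rule powers_independent[rotated 4]) (intro add mult power numeral a e c)+
    then show "c0 = 0 \<and> c1 = 0 \<and> c2 = 0 \<and> c3 = 0" using e0 by auto
  qed
qed

text \<open>The four roots are permuted by the sign changes of \<open>p, q, r\<close>; this one sends \<open>\<xi>\<close> to \<open>- 1 / \<xi>\<close>.\<close>

lemma conjugate: "quartic_order R t (- p) (- q) r"
  by (intro quartic_order.intro discrete_subring_axioms quartic_order_axioms.intro) (simp_all add: t pqr)

text \<open>- 1 / \<xi> is a polynomial in \<xi>, and since the conjugation is an involution, \<xi>
  is the same polynomial in - 1 / \<xi>.\<close>

lemma ring_adjoin_conjugate: "ring_adjoin R (quartic_order.\<xi> (- p) (- q) r) = ring_adjoin R \<xi>"
proof -
  have \<alpha>: "\<alpha>\<^sub>2 + 4 * t \<in> ring_adjoin R \<xi>"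
  proof -
    have "\<alpha>\<^sub>2 + 4 * t = (6 * t + 2) * \<xi> + (- 4 * t) * \<xi>\<^sup>2 + \<xi> ^ 3 + 4 * t" unfolding \<alpha>\<^sub>2_def by simp
    moreover have "(6 * t + 2) * \<xi> + (- 4 * t) * \<xi>\<^sup>2 + \<xi> ^ 3 + 4 * t \<in> ring_adjoin R \<xi>"
      by (intro ring_adjoin_add ring_adjoin_mult ring_adjoin_power ring_adjoin_gen ring_adjoin_const
          add mult uminus numeral t)
    ultimately show ?thesis by simp
  qed
  interpret c: quartic_order R t "- p" "- q" r by (rule conjugate)
  have c\<xi>: "c.\<xi> = \<alpha>\<^sub>2 + 4 * t" unfolding c.\<xi>_def \<alpha>\<^sub>2_eq by simp
  have "c.\<alpha>\<^sub>2 + 4 * t = \<xi>" unfolding \<xi>_def c.\<alpha>\<^sub>2_eq by simp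
  moreover have "c.\<alpha>\<^sub>2 + 4 * t \<in> ring_adjoin R c.\<xi>"
  proof -
    have "c.\<alpha>\<^sub>2 + 4 * t = (6 * t + 2) * c.\<xi> + (- 4 * t) * c.\<xi>\<^sup>2 + c.\<xi> ^ 3 + 4 * t" unfolding c.\<alpha>\<^sub>2_def by simp
    moreover have "(6 * t + 2) * c.\<xi> + (- 4 * t) * c.\<xi>\<^sup>2 + c.\<xi> ^ 3 + 4 * t \<in> ring_adjoin R c.\<xi>"
      by (intro ring_adjoin_add ring_adjoin_mult ring_adjoin_power ring_adjoin_gen ring_adjoin_const
          add mult uminus numeral t)
    ultimately show ?thesis by simp
  qed
  ultimately show ?thesis using \<alpha> ring_adjoin_subset unfolding c\<xi>[symmetric] by (metis subset_antisym)
qed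

text \<open>\<open>\<alpha>\<^sub>2\<close> is a translate of the conjugate root, which generates
  the same order, so \<open>generates_affine\<close> in the conjugate instance settles the second
  class.\<close>

lemma equivalent_imp_generates:
  assumes "equivalent_over R \<xi> \<alpha> \<or> equivalent_over R \<alpha>\<^sub>2 \<alpha>"
  shows "generates_relative_power_basis R (ring_adjoin R \<xi>) \<alpha>"
  using assms
proof
  assume "equivalent_over R \<xi> \<alpha>"
  then show ?thesis unfolding equivalent_over_def using generates_affine by blast
next
  assume "equivalent_over R \<alpha>\<^sub>2 \<alpha>"
  then obtain e h a where e: "e \<in> R" "h \<in> R" "e * h = 1" "a \<in> R" "\<alpha> = e * \<alpha>\<^sub>2 + a"
    unfolding equivalent_over_def by blast
  interpret c: quartic_order R t "- p" "- q" r by (rule conjugate)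
  have "c.\<xi> = \<alpha>\<^sub>2 + 4 * t" unfolding c.\<xi>_def \<alpha>\<^sub>2_eq by simp
  then have \<alpha>: "\<alpha> = e * c.\<xi> + (a - 4 * t * e)" unfolding e(5) by (simp add: algebra_simps)
  show ?thesis unfolding \<alpha> ring_adjoin_conjugate[symmetric]
    by (rule c.generates_affine[OF e(1-3)]) (intro diff mult numeral t e)
qed

lemma not_equivalent: "\<not> equivalent_over R \<xi> \<alpha>\<^sub>2"
proof
  assume "equivalent_over R \<xi> \<alpha>\<^sub>2"
  then obtain e a where e: "e \<in> R" "a \<in> R" "\<alpha>\<^sub>2 = e * \<xi> + a" unfolding equivalent_over_def by blast
  then have "- a + (- e) * \<xi> + 0 * \<xi>\<^sup>2 + 1 * \<alpha>\<^sub>2 = 0" by simp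
  then have "(1::complex) = 0" using \<alpha>\<^sub>2_independent[of "- a" "- e" 0 1] e uminus by blast
  then show False by simp
qed

end

section \<open>The index form\<close>

definition det3 :: "complex \<Rightarrow> complex \<Rightarrow> complex \<Rightarrow> complex \<Rightarrow> complex \<Rightarrow> complex \<Rightarrow>
    complex \<Rightarrow> complex \<Rightarrow> complex \<Rightarrow> complex" where
  "det3 a b c d e f g h i = a * (e * i - f * h) - b * (d * i - f * g) + c * (d * h - e * g)"

lemma det3_mult:
  "det3 (a1 * x1 + b1 * y1 + c1 * z1) (a1 * x2 + b1 * y2 + c1 * z2) (a1 * x3 + b1 * y3 + c1 * z3)
     (a2 * x1 + b2 * y1 + c2 * z1) (a2 * x2 + b2 * y2 + c2 * z2) (a2 * x3 + b2 * y3 + c2 * z3)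
     (a3 * x1 + b3 * y1 + c3 * z1) (a3 * x2 + b3 * y2 + c3 * z2) (a3 * x3 + b3 * y3 + c3 * z3)
   = det3 a1 b1 c1 a2 b2 c2 a3 b3 c3 * det3 x1 x2 x3 y1 y2 y3 z1 z2 z3"
  unfolding det3_def by (simp add: algebra_simps)

text \<open>
  The coordinates of \<open>\<beta>, \<beta>\<^sup>2\<close> and \<open>\<beta>\<^sup>3 - \<kappa> \<beta>\<close> for \<open>\<beta> = (U \<surd>(a b) + Z \<surd>(a c) + V \<surd>(b c)) / 2\<close>
  have a determinant that splits into three quadratic forms.
\<close>

lemma det3_biquadratic:
  "det3 U Z V (Z * V * c) (U * V * b) (U * Z * a)
     (U * c * (V\<^sup>2 * b + Z\<^sup>2 * a)) (Z * b * (V\<^sup>2 * c + U\<^sup>2 * a)) (V * a * (Z\<^sup>2 * c + U\<^sup>2 * b))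
   = (Z\<^sup>2 * a - V\<^sup>2 * b) * (Z\<^sup>2 * c - U\<^sup>2 * b) * (U\<^sup>2 * a - V\<^sup>2 * c)"
  unfolding det3_def by (simp add: algebra_simps power2_eq_square)

context quartic_order
begin

lemma \<beta>_powers:
  fixes U Z V :: complex
  defines "\<beta> \<equiv> (U * (p * q) + Z * (r * p) + V * (r * q)) / 2"
    and "\<kappa> \<equiv> (U\<^sup>2 * p\<^sup>2 * q\<^sup>2 + Z\<^sup>2 * r\<^sup>2 * p\<^sup>2 + V\<^sup>2 * r\<^sup>2 * q\<^sup>2) / 4"
  shows "2 * \<beta>\<^sup>2 = 2 * \<kappa> + (Z * V * r\<^sup>2) * (p * q) + (U * V * q\<^sup>2) * (r * p) + (U * Z * p\<^sup>2) * (r * q)"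
    and "4 * \<beta> ^ 3 = 4 * \<kappa> * \<beta> + 3 * U * Z * V * p\<^sup>2 * q\<^sup>2 * r\<^sup>2
      + U * r\<^sup>2 * (V\<^sup>2 * q\<^sup>2 + Z\<^sup>2 * p\<^sup>2) * (p * q) + Z * q\<^sup>2 * (V\<^sup>2 * r\<^sup>2 + U\<^sup>2 * p\<^sup>2) * (r * p)
      + V * p\<^sup>2 * (Z\<^sup>2 * r\<^sup>2 + U\<^sup>2 * q\<^sup>2) * (r * q)"
proof -
  show 1: "2 * \<beta>\<^sup>2 = 2 * \<kappa> + (Z * V * r\<^sup>2) * (p * q) + (U * V * q\<^sup>2) * (r * p) + (U * Z * p\<^sup>2) * (r * q)"
    unfolding \<beta>_def \<kappa>_def by (simp add: field_simps power2_eq_square)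
  have 2: "2 * \<beta> = U * (p * q) + Z * (r * p) + V * (r * q)" unfolding \<beta>_def by simp
  have "4 * \<beta> ^ 3 = (2 * \<beta>\<^sup>2) * (2 * \<beta>)" by (simp add: power2_eq_square power3_eq_cube)
  also have "\<dots> = 2 * \<kappa> * (2 * \<beta>) + ((Z * V * r\<^sup>2) * (p * q) + (U * V * q\<^sup>2) * (r * p)
      + (U * Z * p\<^sup>2) * (r * q)) * (U * (p * q) + Z * (r * p) + V * (r * q))"
    unfolding 1 by (simp only: 2[symmetric]) (simp add: algebra_simps)
  also have "\<dots> = 4 * \<kappa> * \<beta> + 3 * U * Z * V * p\<^sup>2 * q\<^sup>2 * r\<^sup>2
      + U * r\<^sup>2 * (V\<^sup>2 * q\<^sup>2 + Z\<^sup>2 * p\<^sup>2) * (p * q) + Z * q\<^sup>2 * (V\<^sup>2 * r\<^sup>2 + U\<^sup>2 * p\<^sup>2) * (r * p)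
      + V * p\<^sup>2 * (Z\<^sup>2 * r\<^sup>2 + U\<^sup>2 * q\<^sup>2) * (r * q)"
    by (simp add: algebra_simps power2_eq_square)
  finally show "4 * \<beta> ^ 3 = 4 * \<kappa> * \<beta> + 3 * U * Z * V * p\<^sup>2 * q\<^sup>2 * r\<^sup>2
      + U * r\<^sup>2 * (V\<^sup>2 * q\<^sup>2 + Z\<^sup>2 * p\<^sup>2) * (p * q) + Z * q\<^sup>2 * (V\<^sup>2 * r\<^sup>2 + U\<^sup>2 * p\<^sup>2) * (r * p)
      + V * p\<^sup>2 * (Z\<^sup>2 * r\<^sup>2 + U\<^sup>2 * q\<^sup>2) * (r * q)" .
qed

text \<open>Coordinates of a combination of powers of \<beta> are a row times the matrix of
  \<open>det3_biquadratic\<close>. Subtracting \<kappa> \<beta> from the cube shifts e1 to e1 +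
  \<kappa> e3, a column operation that leaves determinants unchanged.\<close>

lemma \<beta>_combination_coords:
  fixes U Z V :: complex
  defines "\<beta> \<equiv> (U * (p * q) + Z * (r * p) + V * (r * q)) / 2"
    and "\<kappa> \<equiv> (U\<^sup>2 * p\<^sup>2 * q\<^sup>2 + Z\<^sup>2 * r\<^sup>2 * p\<^sup>2 + V\<^sup>2 * r\<^sup>2 * q\<^sup>2) / 4"
  assumes R: "U \<in> R" "Z \<in> R" "V \<in> R" "e0 \<in> R" "e1 \<in> R" "e2 \<in> R" "e3 \<in> R"
      "w0 \<in> R" "w1 \<in> R" "w2 \<in> R" "w3 \<in> R"
    and w: "2 * w = w0 + w1 * (p * q) + w2 * (r * p) + w3 * (r * q)"
    and e: "w = e0 + e1 * \<beta> + e2 * \<beta>\<^sup>2 + e3 * \<beta> ^ 3"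
  shows "w1 = (e1 + \<kappa> * e3) * U + e2 * (Z * V * r\<^sup>2) + e3 / 2 * (U * r\<^sup>2 * (V\<^sup>2 * q\<^sup>2 + Z\<^sup>2 * p\<^sup>2))"
    and "w2 = (e1 + \<kappa> * e3) * Z + e2 * (U * V * q\<^sup>2) + e3 / 2 * (Z * q\<^sup>2 * (V\<^sup>2 * r\<^sup>2 + U\<^sup>2 * p\<^sup>2))"
    and "w3 = (e1 + \<kappa> * e3) * V + e2 * (U * Z * p\<^sup>2) + e3 / 2 * (V * p\<^sup>2 * (Z\<^sup>2 * r\<^sup>2 + U\<^sup>2 * q\<^sup>2))"
proof -
  define k where "k = U\<^sup>2 * p\<^sup>2 * q\<^sup>2 + Z\<^sup>2 * r\<^sup>2 * p\<^sup>2 + V\<^sup>2 * r\<^sup>2 * q\<^sup>2"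
  define A where "A = U * r\<^sup>2 * (V\<^sup>2 * q\<^sup>2 + Z\<^sup>2 * p\<^sup>2)"
  define B where "B = Z * q\<^sup>2 * (V\<^sup>2 * r\<^sup>2 + U\<^sup>2 * p\<^sup>2)"
  define C where "C = V * p\<^sup>2 * (Z\<^sup>2 * r\<^sup>2 + U\<^sup>2 * q\<^sup>2)"
  define E where "E = U * Z * V * p\<^sup>2 * q\<^sup>2 * r\<^sup>2"
  have sqR: "U\<^sup>2 \<in> R" "Z\<^sup>2 \<in> R" "V\<^sup>2 \<in> R" using R by auto
  have kR: "k \<in> R" "A \<in> R" "B \<in> R" "C \<in> R" "E \<in> R"
    unfolding k_def A_def B_def C_def E_def by (intro add mult R sq_in_R sqR)+
  have \<kappa>: "4 * \<kappa> = k" unfolding \<kappa>_def k_def by simp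
  have b1: "2 * \<beta> = U * (p * q) + Z * (r * p) + V * (r * q)" unfolding \<beta>_def by simp
  have b2: "2 * \<beta>\<^sup>2 = 2 * \<kappa> + (Z * V * r\<^sup>2) * (p * q) + (U * V * q\<^sup>2) * (r * p) + (U * Z * p\<^sup>2) * (r * q)"
    unfolding \<beta>_def \<kappa>_def by (rule \<beta>_powers(1))
  have b3: "4 * \<beta> ^ 3 = 4 * \<kappa> * \<beta> + 3 * E + A * (p * q) + B * (r * p) + C * (r * q)"
    using \<beta>_powers(2)[of U Z V] unfolding \<beta>_def[symmetric] \<kappa>_def[symmetric] A_def B_def C_def E_def
    by (simp add: mult_ac)
  have b4: "8 * \<beta> ^ 3 = k * (2 * \<beta>) + 6 * E + 2 * A * (p * q) + 2 * B * (r * p) + 2 * C * (r * q)"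
    using arg_cong[OF b3, of "\<lambda>x. 2 * x"] unfolding \<kappa>[symmetric] by (simp add: algebra_simps)
  have b2': "8 * \<beta>\<^sup>2 = 2 * k + 4 * (Z * V * r\<^sup>2) * (p * q) + 4 * (U * V * q\<^sup>2) * (r * p) + 4 * (U * Z * p\<^sup>2) * (r * q)"
    using arg_cong[OF b2, of "\<lambda>x. 4 * x"] unfolding \<kappa>[symmetric] by (simp add: algebra_simps)
  \<comment> \<open>\<beta> and \<kappa> have denominators 2 and 4; the factor 8 puts every
    coefficient into \<open>R\<close>, as \<open>independent\<close> requires.\<close>
  have "4 * (2 * w) = 8 * e0 + 4 * e1 * (2 * \<beta>) + e2 * (8 * \<beta>\<^sup>2) + e3 * (8 * \<beta> ^ 3)"
    unfolding e by (simp add: algebra_simps)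
  then have "(4 * w0 - 8 * e0 - 2 * e2 * k - 6 * e3 * E)
      + (4 * w1 - 4 * e1 * U - 4 * e2 * (Z * V * r\<^sup>2) - e3 * (k * U + 2 * A)) * (p * q)
      + (4 * w2 - 4 * e1 * Z - 4 * e2 * (U * V * q\<^sup>2) - e3 * (k * Z + 2 * B)) * (r * p)
      + (4 * w3 - 4 * e1 * V - 4 * e2 * (U * Z * p\<^sup>2) - e3 * (k * V + 2 * C)) * (r * q) = 0"
    unfolding w b2' b4 b1 by (simp add: algebra_simps)
  note eq = this
  have "4 * w1 - 4 * e1 * U - 4 * e2 * (Z * V * r\<^sup>2) - e3 * (k * U + 2 * A) = 0"
    "4 * w2 - 4 * e1 * Z - 4 * e2 * (U * V * q\<^sup>2) - e3 * (k * Z + 2 * B) = 0"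
    "4 * w3 - 4 * e1 * V - 4 * e2 * (U * Z * p\<^sup>2) - e3 * (k * V + 2 * C) = 0"
    by (rule independent[OF _ _ _ _ eq]; intro add diff mult numeral R kR sq_in_R)+
  then have "4 * w1 = 4 * ((e1 + \<kappa> * e3) * U + e2 * (Z * V * r\<^sup>2) + e3 / 2 * A)"
    "4 * w2 = 4 * ((e1 + \<kappa> * e3) * Z + e2 * (U * V * q\<^sup>2) + e3 / 2 * B)"
    "4 * w3 = 4 * ((e1 + \<kappa> * e3) * V + e2 * (U * Z * p\<^sup>2) + e3 / 2 * C)"
    unfolding \<kappa>[symmetric] by (simp_all add: algebra_simps)
  then show "w1 = (e1 + \<kappa> * e3) * U + e2 * (Z * V * r\<^sup>2) + e3 / 2 * (U * r\<^sup>2 * (V\<^sup>2 * q\<^sup>2 + Z\<^sup>2 * p\<^sup>2))"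
    "w2 = (e1 + \<kappa> * e3) * Z + e2 * (U * V * q\<^sup>2) + e3 / 2 * (Z * q\<^sup>2 * (V\<^sup>2 * r\<^sup>2 + U\<^sup>2 * p\<^sup>2))"
    "w3 = (e1 + \<kappa> * e3) * V + e2 * (U * Z * p\<^sup>2) + e3 / 2 * (V * p\<^sup>2 * (Z\<^sup>2 * r\<^sup>2 + U\<^sup>2 * q\<^sup>2))"
    unfolding A_def B_def C_def by (simp_all only: mult_cancel_left) simp_all
qed

lemma module_basis_span_shift:
  assumes basis: "is_module_basis R A 4 (\<lambda>i. \<alpha> ^ i)" and y: "y \<in> A"
    and \<alpha>: "\<alpha> = a + \<beta>" "a \<in> R"
  shows "\<exists>e0\<in>R. \<exists>e1\<in>R. \<exists>e2\<in>R. \<exists>e3\<in>R. y = e0 + e1 * \<beta> + e2 * \<beta>\<^sup>2 + e3 * \<beta> ^ 3"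
proof -
  obtain c where c: "c \<in> {..<4} \<rightarrow>\<^sub>E R" "y = (\<Sum>i<4. c i * \<alpha> ^ i)"
    using basis y unfolding is_module_basis_def by blast
  have cR: "c 0 \<in> R" "c 1 \<in> R" "c 2 \<in> R" "c 3 \<in> R" using c(1) by (auto simp: PiE_iff)
  have "y = c 0 + c 1 * \<alpha> + c 2 * \<alpha>\<^sup>2 + c 3 * \<alpha> ^ 3"
    unfolding c(2) by (simp add: eval_nat_numeral)
  also have "\<dots> = (c 0 + c 1 * a + c 2 * a\<^sup>2 + c 3 * a ^ 3) + (c 1 + 2 * c 2 * a + 3 * c 3 * a\<^sup>2) * \<beta>
      + (c 2 + 3 * c 3 * a) * \<beta>\<^sup>2 + c 3 * \<beta> ^ 3"
    unfolding \<alpha>(1) by (simp add: algebra_simps power2_eq_square power3_eq_cube)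
  finally have "y = (c 0 + c 1 * a + c 2 * a\<^sup>2 + c 3 * a ^ 3) + (c 1 + 2 * c 2 * a + 3 * c 3 * a\<^sup>2) * \<beta>
      + (c 2 + 3 * c 3 * a) * \<beta>\<^sup>2 + c 3 * \<beta> ^ 3" .
  moreover have "c 0 + c 1 * a + c 2 * a\<^sup>2 + c 3 * a ^ 3 \<in> R" "c 1 + 2 * c 2 * a + 3 * c 3 * a\<^sup>2 \<in> R"
    "c 2 + 3 * c 3 * a \<in> R"
    by (intro add mult power numeral cR \<alpha>(2))+
  ultimately show ?thesis using cR(4) by blast
qed

lemma \<xi>_in_order: "\<xi> \<in> ring_adjoin R \<xi>" "\<xi>\<^sup>2 \<in> ring_adjoin R \<xi>" "\<alpha>\<^sub>2 \<in> ring_adjoin R \<xi>"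
proof -
  show "\<xi> \<in> ring_adjoin R \<xi>" "\<xi>\<^sup>2 \<in> ring_adjoin R \<xi>" by (intro ring_adjoin_power ring_adjoin_gen)+
  have "(6 * t + 2) * \<xi> + (- 4 * t) * \<xi>\<^sup>2 + \<xi> ^ 3 \<in> ring_adjoin R \<xi>"
    by (intro ring_adjoin_add ring_adjoin_mult ring_adjoin_power ring_adjoin_gen ring_adjoin_const
        add mult uminus numeral t)
  then show "\<alpha>\<^sub>2 \<in> ring_adjoin R \<xi>" unfolding \<alpha>\<^sub>2_def by simp
qed

text \<open>
  The three quadratic forms are the products of two differences of conjugates of \<open>\<alpha>\<close>, divided by
  those of \<open>\<xi>\<close>; their product is the relative index of \<open>\<alpha>\<close>.
\<close>

lemma generator_index_forms:
  assumes R: "a \<in> R" "x \<in> R" "y \<in> R" "z \<in> R" and \<alpha>: "\<alpha> = a + x * \<xi> + y * \<xi>\<^sup>2 + z * \<alpha>\<^sub>2"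
    and U: "U = x + 4 * t * y + z" and Z: "Z = x + (4 * t - 4) * y - z" and V: "V = x + (4 * t + 1) * y - z"
    and gen: "generates_relative_power_basis R (ring_adjoin R \<xi>) \<alpha>"
  obtains \<delta> where "\<delta> \<in> R" "\<delta> * ((Z\<^sup>2 * p\<^sup>2 - V\<^sup>2 * q\<^sup>2) / 5) * ((Z\<^sup>2 * r\<^sup>2 - U\<^sup>2 * q\<^sup>2) / 4) *
    (U\<^sup>2 * p\<^sup>2 - V\<^sup>2 * r\<^sup>2) = 1"
proof -
  define \<beta> where "\<beta> = (U * (p * q) + Z * (r * p) + V * (r * q)) / 2"
  define \<kappa> where "\<kappa> = (U\<^sup>2 * p\<^sup>2 * q\<^sup>2 + Z\<^sup>2 * r\<^sup>2 * p\<^sup>2 + V\<^sup>2 * r\<^sup>2 * q\<^sup>2) / 4"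
  define b where "b = a + x * t + y * ((4 * t + 1) * (t - 1)) - 3 * t * z"
  have UR: "U \<in> R" "Z \<in> R" "V \<in> R" unfolding U Z V by (intro add diff mult numeral one R t)+
  have bR: "b \<in> R" unfolding b_def by (intro add diff mult numeral one R t)
  have "2 * \<alpha> = 2 * a + x * (2 * \<xi>) + y * (2 * \<xi>\<^sup>2) + z * (2 * \<alpha>\<^sub>2)"
    unfolding \<alpha> by (simp add: algebra_simps)
  also have "\<dots> = 2 * b + (U * (p * q) + Z * (r * p) + V * (r * q))"
    unfolding \<xi>_coords \<xi>_sq_coords \<alpha>\<^sub>2_coords b_def U Z V by (simp add: algebra_simps)
  also have "\<dots> = 2 * (b + \<beta>)" unfolding \<beta>_def by simp
  finally have \<alpha>\<beta>: "\<alpha> = b + \<beta>" by (simp only: mult_cancel_left) simp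
  have basis: "is_module_basis R (ring_adjoin R \<xi>) 4 (\<lambda>i. \<alpha> ^ i)"
    using gen unfolding generates_relative_power_basis_def by blast
  obtain e0 e1 e2 e3 where e: "e0 \<in> R" "e1 \<in> R" "e2 \<in> R" "e3 \<in> R"
      "\<xi> = e0 + e1 * \<beta> + e2 * \<beta>\<^sup>2 + e3 * \<beta> ^ 3"
    using module_basis_span_shift[OF basis \<xi>_in_order(1) \<alpha>\<beta> bR] by blast
  obtain f0 f1 f2 f3 where f: "f0 \<in> R" "f1 \<in> R" "f2 \<in> R" "f3 \<in> R"
      "\<xi>\<^sup>2 = f0 + f1 * \<beta> + f2 * \<beta>\<^sup>2 + f3 * \<beta> ^ 3"
    using module_basis_span_shift[OF basis \<xi>_in_order(2) \<alpha>\<beta> bR] by blast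
  obtain g0 g1 g2 g3 where g: "g0 \<in> R" "g1 \<in> R" "g2 \<in> R" "g3 \<in> R"
      "\<alpha>\<^sub>2 = g0 + g1 * \<beta> + g2 * \<beta>\<^sup>2 + g3 * \<beta> ^ 3"
    using module_basis_span_shift[OF basis \<xi>_in_order(3) \<alpha>\<beta> bR] by blast
  have c1: "2 * \<xi> = 2 * t + 1 * (p * q) + 1 * (r * p) + 1 * (r * q)" using \<xi>_coords by simp
  have c3: "2 * \<alpha>\<^sub>2 = - 6 * t + 1 * (p * q) + (-1) * (r * p) + (-1) * (r * q)" using \<alpha>\<^sub>2_coords by simp
  have R': "2 * t \<in> R" "2 * (4 * t + 1) * (t - 1) \<in> R" "4 * t \<in> R" "4 * t - 4 \<in> R" "4 * t + 1 \<in> R"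
      "- 6 * t \<in> R" "-1 \<in> R"
    by (intro add diff mult numeral one t uminus)+
  note E = \<beta>_combination_coords[OF UR e(1-4) R'(1) one one one c1 e(5)[unfolded \<beta>_def], folded \<kappa>_def]
  note F = \<beta>_combination_coords[OF UR f(1-4) R'(2-5) \<xi>_sq_coords f(5)[unfolded \<beta>_def], folded \<kappa>_def]
  note G = \<beta>_combination_coords[OF UR g(1-4) R'(6) one R'(7) R'(7) c3 g(5)[unfolded \<beta>_def], folded \<kappa>_def]
  let ?X = "(Z\<^sup>2 * p\<^sup>2 - V\<^sup>2 * q\<^sup>2) * (Z\<^sup>2 * r\<^sup>2 - U\<^sup>2 * q\<^sup>2) * (U\<^sup>2 * p\<^sup>2 - V\<^sup>2 * r\<^sup>2)"
  \<comment> \<open>The coordinate determinant of \<xi>, its square and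
    \<open>\<alpha>\<^sub>2\<close> equals the transition determinant times the three forms. The
    factor e3 / 2 turns 10 into 20 = 5 * 4, the two divisors in the conclusion.\<close>
  have "10 = det3 1 1 1 (4 * t) (4 * t - 4) (4 * t + 1) 1 (-1) (-1)"
    unfolding det3_def by (simp add: algebra_simps)
  also have "\<dots> = det3 (e1 + \<kappa> * e3) e2 (e3 / 2) (f1 + \<kappa> * f3) f2 (f3 / 2) (g1 + \<kappa> * g3) g2 (g3 / 2) * ?X"
    by (subst E(1), subst E(2), subst E(3), subst F(1), subst F(2), subst F(3),
        subst G(1), subst G(2), subst G(3)) (simp only: det3_mult det3_biquadratic)
  also have "det3 (e1 + \<kappa> * e3) e2 (e3 / 2) (f1 + \<kappa> * f3) f2 (f3 / 2) (g1 + \<kappa> * g3) g2 (g3 / 2) =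
      det3 e1 e2 e3 f1 f2 f3 g1 g2 g3 / 2"
    unfolding det3_def by (simp add: field_simps)
  finally have ten: "10 = det3 e1 e2 e3 f1 f2 f3 g1 g2 g3 / 2 * ?X" .
  show thesis
  proof (rule that)
    show "det3 e1 e2 e3 f1 f2 f3 g1 g2 g3 \<in> R"
      unfolding det3_def by (intro add diff mult e f g)
    show "det3 e1 e2 e3 f1 f2 f3 g1 g2 g3 * ((Z\<^sup>2 * p\<^sup>2 - V\<^sup>2 * q\<^sup>2) / 5) * ((Z\<^sup>2 * r\<^sup>2 - U\<^sup>2 * q\<^sup>2) / 4) *
      (U\<^sup>2 * p\<^sup>2 - V\<^sup>2 * r\<^sup>2) = 1"
      using ten by (simp add: mult_ac)
  qed
qed

lemma generates_imp_equivalent: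
  assumes gen: "generates_relative_power_basis R (ring_adjoin R \<xi>) \<alpha>"
  shows "equivalent_over R \<xi> \<alpha> \<or> equivalent_over R \<alpha>\<^sub>2 \<alpha>"
proof -
  have "\<alpha> \<in> ring_adjoin R \<xi>" using gen unfolding generates_relative_power_basis_def by blast
  then obtain c0 c1 c2 c3 where c: "c0 \<in> R" "c1 \<in> R" "c2 \<in> R" "c3 \<in> R"
    "\<alpha> = c0 + c1 * \<xi> + c2 * \<xi>\<^sup>2 + c3 * \<xi> ^ 3" by (rule order_span)
  define x y z where "x = c1 - (6 * t + 2) * c3" and "y = c2 + 4 * t * c3" and "z = c3"
  have R: "x \<in> R" "y \<in> R" "z \<in> R" unfolding x_def y_def z_def by (intro add diff mult numeral t c)+
  have \<alpha>: "\<alpha> = c0 + x * \<xi> + y * \<xi>\<^sup>2 + z * \<alpha>\<^sub>2"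
    unfolding c(5) x_def y_def z_def \<alpha>\<^sub>2_def by (simp add: algebra_simps)
  define U Z V where "U = x + 4 * t * y + z" and "Z = x + (4 * t - 4) * y - z" and "V = x + (4 * t + 1) * y - z"
  have UR: "U \<in> R" "Z \<in> R" "V \<in> R" unfolding U_def Z_def V_def by (intro add diff mult numeral one R t)+
  have VZ: "V = Z + 5 * y" and UZ: "U = Z + 2 * (2 * y + z)"
    unfolding U_def V_def Z_def by (simp_all add: algebra_simps)
  define Q1 where "Q1 = (Z\<^sup>2 * p\<^sup>2 - V\<^sup>2 * q\<^sup>2) / 5"
  define Q2 where "Q2 = (Z\<^sup>2 * r\<^sup>2 - U\<^sup>2 * q\<^sup>2) / 4"
  define Q3 where "Q3 = U\<^sup>2 * p\<^sup>2 - V\<^sup>2 * r\<^sup>2"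
  have "Q1 = Z\<^sup>2 - (2 * t - 4) * (2 * Z * y + 5 * y\<^sup>2)"
    unfolding Q1_def pqr VZ by (simp add: field_simps power2_eq_square)
  then have Q1R: "Q1 \<in> R" by (simp only:) (intro diff add mult numeral power UR R t)
  have "Q2 = Z\<^sup>2 - (2 * t - 4) * ((2 * y + z) * Z + (2 * y + z)\<^sup>2)"
    unfolding Q2_def pqr UZ by (simp add: field_simps power2_eq_square)
  then have Q2R: "Q2 \<in> R" by (simp only:) (intro diff add mult numeral power UR R t)
  have Q3R: "Q3 \<in> R" unfolding Q3_def by (intro diff mult sq_in_R power[OF UR(1)] power[OF UR(3)])
  obtain \<delta> where \<delta>: "\<delta> \<in> R" "\<delta> * Q1 * Q2 * Q3 = 1"
    using generator_index_forms[OF c(1) R \<alpha> U_def Z_def V_def gen] unfolding Q1_def Q2_def Q3_def .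
  then have nz: "\<delta> \<noteq> 0" "Q1 \<noteq> 0" "Q2 \<noteq> 0" "Q3 \<noteq> 0" by auto
  have ge: "cmod \<delta> \<ge> 1" "cmod Q1 \<ge> 1" "cmod Q2 \<ge> 1" "cmod Q3 \<ge> 1"
    using norm_ge_1 \<delta>(1) Q1R Q2R Q3R nz by auto
  have prod: "cmod \<delta> * cmod Q1 * cmod Q2 * cmod Q3 = 1"
    using \<delta>(2) by (metis norm_mult norm_one)
  have g1: "cmod \<delta> * cmod Q1 \<ge> 1" using mult_mono[of 1 "cmod \<delta>" 1 "cmod Q1"] ge by simp
  then have g2: "cmod \<delta> * cmod Q1 * cmod Q2 \<ge> 1"
    using mult_mono[of 1 "cmod \<delta> * cmod Q1" 1 "cmod Q2"] ge by simp
  have n3: "cmod Q3 = 1"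
    using mult_right_mono[OF g2, of "cmod Q3"] ge prod by simp
  have n2: "cmod Q2 = 1"
    using mult_right_mono[OF g1, of "cmod Q2"] ge prod n3 by simp
  have q12: "5 * Q1 = Z\<^sup>2 * p\<^sup>2 - V\<^sup>2 * q\<^sup>2" "4 * Q2 = Z\<^sup>2 * r\<^sup>2 - U\<^sup>2 * q\<^sup>2"
    unfolding Q1_def Q2_def by simp_all
  \<comment> \<open>Both sides are 2 t (Z^2 + 4 V^2 - 5 U^2). The right-hand side has size at most
    8, so the element multiplied by 2 t is 0 and Q2 = Q3.\<close>
  have rel: "2 * t * (5 * Q1 - 4 * Q2 - Q3) = 4 * (Q2 - Q3)"
    unfolding right_diff_distrib[of 4] q12 Q3_def pqr by (simp add: algebra_simps)
  then have "2 * cmod t * cmod (5 * Q1 - 4 * Q2 - Q3) = 4 * cmod (Q2 - Q3)"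
    by (metis norm_mult norm_numeral)
  moreover have "cmod (Q2 - Q3) \<le> 2" using norm_triangle_ineq4[of Q2 Q3] n2 n3 by simp
  moreover have "2 * 1544803 * cmod (5 * Q1 - 4 * Q2 - Q3) \<le> 2 * cmod t * cmod (5 * Q1 - 4 * Q2 - Q3)"
    using t(2) by (intro mult_right_mono) auto
  ultimately have "cmod (5 * Q1 - 4 * Q2 - Q3) < 1" by linarith
  then have "5 * Q1 - 4 * Q2 - Q3 = 0"
    using norm_lt_1_iff[of "5 * Q1 - 4 * Q2 - Q3"] Q1R Q2R Q3R by auto
  then have Q23: "Q2 = Q3"
    using rel by simp
  have eqV: "(2 * t + 1) * U\<^sup>2 - 2 * t * V\<^sup>2 = Q3"
    unfolding Q3_def pqr by (simp add: algebra_simps)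
  have "4 * Q3 = Z\<^sup>2 * (2 * t) - U\<^sup>2 * (2 * t - 4)"
    using Q23 unfolding Q2_def pqr by (simp add: field_simps)
  then have "2 * ((t - 2) * U\<^sup>2 - t * Z\<^sup>2) = 2 * (- 2 * Q3)" by (simp add: algebra_simps)
  then have eqZ: "(t - 2) * U\<^sup>2 - t * Z\<^sup>2 = - 2 * Q3" by (simp only: mult_cancel_left) simp
  have U2: "U\<^sup>2 = Q3"
    by (rule pell_system[OF t n3 UR(1,3,2) eqV eqZ])
  have t0: "t \<noteq> 0" using t(2) by auto
  have V2: "V\<^sup>2 = Q3" using eqV t0 unfolding U2 by (simp add: algebra_simps)
  have Z2: "Z\<^sup>2 = Q3" using eqZ t0 unfolding U2 by (simp add: algebra_simps)
  have Z0: "Z \<noteq> 0" using Z2 nz by auto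
  have "(cmod Z)\<^sup>2 = 1\<^sup>2" using n3 unfolding Z2[symmetric] by (simp add: norm_power)
  then have nZ: "cmod Z = 1" by (rule power2_eq_imp_eq) auto
  have y: "y = 0"
  proof -
    have "V = Z \<or> V = - Z" unfolding power2_eq_iff[symmetric] V2 Z2 ..
    \<comment> \<open>V = - Z would give |y| = 2/5, which is below 1, so y = 0 in either
      case.\<close>
    then have "5 * y = 0 \<or> 5 * y = (- 2) * Z" unfolding VZ by (auto simp: algebra_simps eq_neg_iff_add_eq_0)
    then have "cmod (5 * y) = cmod 0 \<or> cmod (5 * y) = cmod ((- 2) * Z)" by (elim disj_forward) simp_all
    then have "5 * cmod y \<le> 2" unfolding norm_mult using nZ by auto
    then show ?thesis using norm_lt_1_iff[OF R(2)] by simp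
  qed
  \<comment> \<open>As Q3 is invertible with inverse \<delta> Q1 Q2, every square root of it in
    \<open>R\<close> is a unit.\<close>
  have unit: "\<exists>\<eta>\<in>R. v * \<eta> = 1" if "v \<in> R" "v\<^sup>2 = Q3" for v
  proof (rule bexI)
    show "v * (v * (\<delta> * Q1 * Q2)) = 1"
      using \<delta>(2) unfolding that(2)[symmetric] by (simp add: power2_eq_square mult_ac)
    show "v * (\<delta> * Q1 * Q2) \<in> R" using that \<delta> Q1R Q2R by auto
  qed
  \<comment> \<open>Since y = 0, U = x + z and Z = x - z: one sign kills z and gives the class of
    \<xi>, the other kills x and gives that of \<open>\<alpha>\<^sub>2\<close>.\<close>
  have "U = Z \<or> U = - Z" unfolding power2_eq_iff[symmetric] U2 Z2 ..
  then show ?thesis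
  proof
    assume "U = Z"
    then have z: "z = 0" using y unfolding UZ by simp
    then have "\<alpha> = x * \<xi> + c0" "x\<^sup>2 = Q3" using \<alpha> y U2 unfolding U_def by simp_all
    then show ?thesis unfolding equivalent_over_def using R c(1) unit by blast
  next
    assume "U = - Z"
    then have x: "x = 0" using y unfolding U_def Z_def by (simp add: algebra_simps)
    then have "\<alpha> = z * \<alpha>\<^sub>2 + c0" "z\<^sup>2 = Q3" using \<alpha> y U2 unfolding U_def by simp_all
    then show ?thesis unfolding equivalent_over_def using R c(1) unit by blast
  qed
qed

end

theorem theorem2:
  fixes D :: int and M Z\<^sub>M \<O> :: "complex set" and t \<xi> \<alpha>\<^sub>1 \<alpha>\<^sub>2 :: complex
  assumes D: "D > 0" "squarefree D"
    and M: "M = imag_quadratic_field D"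
    and Z\<^sub>M: "Z\<^sub>M = ring_of_integers M"
    and t: "t \<in> Z\<^sub>M"
    and \<xi>: "poly [:1, 4 * t, 6 * t + 2, - 4 * t, 1:] \<xi> = 0"
    and \<O>: "\<O> = ring_adjoin Z\<^sub>M \<xi>"
    and \<alpha>\<^sub>1: "\<alpha>\<^sub>1 = \<xi>"
    and \<alpha>\<^sub>2: "\<alpha>\<^sub>2 = (6 * t + 2) * \<xi> - 4 * t * \<xi> ^ 2 + \<xi> ^ 3"
    and large: "cmod t > 1544803"
  shows "(\<forall>\<alpha>\<in>\<O>. generates_relative_power_basis Z\<^sub>M \<O> \<alpha> \<longleftrightarrow>
            equivalent_over Z\<^sub>M \<alpha>\<^sub>1 \<alpha> \<or> equivalent_over Z\<^sub>M \<alpha>\<^sub>2 \<alpha>)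
         \<and> \<not> equivalent_over Z\<^sub>M \<alpha>\<^sub>1 \<alpha>\<^sub>2"
proof -
  obtain p q r where pqr: "p\<^sup>2 = 2 * t + 1" "q\<^sup>2 = 2 * t - 4" "r\<^sup>2 = 2 * t" "\<xi> = (r + p) * (r + q) / 2"
    using quartic_root_radicals[OF \<xi>] .
  have "discrete_subring Z\<^sub>M"
    unfolding Z\<^sub>M M by (rule discrete_subring_ring_of_integers[OF D(1)])
  then interpret o: quartic_order Z\<^sub>M t p q r
    by (intro quartic_order.intro quartic_order_axioms.intro) (use t large pqr in simp_all)
  have \<xi>': "o.\<xi> = \<xi>" unfolding o.\<xi>_def pqr(4) ..
  have \<alpha>\<^sub>2': "o.\<alpha>\<^sub>2 = \<alpha>\<^sub>2" unfolding o.\<alpha>\<^sub>2_def \<xi>' \<alpha>\<^sub>2 ..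
  show ?thesis
    unfolding \<O> \<alpha>\<^sub>1
    using o.generates_imp_equivalent o.equivalent_imp_generates o.not_equivalent
    unfolding \<xi>' \<alpha>\<^sub>2' by blast
qed

end
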